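(* Let $f$ be a univalent function on the open unit disc $\mathbb{D}=\{z\in\mathbb{C}:|z|<1\}$ with $f(0)=0$, and set $U=f(\mathbb{D})$. Let $(Z_t)_{t\ge 0}$ be a standard planar Brownian motion and let $\tau_U=\inf\{t\ge 0: Z_t\notin U\}$ be its exit time from $U$. Let $\xi$ be any random variable uniformly distributed on the unit circle $\mathbb{T}=\{z\in\mathbb{C}:|z|=1\}$, and let $f(\xi)=\lim_{r\to 1^-}f(r\xi)$ denote the radial boundary value of $f$ at $\xi$ (defined for almost every point of $\mathbb{T}$). Then $Z_{\tau_U}$ and $f(\xi)$ have the same distribution.
   Context: A univalent function on $\mathbb{D}$ is an injective analytic function $f:\mathbb{D}\to\mathbb{C}$. A standard planar Brownian motion is a planar (two-dimensional, viewed as $\mathbb{C}$-valued) Brownian motion started at $0$. "Almost every" on $\mathbb{T}$ is with respect to normalized arc-length (Lebesgue) measure, which is also the law of a uniformly distributed random variable on $\mathbb{T}$. *)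

theory Defs
  imports "HOL-Probability.Probability" "HOL-Complex_Analysis.Complex_Analysis"
begin

text \<open>
  Only the values at times \<open>t \<ge> 0\<close> matter. The density in \<open>gaussian_increments\<close> is that of the
  centred Gaussian with covariance matrix \<open>(t - s) I\<close>, i.e. the real and imaginary parts of an
  increment are independent and normal with variance \<open>t - s\<close>.
\<close>

locale standard_planar_brownian_motion = prob_space M
  for M :: "'a measure" +
  fixes Z :: "real \<Rightarrow> 'a \<Rightarrow> complex"
  assumes measurable: "\<And>t. 0 \<le> t \<Longrightarrow> random_variable borel (Z t)"
    and start: "AE \<omega> in M. Z 0 \<omega> = 0"
    and independent_increments:
      "\<And>(n::nat) (t :: nat \<Rightarrow> real). 0 \<le> t 0 \<Longrightarrow> (\<And>i. i < n \<Longrightarrow> t i < t (Suc i)) \<Longrightarrow>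
        indep_vars (\<lambda>_. borel) (\<lambda>i \<omega>. Z (t (Suc i)) \<omega> - Z (t i) \<omega>) {..<n}"
    and gaussian_increments:
      "\<And>s t. 0 \<le> s \<Longrightarrow> s < t \<Longrightarrow>
        distributed M lborel (\<lambda>\<omega>. Z t \<omega> - Z s \<omega>)
          (\<lambda>z. ennreal (normal_density 0 (sqrt (t - s)) (Re z) *
                         normal_density 0 (sqrt (t - s)) (Im z)))"
    and continuous_paths: "AE \<omega> in M. continuous_on {0..} (\<lambda>t. Z t \<omega>)"

text \<open>The exit time is \<open>\<infinity>\<close> if the path never leaves \<open>U\<close>.\<close>

definition exit_time :: "(real \<Rightarrow> 'a \<Rightarrow> complex) \<Rightarrow> complex set \<Rightarrow> 'a \<Rightarrow> ennreal" where
  "exit_time Z U \<omega> = Inf {ennreal t | t. 0 \<le> t \<and> Z t \<omega> \<notin> U}"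

text \<open>The value is meaningful only where the exit time is finite (\<open>enn2real \<infinity> = 0\<close>).\<close>

definition exit_position :: "(real \<Rightarrow> 'a \<Rightarrow> complex) \<Rightarrow> complex set \<Rightarrow> 'a \<Rightarrow> complex" where
  "exit_position Z U \<omega> = Z (enn2real (exit_time Z U \<omega>)) \<omega>"

definition has_radial_limit :: "(complex \<Rightarrow> complex) \<Rightarrow> complex \<Rightarrow> bool" where
  "has_radial_limit f \<zeta> \<longleftrightarrow> (\<exists>L. ((\<lambda>r. f (of_real r * \<zeta>)) \<longlongrightarrow> L) (at_left 1))"

definition radial_limit :: "(complex \<Rightarrow> complex) \<Rightarrow> complex \<Rightarrow> complex" where
  "radial_limit f \<zeta> = Lim (at_left 1) (\<lambda>r. f (of_real r * \<zeta>))"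

text \<open>Normalized arc length on the unit circle, as a Borel measure on the plane.\<close>

definition circle_measure :: "complex measure" where
  "circle_measure = distr (uniform_measure lborel {0..2 * pi}) borel cis"

definition uniform_on_circle :: "'a measure \<Rightarrow> ('a \<Rightarrow> complex) \<Rightarrow> bool" where
  "uniform_on_circle M \<xi> \<longleftrightarrow>
     prob_space M \<and> \<xi> \<in> borel_measurable M \<and> distr M borel \<xi> = circle_measure"

text \<open>
  Equality in law for variables that are determined only almost surely (such as exit positions
  and boundary values) and hence measurable only with respect to the completion. Measurability
  is demanded explicitly because \<open>distr\<close> is meaningless for non-measurable functions. For
  \<open>M\<close>-measurable \<open>X\<close>, \<open>distr (completion M) borel X\<close> coincides with \<open>distr M borel X\<close>.
\<close>

definition same_distribution ::
  "'a measure \<Rightarrow> ('a \<Rightarrow> complex) \<Rightarrow> 'b measure \<Rightarrow> ('b \<Rightarrow> complex) \<Rightarrow> bool" where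
  "same_distribution M X N Y \<longleftrightarrow>
     X \<in> borel_measurable (completion M) \<and> Y \<in> borel_measurable (completion N) \<and>
     distr (completion M) borel X = distr (completion N) borel Y"

end

theory Submission
  imports Defs "HOL-Real_Asymp.Real_Asymp"
begin

text \<open>
  Sample the path at times \<open>t0 + i / 2 ^ m\<close> and stop at the first sample outside a compact set \<open>K\<close>.
  Gaussian increments are rotation invariant, so a function that is harmonic near \<open>K\<close> has exactly
  the mean value property on increments smaller than some \<open>\<rho>\<close>, and large increments are
  exponentially unlikely; letting \<open>m \<rightarrow> \<infinity>\<close> yields optional stopping at the exit from \<open>K\<close>
  for harmonic functions, without any stochastic calculus.

  Let \<open>g\<close> be the inverse of \<open>f\<close>. Applied to \<open>Re (a * g ^ n)\<close> this shows that the exit point from \<open>f (r D)\<close> is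
  distributed as \<open>f (r \<xi>)\<close>. Applied to \<open>ln |z|\<close> on annuli it gives recurrence. Applied to
  \<open>- ln |g|\<close> it shows that a path which is close to the boundary of \<open>U\<close> at some late time probably
  leaves \<open>U\<close> before it visits a fixed disc again; together with recurrence, \<open>U\<close> is left
  almost surely. Hence the exit points from \<open>f (r D)\<close> converge to the exit position as \<open>r \<rightarrow> 1\<close>.

  Radial limits, possibly infinite, exist almost everywhere because \<open>f = c + (1 / k - b)\<^sup>2\<close>
  with \<open>k\<close> bounded and univalent: the image of \<open>k\<close> has finite area, so \<open>k\<close> maps almost every
  radius to a curve of finite length. They are finite because \<open>f (r \<xi>)\<close>
  is tight, being distributed as a convergent sequence of exit points.
\<close>

section \<open>Area of univalent images\<close>

text \<open>Restarts happen only at deterministic times \<open>t0\<close>: conditioning on the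
  position there is an indicator factor \<open>indicator C (Z t0 \<omega>)\<close> inside the
  expectation. The late time in the exit argument is likewise a fixed integer, chosen so large that
  the decay 1 / t of the Gaussian density makes a compact part of \<open>U\<close> an unlikely place
  to be. The functions \<open>Re (a * g ^ n)\<close> determine a law because on the circle products
  of real parts of polynomials are again of this form, so Stone-Weierstrass reduces every continuous
  test function to these moments. A measurability obstacle shapes the last part: the exit position
  involves an infimum over uncountably many times, the radial limit a continuum of radii. Both are
  replaced by limits of sequences of Borel functions, \<open>exit_limit\<close> and
  \<open>boundary_limit\<close>, which agree with them almost everywhere; the laws of these versions
  are compared and the result is transferred to the completion.\<close>

lemma distr_lborel_Complex:
  "distr (lborel :: (real \<times> real) measure) borel (\<lambda>(x, y). Complex x y) = lborel"
proof (rule lborel_eqI[symmetric])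
  have meas: "(\<lambda>(x, y). Complex x y) \<in> borel_measurable (borel :: (real \<times> real) measure)"
    unfolding Complex_eq split_beta by (intro borel_measurable_continuous_onI continuous_intros)
  fix l u :: complex assume le: "\<And>b. b \<in> Basis \<Longrightarrow> l \<bullet> b \<le> u \<bullet> b"
  have le': "Re l \<le> Re u" "Im l \<le> Im u"
    using le[of 1] le[of \<i>] by (auto simp: Basis_complex_def inner_complex_def)
  have pre: "(\<lambda>(x, y). Complex x y) -` box l u \<inter> space lborel = box (Re l, Im l) (Re u, Im u)"
    by (auto simp: box_def Basis_complex_def Basis_prod_def inner_complex_def)
  show "emeasure (distr (lborel :: (real \<times> real) measure) borel (\<lambda>(x, y). Complex x y)) (box l u)
    = (\<Prod>b\<in>Basis. (u - l) \<bullet> b)"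
    using le' meas
    by (subst emeasure_distr)
       (auto simp del: space_lborel simp add: pre emeasure_lborel_box_eq Basis_prod_def Basis_complex_def inner_complex_def
         prod.union_disjoint ennreal_mult mult.commute)
qed simp

text \<open>The change of variables theorem is phrased with determinants on
  \<open>real ^ 'n\<close>; this identification carries it over to \<open>complex\<close>.\<close>

lemma distr_lborel_vec2:
  "distr (lborel :: (real ^ 2) measure) borel (\<lambda>v. Complex (v $ 1) (v $ 2)) = lborel"
proof (rule lborel_eqI[symmetric])
  have meas: "(\<lambda>v. Complex (v $ 1) (v $ 2)) \<in> borel_measurable (borel :: (real ^ 2) measure)"
    unfolding Complex_eq by (intro borel_measurable_continuous_onI continuous_intros)
  fix l u :: complex assume le: "\<And>b. b \<in> Basis \<Longrightarrow> l \<bullet> b \<le> u \<bullet> b"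
  have le': "Re l \<le> Re u" "Im l \<le> Im u"
    using le[of 1] le[of \<i>] by (auto simp: Basis_complex_def inner_complex_def)
  have pre: "(\<lambda>v. Complex (v $ 1) (v $ 2)) -` box l u \<inter> space lborel = box (vector [Re l, Im l]) (vector [Re u, Im u] :: real ^ 2)"
    by (auto simp: box_def Basis_complex_def Basis_vec_def inner_complex_def inner_axis forall_2)
  show "emeasure (distr (lborel :: (real ^ 2) measure) borel (\<lambda>v. Complex (v $ 1) (v $ 2))) (box l u)
    = (\<Prod>b\<in>Basis. (u - l) \<bullet> b)"
    using le' meas
    by (subst emeasure_distr)
       (auto simp del: space_lborel simp add: pre emeasure_lborel_box_eq Basis_vec_def Basis_complex_def inner_complex_def
         inner_axis UNIV_2 axis_eq_axis forall_2)
qed simp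

text \<open>Change of variables: by the Cauchy-Riemann equations the Jacobian of a holomorphic map
  is \<open>(cmod (deriv G z))\<^sup>2\<close>, and injectivity makes every image point count
  once.\<close>

lemma nn_integral_deriv_square:
  assumes S: "open S" and G: "G holomorphic_on S" and inj: "inj_on G S" and bdd: "bounded (G ` S)"
  shows "(\<integral>\<^sup>+z. ennreal ((cmod (deriv G z))\<^sup>2) * indicator S z \<partial>lborel) = emeasure lborel (G ` S)"
proof -
  define T :: "real ^ 2 \<Rightarrow> complex" where "T = (\<lambda>v. Complex (v $ 1) (v $ 2))"
  define T' :: "complex \<Rightarrow> real ^ 2" where "T' = (\<lambda>z. vector [Re z, Im z])"
  have TT' [simp]: "T (T' z) = z" for z by (simp add: T_def T'_def complex_eq_iff)
  have T'T [simp]: "T' (T v) = v" for v by (simp add: T_def T'_def vec_eq_iff forall_2)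
  have linT: "bounded_linear T"
    by (rule linear_conv_bounded_linear[THEN iffD1], rule linearI) (auto simp: T_def complex_eq_iff)
  have linT': "bounded_linear T'"
    by (rule linear_conv_bounded_linear[THEN iffD1], rule linearI) (auto simp: T'_def vec_eq_iff forall_2)
  have contT: "continuous_on UNIV T" using linT by (simp add: linear_continuous_on)
  have measT [measurable]: "T \<in> borel_measurable borel"
    using contT by (rule borel_measurable_continuous_onI)
  define S' where "S' = T -` S"
  define g where "g = (\<lambda>v. T' (G (T v)))"
  have S': "open S'" unfolding S'_def using contT S by (rule open_vimage[rotated])
  have GS: "open (G ` S)" by (rule open_mapping_thm3[OF G S inj])
  have img: "g ` S' = T -` (G ` S)"
  proof
    show "T -` (G ` S) \<subseteq> g ` S'"
    proof
      fix v assume "v \<in> T -` (G ` S)"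
      then obtain z where z: "z \<in> S" "T v = G z" by auto
      have "v = g (T' z)" using z(2) T'T[of v] by (simp add: g_def)
      moreover have "T' z \<in> S'" using z(1) by (simp add: S'_def)
      ultimately have "v = g (T' z)" "T' z \<in> S'" by simp_all
      then show "v \<in> g ` S'" by blast
    qed
  qed (auto simp: g_def S'_def)
  have "bounded (T' ` (G ` S))" by (rule bounded_linear_image[OF bdd linT'])
  moreover have "T' ` (G ` S) = g ` S'"
  proof -
    have "T ` S' = S" unfolding S'_def by (auto intro: image_eqI[where x="T' _"])
    moreover have "g = T' \<circ> G \<circ> T" by (simp add: g_def fun_eq_iff)
    ultimately show ?thesis by (metis image_comp)
  qed
  ultimately have bdd': "bounded (g ` S')" by simp
  have op': "open (g ` S')" unfolding img using contT GS by (rule open_vimage[rotated])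
  have lm: "g ` S' \<in> lmeasurable" using bdd' op' by (rule lmeasurable_open)
  have der: "(g has_derivative (\<lambda>h. T' (deriv G (T v) * T h))) (at v within S')" if "v \<in> S'" for v
  proof -
    have "(G has_field_derivative deriv G (T v)) (at (T v))"
      using that G S by (auto simp: S'_def intro: holomorphic_derivI)
    then have "((\<lambda>v. G (T v)) has_derivative (\<lambda>h. deriv G (T v) * T h)) (at v)"
      unfolding has_field_derivative_def
      by (rule has_derivative_compose[OF bounded_linear_imp_has_derivative[OF linT]])
    then show ?thesis unfolding g_def
      by (rule has_derivative_at_withinI[OF bounded_linear.has_derivative[OF linT']])
  qed
  \<comment> \<open>Multiplication by \<open>c\<close> is a rotation scaled by
    \<open>cmod c\<close>.\<close>
  have det: "\<bar>det (matrix (\<lambda>h. T' (c * T h)))\<bar> = (cmod c)\<^sup>2" for c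
    using cmod_power2[of c] by (simp add: det_2 matrix_def T_def T'_def axis_def power2_eq_square)
  have inj': "inj_on g S'"
  proof (rule inj_onI)
    fix v w assume vw: "v \<in> S'" "w \<in> S'" "g v = g w"
    from vw(3) have "T (g v) = T (g w)" by simp
    then have "G (T v) = G (T w)" by (simp add: g_def)
    then have "T v = T w" using vw inj by (auto simp: S'_def dest: inj_onD)
    then show "v = w" by (metis T'T)
  qed
  have "((\<lambda>v. (cmod (deriv G (T v)))\<^sup>2) has_integral measure lebesgue (g ` S')) S'"
    using has_measure_differentiable_image[OF _ der inj', of "measure lebesgue (g ` S')"] lm S'
    by (simp add: det borel_open sets_completionI_sets)
  note hi = this
  have derG: "continuous_on S (deriv G)" 
    using G S holomorphic_deriv holomorphic_on_imp_continuous_on by blast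
  have mS [measurable]: "S \<in> sets borel" using S by simp
  have meas: "(\<lambda>z. ennreal ((cmod (deriv G z))\<^sup>2) * indicator S z) \<in> borel_measurable borel"
  proof -
    have "(\<lambda>z. indicator S z *\<^sub>R deriv G z) \<in> borel_measurable borel"
      using borel_measurable_continuous_on_indicator[OF _ derG] mS by simp
    then have "(\<lambda>z. ennreal ((cmod (indicator S z *\<^sub>R deriv G z))\<^sup>2)) \<in> borel_measurable borel"
      by measurable
    also have "(\<lambda>z. ennreal ((cmod (indicator S z *\<^sub>R deriv G z))\<^sup>2)) = (\<lambda>z. ennreal ((cmod (deriv G z))\<^sup>2) * indicator S z)"
      by (auto simp: indicator_def)
    finally show ?thesis .
  qed
  have "(\<integral>\<^sup>+z. ennreal ((cmod (deriv G z))\<^sup>2) * indicator S z \<partial>lborel)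
     = (\<integral>\<^sup>+v. ennreal ((cmod (deriv G (T v)))\<^sup>2) * indicator S (T v) \<partial>lborel)"
    using meas measT by (subst distr_lborel_vec2[folded T_def, symmetric], subst nn_integral_distr) auto
  also have "\<dots> = (\<integral>\<^sup>+v. indicator S' v * ennreal ((cmod (deriv G (T v)))\<^sup>2) \<partial>lborel)"
    by (intro nn_integral_cong) (auto simp: S'_def indicator_def)
  also have "\<dots> = ennreal (measure lebesgue (g ` S'))"
    using nn_integral_has_integral_lebesgue'[OF _ hi] by (simp add: mult.commute)
  also have "\<dots> = emeasure lebesgue (g ` S')" 
    using emeasure_eq_measure2[OF lm] by simp
  also have "\<dots> = emeasure lborel (T -` (G ` S))" using op' by (simp add: img)
  also have "\<dots> = emeasure (distr lborel borel T) (G ` S)"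
    using GS measT by (subst emeasure_distr) auto
  also have "\<dots> = emeasure lborel (G ` S)" using distr_lborel_vec2 by (simp add: T_def)
  finally show ?thesis .
qed

text \<open>The area formula applied to the inverse rotation, whose derivative has modulus
  1.\<close>

lemma distr_lborel_rotation: "distr lborel borel (\<lambda>z. cis \<theta> * z) = lborel"
proof (rule lborel_eqI[symmetric])
  fix l u :: complex assume le: "\<And>b. b \<in> Basis \<Longrightarrow> l \<bullet> b \<le> u \<bullet> b"
  have "emeasure (distr lborel borel (\<lambda>z. cis \<theta> * z)) (box l u) = emeasure lborel ((\<lambda>z. cis (-\<theta>) * z) ` box l u)"
  proof (subst emeasure_distr)
    have "(\<lambda>z. cis \<theta> * z) -` box l u \<inter> space lborel = (\<lambda>z. cis (-\<theta>) * z) ` box l u"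
    proof -
      have inv: "cis (-\<theta>) * (cis \<theta> * x) = x" "cis \<theta> * (cis (-\<theta>) * x) = x" for x
        by (simp_all add: mult.assoc[symmetric] cis_mult)
      show ?thesis
      proof (intro equalityI subsetI)
        fix x assume "x \<in> (\<lambda>z. cis \<theta> * z) -` box l u \<inter> space lborel"
        then show "x \<in> (\<lambda>z. cis (-\<theta>) * z) ` box l u"
          by (intro image_eqI[where x="cis \<theta> * x"]) (simp_all only: inv, simp)
      next
        fix x assume "x \<in> (\<lambda>z. cis (-\<theta>) * z) ` box l u"
        then obtain y where "y \<in> box l u" "x = cis (-\<theta>) * y" by blast
        then show "x \<in> (\<lambda>z. cis \<theta> * z) -` box l u \<inter> space lborel"
          by (simp only: vimage_eq Int_iff inv space_lborel space_borel UNIV_I simp_thms)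
      qed
    qed
    then show "emeasure lborel ((*) (cis \<theta>) -` box l u \<inter> space lborel) = emeasure lborel ((*) (cis (- \<theta>)) ` box l u)"
      by simp
  qed auto
  also have "\<dots> = (\<integral>\<^sup>+z. ennreal ((cmod (deriv (\<lambda>z. cis (-\<theta>) * z) z))\<^sup>2) * indicator (box l u) z \<partial>lborel)"
    by (rule nn_integral_deriv_square[symmetric])
       (auto intro!: holomorphic_intros inj_onI bounded_linear_image bounded_linear_mult_right)
  also have "deriv (\<lambda>z. cis (-\<theta>) * z) = (\<lambda>z. cis (-\<theta>))"
    by (intro ext DERIV_imp_deriv) (auto intro!: derivative_eq_intros)
  also have "(\<integral>\<^sup>+z. ennreal ((cmod (cis (- \<theta>)))\<^sup>2) * indicator (box l u) z \<partial>lborel) = emeasure lborel (box l u)"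
    by simp
  also have "\<dots> = ennreal (\<Prod>b\<in>Basis. (u - l) \<bullet> b)" using le by (simp add: emeasure_lborel_box)
  finally show "emeasure (distr lborel borel (\<lambda>z. cis \<theta> * z)) (box l u) = ennreal (\<Prod>b\<in>Basis. (u - l) \<bullet> b)" .
qed simp

section \<open>Radial limits of univalent functions\<close>

text \<open>On a bounded interval a square integrable derivative is integrable, so the curve has
  finite length; up to a constant it is an indefinite integral, which is continuous up to the
  endpoint.\<close>

lemma tendsto_at_left_0_of_integrable_deriv:
  fixes g g' :: "real \<Rightarrow> complex"
  assumes der: "\<And>x. a < x \<Longrightarrow> x < 0 \<Longrightarrow> (g has_vector_derivative g' x) (at x)"
    and cont: "continuous_on {a<..<0} g'"
    and fin: "(\<integral>\<^sup>+x. ennreal ((cmod (g' x))\<^sup>2) * indicator {a<..<0} x \<partial>lborel) < \<infinity>"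
    and a: "a < 0"
  shows "\<exists>L. (g \<longlongrightarrow> L) (at_left 0)"
proof -
  have m [measurable]: "(\<lambda>x. indicator {a<..<0} x *\<^sub>R g' x) \<in> borel_measurable borel"
    using borel_measurable_continuous_on_indicator[OF _ cont] by simp
  have "(\<integral>\<^sup>+x. ennreal (norm (indicator {a<..<0} x *\<^sub>R g' x)) \<partial>lborel)
    \<le> (\<integral>\<^sup>+x. indicator {a<..<0} x + ennreal ((cmod (g' x))\<^sup>2) * indicator {a<..<0} x \<partial>lborel)"
  proof (rule nn_integral_mono)
    fix x :: real
    \<comment> \<open>This gives \<open>cmod (g' x) \<le> 1 + (cmod (g' x))\<^sup>2\<close>, which
      turns square integrability into integrability.\<close>
    have "0 \<le> (cmod (g' x) - 1)\<^sup>2" by simp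
    then have "2 * cmod (g' x) \<le> 1 + (cmod (g' x))\<^sup>2" by (simp add: power2_eq_square algebra_simps)
    then have "cmod (g' x) \<le> 1 + (cmod (g' x))\<^sup>2" using norm_ge_zero[of "g' x"] by linarith
    then have "ennreal (cmod (g' x)) \<le> 1 + ennreal ((cmod (g' x))\<^sup>2)"
      by (metis ennreal_leI ennreal_plus ennreal_1 zero_le_one zero_le_power2)
    then show "ennreal (norm (indicator {a<..<0} x *\<^sub>R g' x)) \<le> indicator {a<..<0} x + ennreal ((cmod (g' x))\<^sup>2) * indicator {a<..<0} x"
      by (auto simp: indicator_def)
  qed
  also have "\<dots> = (\<integral>\<^sup>+x. indicator {a<..<0} x \<partial>lborel) + (\<integral>\<^sup>+x. ennreal ((cmod (g' x))\<^sup>2) * indicator {a<..<0} x \<partial>lborel)"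
  proof (rule nn_integral_add)
    have "(\<lambda>x. ennreal ((cmod (indicator {a<..<0} x *\<^sub>R g' x))\<^sup>2)) \<in> borel_measurable lborel" by measurable
    also have "(\<lambda>x. ennreal ((cmod (indicator {a<..<0} x *\<^sub>R g' x))\<^sup>2)) = (\<lambda>x. ennreal ((cmod (g' x))\<^sup>2) * indicator {a<..<0} x)"
      by (auto simp: indicator_def)
    finally show "(\<lambda>x. ennreal ((cmod (g' x))\<^sup>2) * indicator {a<..<0} x) \<in> borel_measurable lborel" .
  qed auto
  also have "\<dots> < \<infinity>" using fin a by simp
  finally have "set_integrable lborel {a<..<0} g'"
    unfolding set_integrable_def by (intro integrableI_bounded) auto
  then have "g' integrable_on {a<..<0}" by (rule set_borel_integral_eq_integral(1))
  then have int: "g' integrable_on {a..0}"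
    by (simp add: integrable_on_open_interval_real)
  \<comment> \<open>\<open>g\<close> is differentiable only strictly inside the interval, so the
    fundamental theorem starts from an interior point.\<close>
  define b where "b = a / 2"
  have b: "a < b" "b < 0" using a by (auto simp: b_def)
  have int': "g' integrable_on {b..0}" by (rule integrable_subinterval_real[OF int]) (use b in auto)
  have "continuous_on {b..0} (\<lambda>x. integral {b..x} g')"
    by (rule indefinite_integral_continuous_1[OF int'])
  then have "((\<lambda>x. integral {b..x} g') \<longlongrightarrow> integral {b..0} g') (at 0 within {b..0})"
    using b by (auto simp: continuous_on_def)
  then have lim: "((\<lambda>x. integral {b..x} g') \<longlongrightarrow> integral {b..0} g') (at_left 0)"
    using b at_within_Icc_at_left by metis
  have ev: "eventually (\<lambda>x. b < x \<and> x < 0) (at_left (0::real))"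
    using b eventually_at_left_real by (metis (mono_tags, lifting) eventually_mono greaterThanLessThan_iff)
  have eq: "integral {b..x} g' + g b = g x" if "b < x" "x < 0" for x
  proof -
    have "(g' has_integral (g x - g b)) {b..x}"
    proof (rule fundamental_theorem_of_calculus)
      fix y assume "y \<in> {b..x}"
      then show "(g has_vector_derivative g' y) (at y within {b..x})"
        using der[of y] b that by (auto intro: has_vector_derivative_at_within)
    qed (use that in auto)
    then show ?thesis by (simp add: integral_unique)
  qed
  have "((\<lambda>x. integral {b..x} g' + g b) \<longlongrightarrow> integral {b..0} g' + g b) (at_left 0)"
    by (intro tendsto_add lim tendsto_const)
  then have "(g \<longlongrightarrow> integral {b..0} g' + g b) (at_left 0)"
    by (rule Lim_transform_eventually) (use ev eq in \<open>auto elim: eventually_mono\<close>)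
  then show ?thesis by blast
qed

text \<open>Length-area argument: by Tonelli the finite area of the image is the integral over
  heights \<open>y\<close> of the squared derivative along horizontal segments, so almost every
  segment carries a finite integral.\<close>

lemma AE_tendsto_vertical_side:
  defines "R \<equiv> \<lambda>a c d. {z. a < Re z \<and> Re z < 0 \<and> c < Im z \<and> Im z < d}"
  assumes G: "G holomorphic_on R a c d"
    and inj: "inj_on G (R a c d)" and bdd: "bounded (G ` R a c d)" and a: "a < 0"
  shows "AE y in lborel. c < y \<and> y < d \<longrightarrow> (\<exists>L. ((\<lambda>x. G (Complex x y)) \<longlongrightarrow> L) (at_left 0))"
proof -
  let ?R = "R a c d"
  have R_eq: "?R = {z. a < Re z \<and> Re z < 0 \<and> c < Im z \<and> Im z < d}" by (simp add: R_def)
  have R: "open ?R"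
  proof -
    have "?R = {z. a < Re z} \<inter> {z. Re z < 0} \<inter> {z. c < Im z} \<inter> {z. Im z < d}" by (auto simp: R_eq)
    then show ?thesis by (auto intro!: open_Int open_halfspace_Re_gt open_halfspace_Re_lt open_halfspace_Im_gt open_halfspace_Im_lt)
  qed
  define h where "h = (\<lambda>z. ennreal ((cmod (deriv G z))\<^sup>2) * indicator ?R z)"
  have derG: "continuous_on ?R (deriv G)" 
    using G R holomorphic_deriv holomorphic_on_imp_continuous_on by blast
  have mh [measurable]: "h \<in> borel_measurable borel"
  proof -
    have "(\<lambda>z. indicator ?R z *\<^sub>R deriv G z) \<in> borel_measurable borel"
      using borel_measurable_continuous_on_indicator[OF _ derG] R by simp
    then have "(\<lambda>z. ennreal ((cmod (indicator ?R z *\<^sub>R deriv G z))\<^sup>2)) \<in> borel_measurable borel"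
      by measurable
    also have "(\<lambda>z. ennreal ((cmod (indicator ?R z *\<^sub>R deriv G z))\<^sup>2)) = h"
      unfolding h_def by (auto simp: indicator_def)
    finally show ?thesis .
  qed
  have mC: "(\<lambda>(x, y). Complex x y) \<in> borel_measurable (borel \<Otimes>\<^sub>M borel)"
    unfolding borel_prod Complex_eq split_beta by (intro borel_measurable_continuous_onI continuous_intros)
  then have mhC: "(\<lambda>(x, y). h (Complex x y)) \<in> borel_measurable (lborel \<Otimes>\<^sub>M lborel)"
    using measurable_compose[OF mC mh] by (simp add: split_beta')
  have "(\<integral>\<^sup>+y. (\<integral>\<^sup>+x. h (Complex x y) \<partial>lborel) \<partial>lborel) = (\<integral>\<^sup>+(x,y). h (Complex x y) \<partial>(lborel \<Otimes>\<^sub>M lborel))"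
    using lborel_pair.nn_integral_snd[OF mhC] by simp
  also have "\<dots> = (\<integral>\<^sup>+p. h p \<partial>distr (lborel \<Otimes>\<^sub>M lborel) borel (\<lambda>(x, y). Complex x y))"
    using mC by (subst nn_integral_distr) (auto simp: split_beta' measurable_cong_sets[OF sets_pair_measure_cong[OF sets_lborel sets_lborel] refl])
  also have "\<dots> = (\<integral>\<^sup>+p. h p \<partial>lborel)"
    unfolding lborel_prod distr_lborel_Complex ..
  also have "\<dots> = emeasure lborel (G ` ?R)"
    unfolding h_def by (rule nn_integral_deriv_square[OF R G inj bdd])
  also have "\<dots> < \<infinity>" using bdd by (rule emeasure_bounded_finite)
  finally have fin: "(\<integral>\<^sup>+y. (\<integral>\<^sup>+x. h (Complex x y) \<partial>lborel) \<partial>lborel) \<noteq> \<infinity>" by simp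
  have "(\<lambda>y. \<integral>\<^sup>+x. h (Complex x y) \<partial>lborel) \<in> borel_measurable lborel"
    using measurable_pair_swap[OF mhC] by (intro lborel.borel_measurable_nn_integral) simp
  then have "AE y in lborel. (\<integral>\<^sup>+x. h (Complex x y) \<partial>lborel) \<noteq> \<infinity>"
    using fin by (intro nn_integral_PInf_AE)
  then show ?thesis
  proof (rule AE_mp, intro AE_I2 impI)
    fix y assume fy: "(\<integral>\<^sup>+x. h (Complex x y) \<partial>lborel) \<noteq> \<infinity>" and y: "c < y \<and> y < d"
    show "\<exists>L. ((\<lambda>x. G (Complex x y)) \<longlongrightarrow> L) (at_left 0)"
    proof (rule tendsto_at_left_0_of_integrable_deriv[OF _ _ _ a])
      fix x assume "a < x" "x < 0"
      then have "Complex x y \<in> ?R" using y by (simp add: R_eq)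
      then have "(G has_field_derivative deriv G (Complex x y)) (at (Complex x y))"
        using G R by (auto intro: holomorphic_derivI)
      moreover have "((\<lambda>x. Complex x y) has_vector_derivative 1) (at x)"
        unfolding Complex_eq by (auto intro!: derivative_eq_intros)
      ultimately show "((\<lambda>x. G (Complex x y)) has_vector_derivative deriv G (Complex x y)) (at x)"
        using field_vector_diff_chain_at[of "\<lambda>x. Complex x y" 1 x G] by (simp add: o_def)
    next
      show "continuous_on {a<..<0} (\<lambda>x. deriv G (Complex x y))"
        by (rule continuous_on_compose2[OF derG]) (use y in \<open>auto simp: R_eq Complex_eq intro!: continuous_intros\<close>)
      have "(\<integral>\<^sup>+x. ennreal ((cmod (deriv G (Complex x y)))\<^sup>2) * indicator {a<..<0} x \<partial>lborel) = (\<integral>\<^sup>+x. h (Complex x y) \<partial>lborel)"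
        using y by (intro nn_integral_cong) (auto simp: h_def R_eq indicator_def)
      then show "(\<integral>\<^sup>+x. ennreal ((cmod (deriv G (Complex x y)))\<^sup>2) * indicator {a<..<0} x \<partial>lborel) < \<infinity>"
        using fy by (simp add: less_top)
    qed
  qed
qed

text \<open>In logarithmic coordinates radii become horizontal segments ending on the side
  \<open>Re z = 0\<close>. The height \<open>2 * pi\<close> keeps \<open>exp\<close> injective on
  the rectangle, whose image is a slit annulus along the unit circle.\<close>

lemma AE_radial_limit_bounded_univalent:
  assumes k: "k holomorphic_on ball 0 1" and inj: "inj_on k (ball 0 1)" and bdd: "bounded (k ` ball 0 1)"
  shows "AE \<theta> in lborel. 0 < \<theta> \<and> \<theta> < 2 * pi \<longrightarrow> (\<exists>L. ((\<lambda>r. k (of_real r * cis \<theta>)) \<longlongrightarrow> L) (at_left 1))"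
proof -
  define R where "R = {z. -1 < Re z \<and> Re z < 0 \<and> 0 < Im z \<and> Im z < 2 * pi}"
  have exp_ball: "exp ` R \<subseteq> ball 0 1" by (auto simp: R_def)
  have "inj_on exp R"
  proof (rule inj_onI)
    fix z w assume zw: "z \<in> R" "w \<in> R" "exp z = exp w"
    then obtain n :: int where n: "z = w + (of_int (2 * n) * pi) * \<i>" by (auto simp: exp_eq)
    then have "Im z - Im w = of_int n * (2 * pi)" by simp
    moreover have "Im z - Im w < 2 * pi" "- (2 * pi) < Im z - Im w" using zw by (simp_all add: R_def)
    ultimately have "of_int n * (2 * pi) < 1 * (2 * pi)" "(-1) * (2 * pi) < of_int n * (2 * pi)"
      by linarith+
    then have "real_of_int n < 1" "-1 < real_of_int n"
      using pi_gt_zero by (simp_all only: mult_less_cancel_right_pos[of "2 * pi"] zero_less_mult_iff zero_less_numeral simp_thms)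
    then have "n = 0" by linarith
    then show "z = w" using n by simp
  qed
  then have inj': "inj_on (k \<circ> exp) R" using inj exp_ball by (intro comp_inj_on) (auto intro: inj_on_subset)
  have hol: "(k \<circ> exp) holomorphic_on R"
    using k exp_ball by (intro holomorphic_on_compose) (auto intro: holomorphic_intros holomorphic_on_subset)
  have "bounded ((k \<circ> exp) ` R)"
    by (rule bounded_subset[OF bdd]) (use exp_ball in auto)
  note AE_tendsto_vertical_side[OF hol[unfolded R_def] inj'[unfolded R_def] this[unfolded R_def]]
  then have ae: "AE y in lborel. 0 < y \<and> y < 2 * pi \<longrightarrow> (\<exists>L. ((\<lambda>x. (k \<circ> exp) (Complex x y)) \<longlongrightarrow> L) (at_left 0))"
    by simp
  have ln: "filterlim ln (at_left 0) (at_left (1::real))"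
    unfolding filterlim_at
  proof
    show "(ln \<longlongrightarrow> 0) (at_left (1::real))" using tendsto_ln[OF tendsto_ident_at, of 1 "{..<1}"] by simp
    show "\<forall>\<^sub>F x in at_left (1::real). ln x \<in> {..<0} \<and> ln x \<noteq> 0"
      using eventually_at_left_real[of 0 1] by (auto elim!: eventually_mono)
  qed
  have eq: "eventually (\<lambda>r. (k \<circ> exp) (Complex (ln r) y) = k (of_real r * cis y)) (at_left (1::real))" for y
    using eventually_at_left_real[of 0 1] 
    by (auto elim!: eventually_mono simp: exp_eq_polar)
  show ?thesis
  proof (rule AE_mp[OF ae], intro AE_I2 impI)
    fix y assume *: "0 < y \<and> y < 2 * pi \<longrightarrow> (\<exists>L. ((\<lambda>x. (k \<circ> exp) (Complex x y)) \<longlongrightarrow> L) (at_left 0))"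
      and "0 < y \<and> y < 2 * pi"
    then obtain L where "((\<lambda>x. (k \<circ> exp) (Complex x y)) \<longlongrightarrow> L) (at_left 0)" by blast
    then have "((\<lambda>r. (k \<circ> exp) (Complex (ln r) y)) \<longlongrightarrow> L) (at_left 1)"
      by (rule filterlim_compose[OF _ ln])
    then show "\<exists>L. ((\<lambda>r. k (of_real r * cis y)) \<longlongrightarrow> L) (at_left 1)"
      using Lim_transform_eventually[OF _ eq] by blast
  qed
qed

text \<open>Otherwise the inverse would be a bounded entire function, hence constant by Liouville.
  The omitted value \<open>c\<close> is what makes a square root of \<open>f - c\<close>
  available.\<close>

lemma univalent_image_not_UNIV:
  assumes f: "f holomorphic_on ball 0 1" and inj: "inj_on f (ball 0 1)"
  shows "f ` ball 0 1 \<noteq> UNIV"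
proof
  assume U: "f ` ball 0 1 = UNIV"
  obtain g where g: "g holomorphic_on (f ` ball 0 1)" "\<And>z. z \<in> ball 0 1 \<Longrightarrow> g (f z) = z"
    by (rule holomorphic_has_inverse[OF f open_ball inj]) (rule that)
  have "range g = ball 0 1"
  proof -
    have "g ` f ` ball 0 1 = id ` ball 0 1" unfolding image_image by (rule image_cong) (use g(2) in auto)
    then show ?thesis by (simp add: U)
  qed
  then have "bounded (range g)" by simp
  with g(1) U obtain c where "\<And>z. g z = c" using Liouville_theorem[of g] by (auto simp: constant_on_def)
  then have "(0::complex) = of_real (1/2)" using g(2)[of 0] g(2)[of "of_real (1/2)"] by simp
  then show False by simp
qed

text \<open>A branch of \<open>sqrt (f - c)\<close>, for \<open>c\<close> outside the image, omits \<open>-w\<close> whenever it attains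
  \<open>w\<close>; so it stays away from a whole disc, and inverting in that disc makes it bounded.\<close>

lemma univalent_bounded_transform:
  assumes f: "f holomorphic_on ball 0 1" and inj: "inj_on f (ball 0 1)"
  obtains k b c where "k holomorphic_on ball 0 1" "inj_on k (ball 0 1)" "bounded (k ` ball 0 1)"
    "\<And>z. z \<in> ball 0 1 \<Longrightarrow> k z \<noteq> 0" "\<And>z. z \<in> ball 0 1 \<Longrightarrow> f z = c + (inverse (k z) - b)\<^sup>2"
proof -
  obtain c where c: "c \<notin> f ` ball 0 1" using univalent_image_not_UNIV[OF f inj] by blast
  obtain s where s: "s holomorphic_on ball 0 1" and s2: "\<And>z. z \<in> ball 0 1 \<Longrightarrow> f z - c = (s z)\<^sup>2"
    by (rule contractible_imp_holomorphic_sqrt[of "\<lambda>z. f z - c" "ball 0 1"])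
       (use f c in \<open>auto intro!: holomorphic_intros convex_imp_contractible\<close>)
  have s0: "s z \<noteq> 0" if "z \<in> ball 0 1" for z using s2[OF that] c that by force
  have injs: "inj_on s (ball 0 1)"
    by (rule inj_onI) (metis s2 inj inj_onD diff_add_cancel)
  have anti: "s z \<noteq> - s w" if "z \<in> ball 0 1" "w \<in> ball 0 1" for z w
  proof
    assume e: "s z = - s w"
    then have "f z = f w" using s2[OF that(1)] s2[OF that(2)] by (metis diff_add_cancel power2_minus)
    then have "z = w" using inj that by (auto dest: inj_onD)
    then show False using e s0[OF that(1)] by simp
  qed
  have "open (s ` ball 0 1)" by (rule open_mapping_thm3[OF s open_ball injs])
  moreover have "s 0 \<in> s ` ball 0 1" by simp
  ultimately obtain e where e: "e > 0" "ball (s 0) e \<subseteq> s ` ball 0 1"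
    using open_contains_ball by blast
  define b where "b = s 0"
  have far: "e \<le> cmod (s z + b)" if "z \<in> ball 0 1" for z
  proof (rule ccontr)
    assume "\<not> e \<le> cmod (s z + b)"
    then have "- s z \<in> ball (s 0) e" by (simp add: b_def dist_norm add.commute)
    then obtain w where "w \<in> ball 0 1" "- s z = s w" using e by blast
    then show False using anti[of w z] that by simp
  qed
  have nz: "s z + b \<noteq> 0" if "z \<in> ball 0 1" for z using far[OF that] e by auto
  show ?thesis
  proof
    show "(\<lambda>z. inverse (s z + b)) holomorphic_on ball 0 1"
      using s nz by (auto intro!: holomorphic_intros)
    show "inj_on (\<lambda>z. inverse (s z + b)) (ball 0 1)"
      using injs by (auto simp: inj_on_def)
    show "bounded ((\<lambda>z. inverse (s z + b)) ` ball 0 1)"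
      unfolding bounded_iff
    proof (intro exI ballI)
      fix x assume "x \<in> (\<lambda>z. inverse (s z + b)) ` ball 0 1"
      then obtain z where z: "z \<in> ball 0 1" "x = inverse (s z + b)" by blast
      show "cmod x \<le> inverse e" unfolding z(2) norm_inverse
        by (rule le_imp_inverse_le[OF far[OF z(1)] e(1)])
    qed
    show "inverse (s z + b) \<noteq> 0" if "z \<in> ball 0 1" for z using nz[OF that] by simp
    show "f z = c + (inverse (inverse (s z + b)) - b)\<^sup>2" if "z \<in> ball 0 1" for z
      using s2[OF that] by (simp add: algebra_simps)
  qed
qed

text \<open>The map from \<open>k\<close> back to \<open>f\<close> is continuous away from the value
  0, so the alternative is decided by whether the radial limit \<open>L\<close> of \<open>k\<close>
  vanishes.\<close>

lemma AE_univalent_radial_limit_or_infinity: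
  assumes f: "f holomorphic_on ball 0 1" and inj: "inj_on f (ball 0 1)"
  shows "AE \<theta> in lborel. 0 < \<theta> \<and> \<theta> < 2 * pi \<longrightarrow>
    has_radial_limit f (cis \<theta>) \<or> filterlim (\<lambda>r. f (of_real r * cis \<theta>)) at_infinity (at_left 1)"
proof -
  obtain k b c where k: "k holomorphic_on ball 0 1" "inj_on k (ball 0 1)" "bounded (k ` ball 0 1)"
    "\<And>z. z \<in> ball 0 1 \<Longrightarrow> k z \<noteq> 0" and fk: "\<And>z. z \<in> ball 0 1 \<Longrightarrow> f z = c + (inverse (k z) - b)\<^sup>2"
    by (rule univalent_bounded_transform[OF f inj]) (rule that)
  have ball: "of_real r * cis \<theta> \<in> ball 0 1" if "0 < r" "r < 1" for r \<theta>
    using that by (simp add: norm_mult)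
  have ev: "eventually (\<lambda>r::real. 0 < r \<and> r < 1) (at_left 1)"
    using eventually_at_left_real[of 0 1] by (auto elim!: eventually_mono)
  show ?thesis
  proof (rule AE_mp[OF AE_radial_limit_bounded_univalent[OF k(1-3)]], intro AE_I2 impI)
    fix \<theta> assume *: "0 < \<theta> \<and> \<theta> < 2 * pi \<longrightarrow> (\<exists>L. ((\<lambda>r. k (of_real r * cis \<theta>)) \<longlongrightarrow> L) (at_left 1))"
      and "0 < \<theta> \<and> \<theta> < 2 * pi"
    then obtain L where L: "((\<lambda>r. k (of_real r * cis \<theta>)) \<longlongrightarrow> L) (at_left 1)" by blast
    have eq: "eventually (\<lambda>r. c + (inverse (k (of_real r * cis \<theta>)) - b)\<^sup>2 = f (of_real r * cis \<theta>)) (at_left 1)"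
      using ev by (rule eventually_mono) (use fk ball in auto)
    show "has_radial_limit f (cis \<theta>) \<or> filterlim (\<lambda>r. f (of_real r * cis \<theta>)) at_infinity (at_left 1)"
    proof (cases "L = 0")
      case False
      then have "((\<lambda>r. c + (inverse (k (of_real r * cis \<theta>)) - b)\<^sup>2) \<longlongrightarrow> c + (inverse L - b)\<^sup>2) (at_left 1)"
        by (intro tendsto_intros L)
      then have "((\<lambda>r. f (of_real r * cis \<theta>)) \<longlongrightarrow> c + (inverse L - b)\<^sup>2) (at_left 1)"
        using eq by (rule Lim_transform_eventually)
      then show ?thesis unfolding has_radial_limit_def by blast
    next
      case True
      \<comment> \<open>Since \<open>k\<close> omits 0 in the disc, convergence to 0 takes place in
        the punctured neighbourhood, as inversion requires.\<close>
      have "filterlim (\<lambda>r. k (of_real r * cis \<theta>)) (at 0) (at_left 1)"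
        unfolding filterlim_at using L True ev k(4) ball by (auto elim: eventually_mono)
      then have "filterlim (\<lambda>r. inverse (k (of_real r * cis \<theta>))) at_infinity (at_left 1)"
        by (rule filterlim_compose[OF filterlim_inverse_at_infinity])
      then have "filterlim (\<lambda>r. -b + inverse (k (of_real r * cis \<theta>))) at_infinity (at_left 1)"
        by (rule tendsto_add_filterlim_at_infinity[OF tendsto_const])
      then have "filterlim (\<lambda>r. (-b + inverse (k (of_real r * cis \<theta>)))\<^sup>2) at_infinity (at_left 1)"
        unfolding power2_eq_square by (intro filterlim_at_infinity_times)
      then have "filterlim (\<lambda>r. c + (-b + inverse (k (of_real r * cis \<theta>)))\<^sup>2) at_infinity (at_left 1)"
        by (rule tendsto_add_filterlim_at_infinity[OF tendsto_const])
      then have "filterlim (\<lambda>r. f (of_real r * cis \<theta>)) at_infinity (at_left 1)"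
        by (rule filterlim_cong[OF refl refl, THEN iffD1, rotated])
           (use eq in \<open>auto elim!: eventually_mono simp: algebra_simps\<close>)
      then show ?thesis by blast
    qed
  qed
qed

section \<open>Mean values over the circle\<close>

lemma uniform_angle_eq_density: "uniform_measure lborel {0..2 * pi} = density lborel (\<lambda>x. ennreal (indicator {0..2 * pi} x / (2 * pi)))"
  unfolding uniform_measure_def
  by (intro arg_cong2[where f=density] refl ext) (auto simp: indicator_def divide_ennreal[symmetric] ennreal_mult)

lemma prob_space_uniform_angle: "prob_space (uniform_measure lborel {0..2 * pi})"
  by (rule prob_space_uniform_measure) auto

lemma measurable_cis [measurable]: "cis \<in> borel_measurable borel"
  by (intro borel_measurable_continuous_onI continuous_intros)

interpretation circle: prob_space circle_measure
  unfolding circle_measure_def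
  by (intro prob_space.prob_space_distr prob_space_uniform_angle) simp

lemma sets_circle_measure [simp, measurable_cong]: "sets circle_measure = sets borel"
  and space_circle_measure [simp]: "space circle_measure = UNIV"
  by (simp_all add: circle_measure_def)

lemma AE_circle_measureI:
  assumes "{z. P z} \<in> sets borel" "AE \<theta> in lborel. 0 < \<theta> \<and> \<theta> < 2 * pi \<longrightarrow> P (cis \<theta>)"
  shows "AE z in circle_measure. P z"
proof -
  have "AE \<theta> in lborel. \<theta> \<noteq> 0 \<and> \<theta> \<noteq> 2 * pi" using AE_lborel_singleton[of 0] AE_lborel_singleton[of "2 * pi"] by auto
  with assms(2) have "AE \<theta> in lborel. \<theta> \<in> {0..2 * pi} \<longrightarrow> P (cis \<theta>)" by eventually_elim auto
  then have "AE \<theta> in uniform_measure lborel {0..2 * pi}. P (cis \<theta>)" by (intro AE_uniform_measureI) auto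
  then show ?thesis unfolding circle_measure_def
    by (subst AE_distr_iff) (use assms(1) in auto)
qed

lemma AE_circle_measure_norm: "AE z in circle_measure. cmod z = 1"
  by (rule AE_circle_measureI) auto

text \<open>For properties such as the existence of a radial limit, whose set is not known to be
  Borel: the exceptional angles are covered by a Borel null set, which is carried to the circle by
  the inverse \<open>Arg2pi\<close> of \<open>cis\<close>.\<close>

lemma AE_circle_measureI_null:
  assumes "AE \<theta> in lborel. 0 < \<theta> \<and> \<theta> < 2 * pi \<longrightarrow> P (cis \<theta>)"
  shows "AE z in circle_measure. P z"
proof -
  obtain B where B: "B \<in> sets lborel" "emeasure lborel B = 0" "{\<theta> \<in> space lborel. \<not> (0 < \<theta> \<and> \<theta> < 2 * pi \<longrightarrow> P (cis \<theta>))} \<subseteq> B"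
    using assms by (auto elim!: AE_E)
  \<comment> \<open>The plane slit along the ray where \<open>Arg2pi\<close> jumps.\<close>
  define D where "D = {z. \<not> (Im z = 0 \<and> 0 \<le> Re z)}"
  have contD: "continuous_on D Arg2pi"
    using continuous_at_Arg2pi by (intro continuous_at_imp_continuous_on) (auto simp: D_def complex_is_Real_iff complex_nonneg_Reals_iff)
  have clD: "closed {z. Im z = 0 \<and> 0 \<le> Re z}"
    by (intro closed_Collect_conj closed_Collect_eq closed_Collect_le continuous_intros)
  have D: "D \<in> sets borel" unfolding D_def using borel_closed[OF clD] by (simp add: Collect_neg_eq)
  have m: "(\<lambda>z. indicator D z * Arg2pi z) \<in> borel_measurable borel"
    using borel_measurable_continuous_on_indicator[OF D contD] by simp
  have Qm: "{z. z \<in> D \<and> indicator D z * Arg2pi z \<notin> B} \<in> sets borel"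
  proof -
    have "(\<lambda>z. indicator D z * Arg2pi z) -` (- B) \<inter> space borel \<in> sets borel"
      by (rule measurable_sets[OF m]) (use B in auto)
    then have "D \<inter> ((\<lambda>z. indicator D z * Arg2pi z) -` (- B)) \<in> sets borel" using D by auto
    then show ?thesis by (simp add: Int_def vimage_def)
  qed
  have arg: "Arg2pi (cis \<theta>) = \<theta>" if "0 < \<theta>" "\<theta> < 2 * pi" for \<theta>
    by (rule Arg2pi_unique[of 1]) (use that in \<open>auto simp: cis_conv_exp\<close>)
  have inD: "cis \<theta> \<in> D" if "0 < \<theta>" "\<theta> < 2 * pi" for \<theta>
  proof -
    have "Arg2pi (cis \<theta>) \<noteq> 0" using arg[OF that] that by simp
    then have "\<not> (cis \<theta> \<in> \<real> \<and> 0 \<le> Re (cis \<theta>))" using Arg2pi_eq_0 by blast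
    then show ?thesis by (auto simp: D_def complex_is_Real_iff)
  qed
  have "AE z in circle_measure. z \<in> D \<and> indicator D z * Arg2pi z \<notin> B"
  proof (rule AE_circle_measureI[OF Qm])
    have "AE \<theta> in lborel. \<theta> \<notin> B" using B(1,2) by (intro AE_not_in) auto
    then show "AE \<theta> in lborel. 0 < \<theta> \<and> \<theta> < 2 * pi \<longrightarrow> cis \<theta> \<in> D \<and> indicator D (cis \<theta>) * Arg2pi (cis \<theta>) \<notin> B"
      by eventually_elim (auto simp: arg inD indicator_def)
  qed
  then show ?thesis using AE_circle_measure_norm
  proof eventually_elim
    case (elim z)
    then have z: "z \<in> D" "Arg2pi z \<notin> B" "z = cis (Arg2pi z)"
      using Arg2pi_eq[of z] by (auto simp: cis_conv_exp)
    have "Arg2pi z \<noteq> 0" using z(1) Arg2pi_eq_0[of z] by (auto simp: D_def complex_is_Real_iff)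
    then have "0 < Arg2pi z \<and> Arg2pi z < 2 * pi" using Arg2pi_ge_0[of z] Arg2pi_lt_2pi[of z] by auto
    then show "P z" using B(3) z by auto
  qed
qed

lemma circle_integrable_bounded:
  fixes h :: "complex \<Rightarrow> 'b::{banach, second_countable_topology}"
  assumes "h \<in> borel_measurable borel" "\<And>z. cmod z = 1 \<Longrightarrow> norm (h z) \<le> B"
  shows "integrable circle_measure h"
  by (rule circle.integrable_const_bound[of _ B])
     (use assms AE_circle_measure_norm in \<open>auto elim: eventually_mono\<close>)

text \<open>Cauchy's formula at 0 for the function taking \<open>\<zeta>\<close> to
  \<open>h (x + \<zeta> * z)\<close>. The radius of the circle is \<open>cmod z\<close>; the form
  with a vector \<open>z\<close> is the one met when an increment is rotated.\<close>

lemma circle_mean_value: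
  fixes u :: "complex \<Rightarrow> real"
  assumes h: "h holomorphic_on ball x \<rho>" and z: "cmod z < \<rho>"
    and mu [measurable]: "u \<in> borel_measurable borel" and u: "\<And>y. y \<in> ball x \<rho> \<Longrightarrow> u y = Re (h y)"
  shows "(\<integral>\<zeta>. u (x + \<zeta> * z) \<partial>circle_measure) = u x"
proof -
  have sub: "x + \<zeta> * z \<in> ball x \<rho>" if "cmod \<zeta> \<le> 1" for \<zeta>
  proof -
    have "cmod (\<zeta> * z) \<le> 1 * cmod z" unfolding norm_mult using that by (intro mult_right_mono) auto
    then show ?thesis using z by (simp add: dist_norm)
  qed
  have "(\<lambda>\<zeta>. h (x + \<zeta> * z)) holomorphic_on cball 0 1"
    by (rule holomorphic_on_compose_gen[where g=h and t="ball x \<rho>", unfolded o_def])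
       (use h sub in \<open>auto intro!: holomorphic_intros\<close>)
  note hol = this
  have "((\<lambda>u. h (x + u * z) / (u - 0)) has_contour_integral (2 * of_real pi * \<i> * h (x + 0 * z))) (circlepath 0 1)"
    by (rule Cauchy_integral_circlepath_simple[OF hol]) simp
  then have "((\<lambda>t. h (x + cis t * z) / cis t * \<i> * cis t) has_integral (2 * of_real pi * \<i> * h x)) {0..2 * pi}"
    unfolding circlepath_def by (subst (asm) has_contour_integral_part_circlepath_iff) auto
  then have "((\<lambda>t. h (x + cis t * z) / cis t * \<i> * cis t * (1 / (2 * of_real pi * \<i>))) has_integral (2 * of_real pi * \<i> * h x) * (1 / (2 * of_real pi * \<i>))) {0..2 * pi}"
    by (rule has_integral_mult_left)
  also have "(\<lambda>t. h (x + cis t * z) / cis t * \<i> * cis t * (1 / (2 * of_real pi * \<i>))) = (\<lambda>t. h (x + cis t * z) / (2 * pi))"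
    by (auto simp: fun_eq_iff field_simps)
  finally have hi: "((\<lambda>t. h (x + cis t * z) / (2 * pi)) has_integral h x) {0..2 * pi}" by simp
  have cont: "continuous_on {0..2 * pi} (\<lambda>t. h (x + cis t * z))"
    by (rule continuous_on_compose2[OF holomorphic_on_imp_continuous_on[OF hol]]) (auto intro!: continuous_intros)
  have si: "set_integrable lborel {0..2 * pi} (\<lambda>t. h (x + cis t * z) / (2 * pi))"
    by (rule borel_integrable_atLeastAtMost') (intro continuous_intros cont, auto)
  \<comment> \<open>The cut-off supplies a function that is Borel on the whole plane, where
    \<open>h\<close> is unconstrained off the ball.\<close>
  define h' where "h' = (\<lambda>\<zeta>. indicator (cball 0 1) \<zeta> *\<^sub>R h (x + \<zeta> * z))"
  have mh': "h' \<in> borel_measurable borel" unfolding h'_def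
    by (rule borel_measurable_continuous_on_indicator[OF _ holomorphic_on_imp_continuous_on[OF hol]]) auto
  have ch: "h' (cis t) = h (x + cis t * z)" for t by (simp add: h'_def indicator_def)
  have mhc: "(\<lambda>t. h (x + cis t * z)) \<in> borel_measurable borel"
    using measurable_compose[OF measurable_cis mh'] by (simp add: ch)
  have "(\<integral>\<zeta>. h' \<zeta> \<partial>circle_measure) = (\<integral>t. h (x + cis t * z) \<partial>uniform_measure lborel {0..2 * pi})"
    unfolding circle_measure_def using mh' by (subst integral_distr) (auto simp: ch)
  also have "\<dots> = (\<integral>t. (indicator {0..2 * pi} t / (2 * pi)) *\<^sub>R h (x + cis t * z) \<partial>lborel)"
    unfolding uniform_angle_eq_density using mhc by (subst integral_density) auto
  also have "\<dots> = (LINT t:{0..2 * pi}|lborel. h (x + cis t * z) / (2 * pi))"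
    unfolding set_lebesgue_integral_def by (intro Bochner_Integration.integral_cong) (auto simp: scaleR_conv_of_real)
  also have "\<dots> = h x"
    unfolding set_borel_integral_eq_integral(2)[OF si] by (rule integral_unique[OF hi])
  finally have h'x: "(\<integral>\<zeta>. h' \<zeta> \<partial>circle_measure) = h x" .
  have "compact ((\<lambda>\<zeta>. h (x + \<zeta> * z)) ` sphere 0 1)"
    by (rule compact_continuous_image[OF continuous_on_subset[OF holomorphic_on_imp_continuous_on[OF hol]]]) auto
  then obtain B where "\<forall>w\<in>(\<lambda>\<zeta>. h (x + \<zeta> * z)) ` sphere 0 1. cmod w \<le> B"
    using compact_imp_bounded bounded_iff by blast
  then have "integrable circle_measure h'"
    by (intro circle_integrable_bounded[OF mh', of B]) (auto simp: h'_def)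
  then have "(\<integral>\<zeta>. Re (h' \<zeta>) \<partial>circle_measure) = Re (h x)" by (simp add: h'x)
  moreover have "(\<integral>\<zeta>. u (x + \<zeta> * z) \<partial>circle_measure) = (\<integral>\<zeta>. Re (h' \<zeta>) \<partial>circle_measure)"
  proof (rule integral_cong_AE)
    show "(\<lambda>\<zeta>. Re (h' \<zeta>)) \<in> borel_measurable circle_measure" using mh' by simp
    show "AE \<zeta> in circle_measure. u (x + \<zeta> * z) = Re (h' \<zeta>)"
      using AE_circle_measure_norm
    proof eventually_elim
      case (elim \<zeta>)
      then show ?case using u[OF sub[of \<zeta>]] by (simp add: h'_def)
    qed
  qed simp
  ultimately show ?thesis using u[of x] z le_less_trans[OF norm_ge_zero z] by simp
qed

text \<open>Only the rotation invariance of the law \<open>\<mu>\<close> enters, so the mean value property is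
  exact on small increments and only large increments contribute to the error.\<close>

lemma rotation_invariant_mean_value:
  fixes u :: "complex \<Rightarrow> real"
  assumes "prob_space \<mu>" and [measurable_cong]: "sets \<mu> = sets borel"
    and rot: "\<And>\<theta>. distr \<mu> borel (\<lambda>z. cis \<theta> * z) = \<mu>"
    and [measurable]: "u \<in> borel_measurable borel" and B: "\<And>z. \<bar>u z\<bar> \<le> B"
    and mv: "\<And>z. cmod z < \<rho> \<Longrightarrow> (\<integral>\<zeta>. u (x + \<zeta> * z) \<partial>circle_measure) = u x"
  shows "\<bar>(\<integral>z. u (x + z) - u x \<partial>\<mu>)\<bar> \<le> 2 * B * measure \<mu> {z. \<rho> \<le> cmod z}"
proof -
  interpret \<mu>: prob_space \<mu> by fact
  let ?\<nu> = "uniform_measure lborel {0..2 * pi :: real}"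
  interpret \<nu>: prob_space ?\<nu> by (rule prob_space_uniform_angle)
  interpret P: pair_prob_space ?\<nu> \<mu> ..
  have B0: "0 \<le> B" using B[of 0] by linarith
  have B2: "\<bar>u y - u x\<bar> \<le> 2 * B" for y using B[of y] B[of x] by linarith
  define v where "v = (\<lambda>z. indicator {z. cmod z < \<rho>} z * (u (x + z) - u x))"
  have mv' [measurable]: "v \<in> borel_measurable borel" unfolding v_def by measurable
  have vB: "\<bar>v z\<bar> \<le> 2 * B" for z using B2 B0 by (auto simp: v_def indicator_def)
  have spm [simp]: "space \<mu> = UNIV" using sets_eq_imp_space_eq[OF assms(2)] by simp
  \<comment> \<open>Averaging over a uniform rotation leaves the integral unchanged; after
    exchanging the integrals the inner one is a circle mean of \<open>u\<close> minus
    \<open>u x\<close>, which vanishes on small increments.\<close>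
  have "(\<integral>z. v z \<partial>\<mu>) = (\<integral>\<theta>. (\<integral>z. v z \<partial>\<mu>) \<partial>?\<nu>)" by (simp add: \<nu>.prob_space)
  also have "\<dots> = (\<integral>\<theta>. (\<integral>z. v (cis \<theta> * z) \<partial>\<mu>) \<partial>?\<nu>)"
  proof -
    have "(\<integral>z. v z \<partial>\<mu>) = (\<integral>z. v (cis \<theta> * z) \<partial>\<mu>)" for \<theta>
      by (subst rot[of \<theta>, symmetric], subst integral_distr) (auto simp: measurable_cong_sets[OF assms(2) refl])
    then show ?thesis by simp
  qed
  also have "\<dots> = (\<integral>z. (\<integral>\<theta>. v (cis \<theta> * z) \<partial>?\<nu>) \<partial>\<mu>)"
  proof (rule P.Fubini_integral[symmetric], rule P.P.integrable_const_bound[of _ "2 * B"])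
    show "(\<lambda>(\<theta>, z). v (cis \<theta> * z)) \<in> borel_measurable (?\<nu> \<Otimes>\<^sub>M \<mu>)" by measurable
  qed (use vB in auto)
  also have "\<dots> = (\<integral>z. 0 \<partial>\<mu>)"
  proof (intro Bochner_Integration.integral_cong refl)
    fix z
    have "(\<integral>\<theta>. v (cis \<theta> * z) \<partial>?\<nu>) = (\<integral>\<theta>. indicator {z. cmod z < \<rho>} z * (u (x + cis \<theta> * z) - u x) \<partial>?\<nu>)"
      by (intro Bochner_Integration.integral_cong refl) (auto simp: v_def norm_mult indicator_def)
    also have "\<dots> = indicator {z. cmod z < \<rho>} z * (\<integral>\<theta>. (u (x + cis \<theta> * z) - u x) \<partial>?\<nu>)"
      by simp
    also have "(\<integral>\<theta>. (u (x + cis \<theta> * z) - u x) \<partial>?\<nu>) = (\<integral>\<zeta>. u (x + \<zeta> * z) - u x \<partial>circle_measure)"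
      unfolding circle_measure_def by (subst integral_distr) auto
    also have "\<dots> = (\<integral>\<zeta>. u (x + \<zeta> * z) \<partial>circle_measure) - u x"
      using B by (subst Bochner_Integration.integral_diff) (auto intro!: circle_integrable_bounded simp: circle.prob_space[simplified])
    also have "indicator {z. cmod z < \<rho>} z * \<dots> = 0" using mv[of z] by (auto simp: indicator_def)
    finally show "(\<integral>\<theta>. v (cis \<theta> * z) \<partial>?\<nu>) = 0" .
  qed
  finally have v0: "(\<integral>z. v z \<partial>\<mu>) = 0" by simp
  have int: "integrable \<mu> v" "integrable \<mu> (\<lambda>z. u (x + z) - u x)"
    using vB B2 by (auto intro!: \<mu>.integrable_const_bound[of _ "2 * B"])
  have "(\<integral>z. u (x + z) - u x \<partial>\<mu>) = (\<integral>z. (u (x + z) - u x) - v z \<partial>\<mu>)"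
    using v0 int by simp
  also have "\<bar>\<dots>\<bar> \<le> (\<integral>z. 2 * B * indicator {z. \<rho> \<le> cmod z} z \<partial>\<mu>)"
  proof (rule integral_abs_bound_integral)
    show "integrable \<mu> (\<lambda>z. (u (x + z) - u x) - v z)" using int by simp
    show "integrable \<mu> (\<lambda>z. 2 * B * indicator {z. \<rho> \<le> cmod z} z)"
      by (intro \<mu>.integrable_const_bound[of _ "2 * B"]) (use B0 in \<open>auto simp: indicator_def\<close>)
    show "\<bar>u (x + z) - u x - v z\<bar> \<le> 2 * B * indicator {z. \<rho> \<le> cmod z} z" for z
      using B2[of "x + z"] by (auto simp: v_def indicator_def)
  qed
  also have "\<dots> = 2 * B * measure \<mu> {z. \<rho> \<le> cmod z}" by simp
  finally show ?thesis .
qed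

text \<open>Independence turns the joint law into a product, so the increment can be integrated
  first with the past \<open>p\<close> frozen. The weight \<open>F\<close> marks pasts that have
  stayed inside; the mean value property is asked for only where it is nonzero.\<close>

lemma (in prob_space) indep_rotation_invariant_increment:
  fixes u :: "complex \<Rightarrow> real"
  assumes ind: "indep_var N P N' Q" and [measurable]: "d \<in> borel_measurable N'"
    and D: "D = (\<lambda>\<omega>. d (Q \<omega>))"
    and rot: "\<And>\<theta>. distr (distr M borel D) borel (\<lambda>z. cis \<theta> * z) = distr M borel D"
    and [measurable]: "F \<in> borel_measurable N" "x \<in> borel_measurable N" and F: "\<And>p. p \<in> space N \<Longrightarrow> \<bar>F p\<bar> \<le> (1::real)"
    and [measurable]: "u \<in> borel_measurable borel" and B: "\<And>z. \<bar>u z\<bar> \<le> B"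
    and mv: "\<And>p z. p \<in> space N \<Longrightarrow> F p \<noteq> 0 \<Longrightarrow> cmod z < \<rho> \<Longrightarrow> (\<integral>\<zeta>. u (x p + \<zeta> * z) \<partial>circle_measure) = u (x p)"
  shows "\<bar>expectation (\<lambda>\<omega>. F (P \<omega>) * (u (x (P \<omega>) + D \<omega>) - u (x (P \<omega>))))\<bar>
    \<le> 2 * B * prob {\<omega> \<in> space M. \<rho> \<le> cmod (D \<omega>)}"
proof -
  have [measurable]: "P \<in> measurable M N" "Q \<in> measurable M N'"
    using ind indep_var_rv1 indep_var_rv2 by auto
  have [measurable]: "D \<in> borel_measurable M" unfolding D by measurable
  let ?\<mu> = "distr M borel D" and ?N = "distr M N P" and ?N' = "distr M N' Q"
  interpret \<mu>: prob_space ?\<mu> by (rule prob_space_distr) simp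
  interpret N: prob_space ?N by (rule prob_space_distr) simp
  interpret N': prob_space ?N' by (rule prob_space_distr) simp
  interpret Q: pair_prob_space ?N ?N' ..
  have B0: "0 \<le> B" using B[of 0] by linarith
  have B2: "\<bar>u y - u z\<bar> \<le> 2 * B" for y z using B[of y] B[of z] by linarith
  let ?H = "\<lambda>(p, q). F p * (u (x p + d q) - u (x p))"
  have mH [measurable]: "?H \<in> borel_measurable (N \<Otimes>\<^sub>M N')" by measurable
  have HB: "\<bar>?H (p, q)\<bar> \<le> 2 * B" if "p \<in> space N" for p q
    using mult_mono[OF F[OF that] B2[of "x p + d q" "x p"]] B0 by (simp add: abs_mult)
  have "expectation (\<lambda>\<omega>. F (P \<omega>) * (u (x (P \<omega>) + D \<omega>) - u (x (P \<omega>)))) = integral\<^sup>L (distr M (N \<Otimes>\<^sub>M N') (\<lambda>\<omega>. (P \<omega>, Q \<omega>))) ?H"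
    by (subst integral_distr) (auto simp: D)
  also have "\<dots> = integral\<^sup>L (?N \<Otimes>\<^sub>M ?N') ?H"
    using ind unfolding indep_var_distribution_eq by simp
  also have "\<dots> = (\<integral>p. (\<integral>q. ?H (p, q) \<partial>?N') \<partial>?N)"
  proof (rule Q.integral_fst'[symmetric])
    show "integrable (?N \<Otimes>\<^sub>M ?N') ?H"
      by (rule Q.P.integrable_const_bound[of _ "2 * B"]) (use HB in \<open>auto intro!: AE_I2 simp: space_pair_measure\<close>)
  qed
  also have "\<dots> = (\<integral>p. (\<integral>d. F p * (u (x p + d) - u (x p)) \<partial>?\<mu>) \<partial>?N)"
  proof -
    have "?\<mu> = distr ?N' borel d" by (subst distr_distr) (auto simp: D o_def)
    then show ?thesis by (simp add: integral_distr)
  qed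
  also have "\<bar>\<dots>\<bar> \<le> 2 * B * measure ?\<mu> {z. \<rho> \<le> cmod z}"
  proof -
    have bd: "\<bar>\<integral>d. F p * (u (x p + d) - u (x p)) \<partial>?\<mu>\<bar> \<le> 2 * B * measure ?\<mu> {z. \<rho> \<le> cmod z}" if p: "p \<in> space N" for p
    proof (cases "F p = 0")
      case False
      have "\<bar>\<integral>d. u (x p + d) - u (x p) \<partial>?\<mu>\<bar> \<le> 2 * B * measure ?\<mu> {z. \<rho> \<le> cmod z}"
        by (rule rotation_invariant_mean_value) (use \<mu>.prob_space_axioms rot B mv[OF p False] in auto)
      then have "\<bar>F p\<bar> * \<bar>\<integral>d. u (x p + d) - u (x p) \<partial>?\<mu>\<bar> \<le> 1 * (2 * B * measure ?\<mu> {z. \<rho> \<le> cmod z})"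
        using F[OF p] by (intro mult_mono) auto
      then show ?thesis by (simp add: abs_mult)
    qed (use B0 in simp)
    have "\<bar>\<integral>p. (\<integral>d. F p * (u (x p + d) - u (x p)) \<partial>?\<mu>) \<partial>?N\<bar> \<le> (\<integral>p. \<bar>\<integral>d. F p * (u (x p + d) - u (x p)) \<partial>?\<mu>\<bar> \<partial>?N)"
      by (rule integral_abs_bound)
    also have "\<dots> \<le> (\<integral>p. 2 * B * measure ?\<mu> {z. \<rho> \<le> cmod z} \<partial>?N)"
      by (rule integral_mono_AE') (use bd B0 in \<open>auto intro!: AE_I2\<close>)
    also have "\<dots> = 2 * B * measure ?\<mu> {z. \<rho> \<le> cmod z}" using N.prob_space by simp
    finally show ?thesis .
  qed
  also have "measure ?\<mu> {z. \<rho> \<le> cmod z} = prob {\<omega> \<in> space M. \<rho> \<le> cmod (D \<omega>)}"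
    by (subst measure_distr) (auto intro!: arg_cong[where f=prob])
  finally show ?thesis .
qed

section \<open>Stopping at the exit from a compact set\<close>

text \<open>The value after stopping is the first sample outside \<open>K\<close>, so it overshoots
  the boundary. The test inspects all earlier samples, so a walk that returns to \<open>K\<close>
  stays frozen.\<close>

primrec stopped :: "complex set \<Rightarrow> (nat \<Rightarrow> complex) \<Rightarrow> nat \<Rightarrow> complex" where
  "stopped K s 0 = s 0"
| "stopped K s (Suc m) = (if \<forall>i\<le>m. s i \<in> K then s (Suc m) else stopped K s m)"

lemma stopped_inside: "\<forall>i\<le>m. s i \<in> K \<Longrightarrow> stopped K s m = s m"
  by (cases m) auto

lemma stopped_first_exit:
  assumes "N \<le> m" "s N \<notin> K" "\<And>i. i < N \<Longrightarrow> s i \<in> K"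
  shows "stopped K s m = s N"
  using assms(1)
proof (induction m)
  case 0 then show ?case by simp
next
  case (Suc m)
  show ?case
  proof (cases "N = Suc m")
    case True then show ?thesis using assms(3) by (auto simp: less_Suc_eq_le)
  next
    case False
    then have "N \<le> m" using Suc.prems by simp
    then show ?thesis using Suc.IH assms(2) by auto
  qed
qed

lemma borel_measurable_stopped:
  assumes "\<And>i. S i \<in> borel_measurable M" "K \<in> sets borel"
  shows "(\<lambda>\<omega>. stopped K (\<lambda>i. S i \<omega>) m) \<in> borel_measurable M"
proof (induction m)
  case 0 show ?case using assms by simp
next
  case (Suc m)
  have [measurable]: "\<And>i. S i \<in> borel_measurable M" "K \<in> sets borel" by fact+
  note Suc[measurable]
  show ?case unfolding stopped.simps by measurable
qed

text \<open>At the infimum \<tau> of the outside times the path is still in the closed set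
  \<open>K\<close>, but it is outside arbitrarily soon after. Such an excursion fills an open time
  interval, which a fine grid meets; hence the first sample outside \<open>K\<close> comes shortly
  after \<tau>.\<close>

lemma continuous_path_first_exit:
  fixes z :: "real \<Rightarrow> complex"
  assumes cont: "continuous_on {0..} z" and t0: "0 \<le> t0" and K: "closed K"
    and in0: "z t0 \<in> K" and out: "t0 \<le> s1" "z s1 \<notin> K"
  obtains \<tau> where "t0 \<le> \<tau>" "\<And>s. t0 \<le> s \<Longrightarrow> s \<le> \<tau> \<Longrightarrow> z s \<in> K" "z \<tau> \<in> frontier K"
    "\<And>e. 0 < e \<Longrightarrow> \<exists>s>\<tau>. s < \<tau> + e \<and> z s \<notin> K"
    "(\<lambda>m. stopped K (\<lambda>i. z (t0 + real i / 2 ^ m)) (4 ^ m)) \<longlonglongrightarrow> z \<tau>"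
proof -
  define E where "E = {s. t0 \<le> s \<and> z s \<notin> K}"
  define \<tau> where "\<tau> = Inf E"
  have E: "E \<noteq> {}" "bdd_below E" using out by (auto simp: E_def intro!: bdd_belowI[of _ t0])
  have t0\<tau>: "t0 \<le> \<tau>" unfolding \<tau>_def by (rule cInf_greatest[OF E(1)]) (auto simp: E_def)
  have before: "z s \<in> K" if "t0 \<le> s" "s < \<tau>" for s
    using that cInf_lower[OF _ E(2), of s] by (force simp: E_def \<tau>_def)
  have near: "\<exists>d>0. \<forall>s\<ge>0. \<bar>s - t\<bar> < d \<longrightarrow> dist (z s) (z t) < e" if "0 \<le> t" "0 < e" for t e
  proof -
    have "\<exists>d>0. \<forall>s\<in>{0..}. dist s t < d \<longrightarrow> dist (z s) (z t) < e"
      using cont that unfolding continuous_on_iff by simp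
    then obtain d where "d > 0" "\<forall>s\<in>{0..}. dist s t < d \<longrightarrow> dist (z s) (z t) < e" by blast
    then show ?thesis by (intro exI[of _ d]) (auto simp: dist_real_def)
  qed
  have at: "z \<tau> \<in> K"
  proof (cases "\<tau> = t0")
    case True then show ?thesis using in0 by simp
  next
    case False
    then have lt: "t0 < \<tau>" using t0\<tau> by simp
    have "(z \<longlongrightarrow> z \<tau>) (at \<tau> within {t0..\<tau>})"
      using continuous_on_subset[OF cont, of "{t0..\<tau>}"] t0 lt by (auto simp: continuous_on_def)
    then have lim: "(z \<longlongrightarrow> z \<tau>) (at_left \<tau>)" using at_within_Icc_at_left[OF lt] by simp
    have ev: "eventually (\<lambda>s. z s \<in> K) (at_left \<tau>)"
      using eventually_at_left_real[OF lt] by (rule eventually_mono) (use before in auto)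
    show ?thesis by (rule Lim_in_closed_set[OF K ev _ lim]) simp
  qed
  have upto: "z s \<in> K" if "t0 \<le> s" "s \<le> \<tau>" for s
    using before[of s] at that by (cases "s = \<tau>") auto
  have after: "\<exists>s>\<tau>. s < \<tau> + e \<and> z s \<notin> K" if "0 < e" for e
  proof -
    have "\<exists>s\<in>E. s < \<tau> + e" using cInf_lessD[OF E(1), of "\<tau> + e"] that by (auto simp: \<tau>_def)
    then obtain s where "s \<in> E" "s < \<tau> + e" by blast
    moreover have "\<tau> < s" using upto[of s] \<open>s \<in> E\<close> by (force simp: E_def)
    ultimately show ?thesis by (auto simp: E_def)
  qed
  have "z \<tau> \<notin> interior K"
  proof
    assume "z \<tau> \<in> interior K"
    then obtain e where e: "e > 0" "ball (z \<tau>) e \<subseteq> K" by (meson mem_interior)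
    obtain d where d: "d > 0" "\<forall>s\<ge>0. \<bar>s - \<tau>\<bar> < d \<longrightarrow> dist (z s) (z \<tau>) < e" using near[of \<tau> e] e t0 t0\<tau> by auto
    obtain s where "s > \<tau>" "s < \<tau> + d" "z s \<notin> K" using after[OF d(1)] by blast
    then have "z s \<in> ball (z \<tau>) e" using d(2)[rule_format, of s] t0 t0\<tau> by (simp add: dist_commute)
    then show False using e(2) \<open>z s \<notin> K\<close> by blast
  qed
  then have fr: "z \<tau> \<in> frontier K" using at closure_closed[OF K] by (simp add: frontier_def)
  have "(\<lambda>m. stopped K (\<lambda>i. z (t0 + real i / 2 ^ m)) (4 ^ m)) \<longlonglongrightarrow> z \<tau>"
  proof (rule tendstoI)
    fix e :: real assume e: "0 < e"
    obtain d where d: "d > 0" "\<forall>s\<ge>0. \<bar>s - \<tau>\<bar> < d \<longrightarrow> dist (z s) (z \<tau>) < e" using near[of \<tau> e] e t0 t0\<tau> by auto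
    obtain s where s: "s > \<tau>" "s < \<tau> + d" "z s \<notin> K" using after[OF d(1)] by blast
    obtain b where b: "b > 0" "ball (z s) b \<subseteq> - K" using s(3) K by (meson ComplI open_Compl open_contains_ball)
    obtain h where h: "h > 0" "\<forall>r\<ge>0. \<bar>r - s\<bar> < h \<longrightarrow> dist (z r) (z s) < b" using near[of s b] b s t0 t0\<tau> by auto
    have l1: "eventually (\<lambda>m. (1/2::real) ^ m < min h (s - \<tau>)) sequentially"
      using order_tendstoD(2)[OF LIMSEQ_power_zero[of "1/2::real"], of "min h (s - \<tau>)"] h s by auto
    \<comment> \<open>\<open>4 ^ m\<close> samples of mesh \<open>1 / 2 ^ m\<close> span a time
      \<open>2 ^ m\<close>, which has to reach beyond the exit.\<close>
    have l2: "eventually (\<lambda>m. \<tau> + d - t0 < (2::real) ^ m) sequentially"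
    proof -
      have "filterlim (\<lambda>m. (2::real) ^ m) at_top sequentially" by real_asymp
      then show ?thesis by (rule filterlim_at_top_dense[THEN iffD1, rule_format])
    qed
    from l1 l2 show "eventually (\<lambda>m. dist (stopped K (\<lambda>i. z (t0 + real i / 2 ^ m)) (4 ^ m)) (z \<tau>) < e) sequentially"
    proof eventually_elim
      case (elim m)
      let ?g = "\<lambda>i. t0 + real i / 2 ^ m"
      have p: "(0::real) < 2 ^ m" by simp
      have small: "1 / 2 ^ m < h" "1 / 2 ^ m < s - \<tau>" using elim(1) by (auto simp: power_divide)
      define i where "i = nat \<lfloor>(s - t0) * 2 ^ m\<rfloor>"
      have "real i = of_int \<lfloor>(s - t0) * 2 ^ m\<rfloor>" unfolding i_def using s t0\<tau> by simp
      then have i: "real i \<le> (s - t0) * 2 ^ m" "(s - t0) * 2 ^ m < real i + 1" by linarith+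
      have gi: "?g i \<le> s" "s < ?g i + 1 / 2 ^ m"
        using i p by (simp_all add: field_simps)
      have "dist (z (?g i)) (z s) < b" using h(2)[rule_format, of "?g i"] gi small t0 by auto
      then have "z (?g i) \<in> ball (z s) b" by (simp add: dist_commute)
      then have iK: "z (?g i) \<notin> K" using b(2) by blast
      define N where "N = (LEAST i. z (?g i) \<notin> K)"
      have N: "z (?g N) \<notin> K" unfolding N_def using iK by (rule LeastI)
      have Ni: "N \<le> i" unfolding N_def using iK by (rule Least_le)
      have lt: "z (?g j) \<in> K" if "j < N" for j using not_less_Least[of j "\<lambda>i. z (?g i) \<notin> K"] that N_def by auto
      have gN: "?g N \<le> ?g i" using Ni by (simp add: divide_right_mono)
      have "\<tau> < ?g N" using upto[of "?g N"] N t0 by force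
      have "real N / 2 ^ m < 2 ^ m" using gN gi s elim(2) by linarith
      then have "real N < 2 ^ m * 2 ^ m" using p by (simp add: pos_divide_less_eq)
      also have "\<dots> = real (4 ^ m)" by (simp add: power_mult_distrib[symmetric])
      finally have "N \<le> 4 ^ m" by linarith
      then have "stopped K (\<lambda>i. z (?g i)) (4 ^ m) = z (?g N)" using N lt by (intro stopped_first_exit) auto
      moreover have "dist (z (?g N)) (z \<tau>) < e"
        using d(2)[rule_format, of "?g N"] \<open>\<tau> < ?g N\<close> gN gi s t0 t0\<tau> by auto
      ultimately show ?case by simp
    qed
  qed
  from that[OF t0\<tau> upto fr after this] show ?thesis .
qed

section \<open>Gaussian increments and their tails\<close>

abbreviation gauss :: "real \<Rightarrow> complex \<Rightarrow> real" where
  "gauss v z \<equiv> normal_density 0 (sqrt v) (Re z) * normal_density 0 (sqrt v) (Im z)"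

lemma gauss_eq: "0 < v \<Longrightarrow> gauss v z = exp (- (cmod z)\<^sup>2 / (2 * v)) / (2 * pi * v)"
proof -
  assume v: "0 < v"
  have "exp (- (Re z)\<^sup>2 / (2 * v)) * exp (- (Im z)\<^sup>2 / (2 * v)) = exp (- (cmod z)\<^sup>2 / (2 * v))"
    by (simp add: exp_add[symmetric] cmod_power2 add_divide_distrib diff_divide_distrib)
  moreover have "normal_density 0 (sqrt v) x = exp (- x\<^sup>2 / (2 * v)) / sqrt (2 * pi * v)" for x
    using v by (simp add: normal_density_def)
  moreover have "sqrt (2 * pi * v) * sqrt (2 * pi * v) = 2 * pi * v" using v by simp
  ultimately show ?thesis by simp
qed

context standard_planar_brownian_motion
begin

lemma borel_measurable_Z [measurable]: "0 \<le> t \<Longrightarrow> Z t \<in> borel_measurable M"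
  using measurable by simp

lemma distr_increment:
  assumes "0 \<le> s" "s < t"
  shows "distr M borel (\<lambda>\<omega>. Z t \<omega> - Z s \<omega>) = density lborel (\<lambda>z. ennreal (gauss (t - s) z))"
  using distributed_distr_eq_density[OF gaussian_increments[OF assms]] 
  by (metis distr_cong sets_lborel)

lemma emeasure_increment:
  assumes st: "0 \<le> s" "s < t" and A [measurable]: "A \<in> sets borel"
  shows "emeasure M {\<omega> \<in> space M. Z t \<omega> - Z s \<omega> \<in> A} = (\<integral>\<^sup>+z. ennreal (gauss (t - s) z) * indicator A z \<partial>lborel)"
proof -
  have "emeasure M {\<omega> \<in> space M. Z t \<omega> - Z s \<omega> \<in> A} = emeasure (distr M borel (\<lambda>\<omega>. Z t \<omega> - Z s \<omega>)) A"
    using st by (subst emeasure_distr) (auto intro!: arg_cong[where f="emeasure M"])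
  also have "\<dots> = (\<integral>\<^sup>+z. ennreal (gauss (t - s) z) * indicator A z \<partial>lborel)"
    unfolding distr_increment[OF st] by (subst emeasure_density) auto
  finally show ?thesis .
qed

text \<open>By \<open>gauss_eq\<close> the density depends on \<open>cmod z\<close> alone, and
  planar Lebesgue measure is rotation invariant.\<close>

lemma increment_rotation_invariant:
  assumes st: "0 \<le> s" "s < t"
  shows "distr (distr M borel (\<lambda>\<omega>. Z t \<omega> - Z s \<omega>)) borel (\<lambda>z. cis \<theta> * z) = distr M borel (\<lambda>\<omega>. Z t \<omega> - Z s \<omega>)"
proof -
  let ?g = "\<lambda>z. ennreal (gauss (t - s) z)"
  have "density lborel ?g = density (distr lborel borel (\<lambda>z. cis \<theta> * z)) ?g" by (simp add: distr_lborel_rotation)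
  also have "\<dots> = distr (density lborel (\<lambda>z. ?g (cis \<theta> * z))) borel (\<lambda>z. cis \<theta> * z)"
    by (rule density_distr) measurable
  also have "(\<lambda>z. ?g (cis \<theta> * z)) = ?g" 
  proof
    have v: "0 < t - s" using st by simp
    show "?g (cis \<theta> * z) = ?g z" for z unfolding gauss_eq[OF v] by (simp add: norm_mult)
  qed
  finally show ?thesis unfolding distr_increment[OF st] by simp
qed

text \<open>Far from the origin, the density of variance \<open>v\<close> is negligible relative to that of
  variance \<open>2 * v\<close>, which integrates to one.\<close>

lemma prob_large_increment:
  assumes st: "0 \<le> s" "s < t" and \<rho>: "0 \<le> \<rho>"
  shows "prob {\<omega> \<in> space M. \<rho> \<le> cmod (Z t \<omega> - Z s \<omega>)} \<le> 2 * exp (- \<rho>\<^sup>2 / (4 * (t - s)))"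
proof -
  let ?v = "t - s" and ?A = "{z::complex. \<rho> \<le> cmod z}"
  have v: "0 < ?v" using st by simp
  \<comment> \<open>One half of the exponent is bounded using \<open>\<rho> \<le> cmod z\<close>;
    the other half is the exponent for variance \<open>2 * w\<close>. The ratio of the normalising
    constants is the factor 2 in the bound.\<close>
  have quarter: "- x / (2 * w) = - x / (4 * w) + - x / (2 * (2 * w))" for x w :: real
    by (cases "w = 0") (simp_all add: field_simps)
  have "emeasure M {\<omega> \<in> space M. \<rho> \<le> cmod (Z t \<omega> - Z s \<omega>)} = (\<integral>\<^sup>+z. ennreal (gauss ?v z) * indicator ?A z \<partial>lborel)"
    using emeasure_increment[OF st, of ?A] by simp
  also have "\<dots> \<le> (\<integral>\<^sup>+z. ennreal (2 * exp (- \<rho>\<^sup>2 / (4 * ?v))) * ennreal (gauss (2 * ?v) z) \<partial>lborel)"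
  proof (rule nn_integral_mono)
    fix z :: complex
    show "ennreal (gauss ?v z) * indicator ?A z \<le> ennreal (2 * exp (- \<rho>\<^sup>2 / (4 * ?v))) * ennreal (gauss (2 * ?v) z)"
    proof (cases "\<rho> \<le> cmod z")
      case True
      have "- (cmod z)\<^sup>2 / (2 * ?v) = - (cmod z)\<^sup>2 / (4 * ?v) + - (cmod z)\<^sup>2 / (2 * (2 * ?v))"
        by (rule quarter)
      also have "\<dots> \<le> - \<rho>\<^sup>2 / (4 * ?v) + - (cmod z)\<^sup>2 / (2 * (2 * ?v))"
        using v True \<rho> by (intro add_mono divide_right_mono) (auto intro: power_mono)
      finally have "exp (- (cmod z)\<^sup>2 / (2 * ?v)) \<le> exp (- \<rho>\<^sup>2 / (4 * ?v)) * exp (- (cmod z)\<^sup>2 / (2 * (2 * ?v)))"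
        by (simp add: exp_add[symmetric])
      then have "exp (- (cmod z)\<^sup>2 / (2 * ?v)) / (2 * pi * ?v) \<le> exp (- \<rho>\<^sup>2 / (4 * ?v)) * exp (- (cmod z)\<^sup>2 / (2 * (2 * ?v))) / (2 * pi * ?v)"
        using v by (intro divide_right_mono) auto
      also have "\<dots> = (2 * exp (- \<rho>\<^sup>2 / (4 * ?v))) * (exp (- (cmod z)\<^sup>2 / (2 * (2 * ?v))) / (2 * pi * (2 * ?v)))"
        by simp
      finally have "gauss ?v z \<le> (2 * exp (- \<rho>\<^sup>2 / (4 * ?v))) * gauss (2 * ?v) z"
        using gauss_eq[of ?v z] gauss_eq[of "2 * ?v" z] v by simp
      then show ?thesis using True by (simp add: ennreal_mult[symmetric] ennreal_leI)
    qed simp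
  qed
  also have "\<dots> = ennreal (2 * exp (- \<rho>\<^sup>2 / (4 * ?v))) * (\<integral>\<^sup>+z. ennreal (gauss (2 * ?v) z) * indicator UNIV z \<partial>lborel)"
    by (subst nn_integral_cmult) auto
  also have "(\<integral>\<^sup>+z. ennreal (gauss (2 * ?v) z) * indicator UNIV z \<partial>lborel) = emeasure M {\<omega> \<in> space M. Z (2 * ?v) \<omega> - Z 0 \<omega> \<in> UNIV}"
    using emeasure_increment[of 0 "2 * ?v" UNIV] v by simp
  also have "\<dots> = 1" by (simp add: emeasure_space_1)
  finally show ?thesis by (simp add: emeasure_eq_measure)
qed

text \<open>The density of \<open>Z t\<close> is at most its peak value
  \<open>1 / (2 * pi * t)\<close> at the origin.\<close>

lemma prob_position_le:
  assumes t: "0 < t" and A [measurable]: "A \<in> sets borel" and fin: "emeasure lborel A < \<infinity>"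
  shows "prob {\<omega> \<in> space M. Z t \<omega> \<in> A} \<le> measure lborel A / (2 * pi * t)"
proof -
  have "emeasure M {\<omega> \<in> space M. Z t \<omega> \<in> A} = emeasure M {\<omega> \<in> space M. Z t \<omega> - Z 0 \<omega> \<in> A}"
    by (rule emeasure_eq_AE) (use start t in \<open>auto elim: eventually_mono\<close>)
  also have "\<dots> = (\<integral>\<^sup>+z. ennreal (gauss t z) * indicator A z \<partial>lborel)"
    using emeasure_increment[of 0 t A] t by simp
  also have "\<dots> \<le> (\<integral>\<^sup>+z. ennreal (1 / (2 * pi * t)) * indicator A z \<partial>lborel)"
  proof (intro nn_integral_mono mult_right_mono ennreal_leI)
    fix z show "gauss t z \<le> 1 / (2 * pi * t)" unfolding gauss_eq[OF t]
      using t by (intro divide_right_mono) auto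
  qed simp
  also have "\<dots> = ennreal (1 / (2 * pi * t)) * emeasure lborel A" by (subst nn_integral_cmult_indicator) auto
  also have "\<dots> = ennreal (measure lborel A / (2 * pi * t))"
    using fin t by (simp add: emeasure_eq_ennreal_measure ennreal_mult[symmetric] less_top)
  finally show ?thesis using t by (simp add: emeasure_eq_measure)
qed

lemma prob_position_tendsto_0:
  assumes A [measurable]: "A \<in> sets borel" and fin: "emeasure lborel A < \<infinity>"
  shows "(\<lambda>n. prob {\<omega> \<in> space M. Z (real n) \<omega> \<in> A}) \<longlonglongrightarrow> 0"
proof (rule tendsto_sandwich[OF _ _ tendsto_const])
  show "eventually (\<lambda>n. prob {\<omega> \<in> space M. Z (real n) \<omega> \<in> A} \<le> measure lborel A / (2 * pi * real n)) sequentially"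
    using eventually_gt_at_top[of 0] by eventually_elim (intro prob_position_le, use assms in auto)
  show "(\<lambda>n. measure lborel A / (2 * pi * real n)) \<longlonglongrightarrow> 0" by real_asymp
qed auto

text \<open>Sampling at integer times gives an event \<open>B\<close> that is contained in
  \<open>{Z n \<in> K}\<close> for all large \<open>n\<close>, and these probabilities tend to
  0.\<close>

lemma AE_leaves_compact:
  assumes K: "compact K"
  shows "AE \<omega> in M. \<exists>s\<ge>t0. Z s \<omega> \<notin> K"
proof -
  have [measurable]: "K \<in> sets borel" using K by (simp add: borel_compact)
  have fin: "emeasure lborel K < \<infinity>" using K emeasure_compact_finite by blast
  define n0 where "n0 = nat \<lceil>t0\<rceil>"
  define B where "B = {\<omega> \<in> space M. \<forall>n\<ge>n0. Z (real n) \<omega> \<in> K}"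
  have [measurable]: "Z (real n) \<in> borel_measurable M" for n by simp
  have Bm: "B \<in> sets M" unfolding B_def by measurable
  have "prob B \<le> 0"
  proof (rule tendsto_lowerbound[OF prob_position_tendsto_0[OF _ fin]])
    show "eventually (\<lambda>n. prob B \<le> prob {\<omega> \<in> space M. Z (real n) \<omega> \<in> K}) sequentially"
      using eventually_ge_at_top[of n0] by eventually_elim (intro finite_measure_mono, auto simp: B_def)
  qed auto
  then have "B \<in> null_sets M" using Bm by (intro null_setsI) (auto simp: emeasure_eq_measure measure_le_0_iff)
  then have "AE \<omega> in M. \<omega> \<notin> B" by (rule AE_not_in)
  then show ?thesis
  proof (rule AE_mp, intro AE_I2 impI)
    fix \<omega> assume "\<omega> \<in> space M" "\<omega> \<notin> B"
    then obtain n where "n \<ge> n0" "Z (real n) \<omega> \<notin> K" by (auto simp: B_def)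
    moreover have "t0 \<le> real n" using \<open>n \<ge> n0\<close> unfolding n0_def by linarith
    ultimately show "\<exists>s\<ge>t0. Z s \<omega> \<notin> K" by blast
  qed
qed

section \<open>Optional stopping on a time grid\<close>

text \<open>The stopped walk moves in step \<open>n\<close> only if all samples so far lie in
  \<open>K\<close>, and then it moves by an increment independent of the past. The factor
  \<open>4 * B\<close> combines \<open>2 * B\<close> from the mean value estimate with the 2 of the
  Gaussian tail.\<close>

lemma discrete_step_bound:
  fixes u :: "complex \<Rightarrow> real" and T :: "nat \<Rightarrow> real" and a n :: nat
  assumes T0: "T 0 = 0" and inc: "\<And>i. T i < T (Suc i)"
    and [measurable]: "K \<in> sets borel" "C \<in> sets borel"
    and [measurable]: "u \<in> borel_measurable borel" and B: "\<And>z. \<bar>u z\<bar> \<le> B" and \<rho>: "0 \<le> \<rho>"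
    and mv: "\<And>x z. x \<in> K \<Longrightarrow> cmod z < \<rho> \<Longrightarrow> (\<integral>\<zeta>. u (x + \<zeta> * z) \<partial>circle_measure) = u x"
  defines "s \<equiv> \<lambda>\<omega> i. Z (T (a + i)) \<omega>"
  shows "\<bar>expectation (\<lambda>\<omega>. indicator C (s \<omega> 0) * (u (stopped K (s \<omega>) (Suc n)) - u (stopped K (s \<omega>) n)))\<bar>
    \<le> 4 * B * exp (- \<rho>\<^sup>2 / (4 * (T (Suc (a + n)) - T (a + n))))"
proof -
  have Tmono: "T i \<le> T (Suc i)" for i using inc less_imp_le by blast
  have T: "0 \<le> T i" for i using lift_Suc_mono_le[of T 0 i] T0 Tmono by simp
  have B0: "0 \<le> B" using B[of 0] by linarith
  have [measurable]: "Z (T i) \<in> borel_measurable M" for i using T by simp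
  define m where "m = a + n"
  define D where "D = (\<lambda>i \<omega>. Z (T (Suc i)) \<omega> - Z (T i) \<omega>)"
  have [measurable]: "D i \<in> borel_measurable M" for i unfolding D_def by measurable
  let ?N = "PiM {..<m} (\<lambda>_. borel :: complex measure)"
  define P where "P = (\<lambda>\<omega>. \<lambda>i\<in>{..<m}. D i \<omega>)"
  \<comment> \<open>Since paths start at 0 almost surely, positions are partial sums of increments;
    the whole past becomes a function of the family \<open>P\<close>. This is why the times
    \<open>T\<close> begin at 0, with the grid proper starting at index \<open>a\<close>.\<close>
  define x where "x = (\<lambda>j (p::nat \<Rightarrow> complex). \<Sum>i<j. p i)"
  have xm: "x j \<in> borel_measurable ?N" if "j \<le> m" for j
    unfolding x_def by (intro borel_measurable_sum measurable_component_singleton) (use that in auto)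
  \<comment> \<open>The last index \<open>a + n\<close> equals \<open>m\<close>, so
    \<open>F p \<noteq> 0\<close> puts the current position \<open>x m p\<close> in
    \<open>K\<close>, where the mean value property is available.\<close>
  define F where "F = (\<lambda>p. indicator C (x a p) * (if \<forall>i\<le>n. x (a + i) p \<in> K then 1 else 0 :: real))"
  have Fm: "F \<in> borel_measurable ?N"
  proof -
    have "a \<le> m" "\<And>i. i \<in> {..n} \<Longrightarrow> a + i \<le> m" by (simp_all add: m_def)
    then have [measurable]: "x a \<in> borel_measurable ?N" "\<And>i. i \<in> {..n} \<Longrightarrow> x (a + i) \<in> borel_measurable ?N"
      using xm by blast+
    have "(\<lambda>p. indicator C (x a p) * (if \<forall>i\<in>{..n}. x (a + i) p \<in> K then 1 else 0 :: real)) \<in> borel_measurable ?N"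
      by measurable
    then show ?thesis by (simp add: F_def)
  qed
  have ind: "indep_var ?N P (PiM {m} (\<lambda>_. borel)) (\<lambda>\<omega>. \<lambda>i\<in>{m}. D i \<omega>)"
  proof -
    have "indep_vars (\<lambda>_. borel) D {..<Suc m}"
      unfolding D_def by (rule independent_increments) (use T inc in auto)
    then show ?thesis
      unfolding P_def by (rule indep_var_restrict) auto
  qed
  have xP: "AE \<omega> in M. \<forall>j\<le>m. x j (P \<omega>) = Z (T j) \<omega>"
    using start
  proof (rule AE_mp, intro AE_I2 impI allI)
    fix \<omega> j assume "Z 0 \<omega> = 0" "j \<le> m"
    have "x j (P \<omega>) = (\<Sum>i<j. D i \<omega>)" unfolding x_def P_def using \<open>j \<le> m\<close> by (intro sum.cong) auto
    also have "\<dots> = Z (T j) \<omega> - Z (T 0) \<omega>" unfolding D_def by (rule sum_lessThan_telescope)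
    finally show "x j (P \<omega>) = Z (T j) \<omega>" using T0 \<open>Z 0 \<omega> = 0\<close> by simp
  qed
  have sm: "(\<lambda>\<omega>. stopped K (s \<omega>) k) \<in> borel_measurable M" for k
    unfolding s_def by (rule borel_measurable_stopped) auto
  note sm[measurable]
  have Pm [measurable]: "P \<in> measurable M ?N" using indep_var_rv1[OF ind] .
  have s0m [measurable]: "(\<lambda>\<omega>. s \<omega> 0) \<in> borel_measurable M" unfolding s_def by simp
  note Fm[measurable]
  have [measurable]: "x m \<in> borel_measurable ?N" by (rule xm) simp
  have "expectation (\<lambda>\<omega>. indicator C (s \<omega> 0) * (u (stopped K (s \<omega>) (Suc n)) - u (stopped K (s \<omega>) n)))
    = expectation (\<lambda>\<omega>. F (P \<omega>) * (u (x m (P \<omega>) + D m \<omega>) - u (x m (P \<omega>))))"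
  proof (rule integral_cong_AE)
    show "AE \<omega> in M. indicator C (s \<omega> 0) * (u (stopped K (s \<omega>) (Suc n)) - u (stopped K (s \<omega>) n))
      = F (P \<omega>) * (u (x m (P \<omega>) + D m \<omega>) - u (x m (P \<omega>)))"
      using xP
    proof (rule AE_mp, intro AE_I2 impI)
      fix \<omega> assume *: "\<forall>j\<le>m. x j (P \<omega>) = Z (T j) \<omega>"
      have 1: "x (a + i) (P \<omega>) = s \<omega> i" if "i \<le> n" for i using * that by (simp add: m_def s_def)
      have 2: "x m (P \<omega>) = s \<omega> n" "x m (P \<omega>) + D m \<omega> = s \<omega> (Suc n)" "x a (P \<omega>) = s \<omega> 0"
        using * by (simp_all add: s_def D_def m_def)
      show "indicator C (s \<omega> 0) * (u (stopped K (s \<omega>) (Suc n)) - u (stopped K (s \<omega>) n))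
      = F (P \<omega>) * (u (x m (P \<omega>) + D m \<omega>) - u (x m (P \<omega>)))"
        using 1 2 stopped_inside[of n "s \<omega>" K] by (auto simp: F_def)
    qed
  qed measurable
  also have "\<bar>\<dots>\<bar> \<le> 2 * B * prob {\<omega> \<in> space M. \<rho> \<le> cmod (D m \<omega>)}"
  proof (rule indep_rotation_invariant_increment[OF ind _ _ _ Fm _ _ _ B])
    show "(\<lambda>p. p m) \<in> borel_measurable (PiM {m} (\<lambda>_. borel :: complex measure))" by simp
    show "D m = (\<lambda>\<omega>. (\<lambda>i\<in>{m}. D i \<omega>) m)" by simp
    show "distr (distr M borel (D m)) borel (\<lambda>z. cis \<theta> * z) = distr M borel (D m)" for \<theta>
      unfolding D_def by (rule increment_rotation_invariant[OF T inc])
    show "\<bar>F p\<bar> \<le> 1" for p by (auto simp: F_def indicator_def)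
    show "(\<integral>\<zeta>. u (x m p + \<zeta> * z) \<partial>circle_measure) = u (x m p)" if "F p \<noteq> 0" "cmod z < \<rho>" for p z
      by (rule mv[OF _ that(2)]) (use that(1) in \<open>auto simp: F_def m_def split: if_splits\<close>)
  qed auto
  also have "\<dots> \<le> 2 * B * (2 * exp (- \<rho>\<^sup>2 / (4 * (T (Suc m) - T m))))"
    unfolding D_def by (intro mult_left_mono prob_large_increment T inc \<rho>) (use B0 in auto)
  finally show ?thesis by (simp add: m_def mult_ac)
qed

text \<open>The one-step errors telescope: \<open>n\<close> steps of equal length contribute
  \<open>n\<close> equal bounds.\<close>

lemma discrete_stopping_bound:
  fixes u :: "complex \<Rightarrow> real"
  assumes t0: "0 \<le> t0" and \<delta>: "0 < \<delta>"
    and [measurable]: "K \<in> sets borel" "C \<in> sets borel"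
    and [measurable]: "u \<in> borel_measurable borel" and B: "\<And>z. \<bar>u z\<bar> \<le> B" and \<rho>: "0 \<le> \<rho>"
    and mv: "\<And>x z. x \<in> K \<Longrightarrow> cmod z < \<rho> \<Longrightarrow> (\<integral>\<zeta>. u (x + \<zeta> * z) \<partial>circle_measure) = u x"
  defines "s \<equiv> \<lambda>\<omega> i. Z (t0 + real i * \<delta>) \<omega>"
  shows "\<bar>expectation (\<lambda>\<omega>. indicator C (Z t0 \<omega>) * u (stopped K (s \<omega>) n)) - expectation (\<lambda>\<omega>. indicator C (Z t0 \<omega>) * u (Z t0 \<omega>))\<bar>
    \<le> real n * (4 * B * exp (- \<rho>\<^sup>2 / (4 * \<delta>)))"
proof -
  \<comment> \<open>Time 0 is put in front of the grid. For \<open>t0 = 0\<close> it is already the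
    first grid point, and repeating it would break strict monotonicity of \<open>T\<close>.\<close>
  define a :: nat where "a = (if t0 = 0 then 0 else 1)"
  define T where "T = (\<lambda>i. if t0 = 0 then real i * \<delta> else if i = 0 then 0 else t0 + real (i - 1) * \<delta>)"
  have T0: "T 0 = 0" by (simp add: T_def)
  have inc: "T i < T (Suc i)" for i using t0 \<delta> by (cases i) (auto simp: T_def algebra_simps)
  have Ta: "T (a + i) = t0 + real i * \<delta>" for i by (simp add: T_def a_def)
  have [measurable]: "Z (t0 + real i * \<delta>) \<in> borel_measurable M" for i using t0 \<delta> by simp
  have [measurable]: "Z t0 \<in> borel_measurable M" using t0 by simp
  have sm [measurable]: "(\<lambda>\<omega>. stopped K (s \<omega>) k) \<in> borel_measurable M" for k
    unfolding s_def by (rule borel_measurable_stopped) auto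
  have int: "integrable M (\<lambda>\<omega>. indicator C (Z t0 \<omega>) * u (stopped K (s \<omega>) k))" for k
    by (rule integrable_const_bound[of _ B]) (use B in \<open>auto simp: indicator_def intro!: AE_I2 order_trans[OF abs_ge_zero B]\<close>)
  show ?thesis
  proof (induction n)
    case 0
    show ?case by (simp add: s_def)
  next
    case (Suc n)
    have "\<bar>expectation (\<lambda>\<omega>. indicator C (Z t0 \<omega>) * (u (stopped K (s \<omega>) (Suc n)) - u (stopped K (s \<omega>) n)))\<bar>
      \<le> 4 * B * exp (- \<rho>\<^sup>2 / (4 * \<delta>))"
    proof -
      have "T (Suc (a + n)) - T (a + n) = \<delta>" using Ta[of "Suc n"] Ta[of n] by (simp add: algebra_simps)
      moreover have "(\<lambda>i. Z (T (a + i)) \<omega>) = s \<omega>" for \<omega> by (simp add: Ta s_def)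
      moreover have "Z (T (a + 0)) \<omega> = Z t0 \<omega>" for \<omega> by (simp only: Ta) simp
      ultimately show ?thesis
        using discrete_step_bound[OF T0 inc assms(3-6) \<rho> mv, of a n] by simp
    qed
    also have "expectation (\<lambda>\<omega>. indicator C (Z t0 \<omega>) * (u (stopped K (s \<omega>) (Suc n)) - u (stopped K (s \<omega>) n)))
      = expectation (\<lambda>\<omega>. indicator C (Z t0 \<omega>) * u (stopped K (s \<omega>) (Suc n))) - expectation (\<lambda>\<omega>. indicator C (Z t0 \<omega>) * u (stopped K (s \<omega>) n))"
      unfolding right_diff_distrib by (rule Bochner_Integration.integral_diff[OF int int])
    finally show ?case using Suc.IH by (simp add: algebra_simps)
  qed
qed

section \<open>Optional stopping at the continuous exit\<close>

text \<open>Taking the limit of the grid values as the definition makes measurability immediate;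
  that it is the path value at the exit is a pathwise fact, valid almost surely for starts in
  \<open>K\<close>.\<close>

definition exit_point :: "complex set \<Rightarrow> real \<Rightarrow> 'a \<Rightarrow> complex" where
  "exit_point K t0 \<omega> = lim (\<lambda>m. stopped K (\<lambda>i. Z (t0 + real i / 2 ^ m) \<omega>) (4 ^ m))"

lemma borel_measurable_stopped_grid:
  assumes "0 \<le> t0" "closed K"
  shows "(\<lambda>\<omega>. stopped K (\<lambda>i. Z (t0 + real i / 2 ^ m) \<omega>) n) \<in> borel_measurable M"
  by (rule borel_measurable_stopped) (use assms in auto)

lemma borel_measurable_exit_point:
  assumes "0 \<le> t0" "closed K"
  shows "exit_point K t0 \<in> borel_measurable M"
  unfolding exit_point_def[abs_def]
  by (intro borel_measurable_lim_metric borel_measurable_stopped_grid assms)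

lemma AE_exit_point:
  assumes t0: "0 \<le> t0" and K: "compact K"
  shows "AE \<omega> in M. Z t0 \<omega> \<in> K \<longrightarrow> (\<exists>\<tau>\<ge>t0. (\<forall>s. t0 \<le> s \<and> s \<le> \<tau> \<longrightarrow> Z s \<omega> \<in> K) \<and>
    exit_point K t0 \<omega> = Z \<tau> \<omega> \<and> Z \<tau> \<omega> \<in> frontier K \<and> (\<forall>e>0. \<exists>s>\<tau>. s < \<tau> + e \<and> Z s \<omega> \<notin> K) \<and>
    (\<lambda>m. stopped K (\<lambda>i. Z (t0 + real i / 2 ^ m) \<omega>) (4 ^ m)) \<longlonglongrightarrow> exit_point K t0 \<omega>)"
  using continuous_paths AE_leaves_compact[OF K, of t0]
proof eventually_elim
  case (elim \<omega>)
  show ?case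
  proof
    assume in0: "Z t0 \<omega> \<in> K"
    obtain s1 where s1: "t0 \<le> s1" "Z s1 \<omega> \<notin> K" using elim(2) by blast
    obtain \<tau> where *: "t0 \<le> \<tau>" "\<And>s. t0 \<le> s \<Longrightarrow> s \<le> \<tau> \<Longrightarrow> Z s \<omega> \<in> K" "Z \<tau> \<omega> \<in> frontier K"
      "\<And>e. 0 < e \<Longrightarrow> \<exists>s>\<tau>. s < \<tau> + e \<and> Z s \<omega> \<notin> K"
      "(\<lambda>m. stopped K (\<lambda>i. Z (t0 + real i / 2 ^ m) \<omega>) (4 ^ m)) \<longlonglongrightarrow> Z \<tau> \<omega>"
      by (rule continuous_path_first_exit[OF elim(1) t0 compact_imp_closed[OF K] in0 s1]) (rule that)
    have "exit_point K t0 \<omega> = Z \<tau> \<omega>" unfolding exit_point_def by (rule limI[OF *(5)])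
    then show "\<exists>\<tau>\<ge>t0. (\<forall>s. t0 \<le> s \<and> s \<le> \<tau> \<longrightarrow> Z s \<omega> \<in> K) \<and>
    exit_point K t0 \<omega> = Z \<tau> \<omega> \<and> Z \<tau> \<omega> \<in> frontier K \<and> (\<forall>e>0. \<exists>s>\<tau>. s < \<tau> + e \<and> Z s \<omega> \<notin> K) \<and>
    (\<lambda>m. stopped K (\<lambda>i. Z (t0 + real i / 2 ^ m) \<omega>) (4 ^ m)) \<longlonglongrightarrow> exit_point K t0 \<omega>"
      using * by auto
  qed
qed

text \<open>Both sides are limits of the same sequence, one by dominated convergence and one by the
  grid bound. The sampled values overshoot \<open>K\<close>, so \<open>u\<close> has to be
  continuous in the full sense at frontier points.\<close>

theorem expectation_exit_point:
  fixes u :: "complex \<Rightarrow> real"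
  assumes t0: "0 \<le> t0" and K: "compact K" and C [measurable]: "C \<in> sets borel" "C \<subseteq> K"
    and [measurable]: "u \<in> borel_measurable borel" and B: "\<And>z. \<bar>u z\<bar> \<le> B" and \<rho>: "0 < \<rho>"
    and mv: "\<And>x z. x \<in> K \<Longrightarrow> cmod z < \<rho> \<Longrightarrow> (\<integral>\<zeta>. u (x + \<zeta> * z) \<partial>circle_measure) = u x"
    and cont: "\<And>x. x \<in> frontier K \<Longrightarrow> isCont u x"
  shows "expectation (\<lambda>\<omega>. indicator C (Z t0 \<omega>) * u (exit_point K t0 \<omega>)) = expectation (\<lambda>\<omega>. indicator C (Z t0 \<omega>) * u (Z t0 \<omega>))"
proof -
  have clK: "closed K" using K by (rule compact_imp_closed)
  have [measurable]: "K \<in> sets borel" using clK by simp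
  let ?S = "\<lambda>m \<omega>. stopped K (\<lambda>i. Z (t0 + real i / 2 ^ m) \<omega>) (4 ^ m)"
  have [measurable]: "Z t0 \<in> borel_measurable M" using t0 by simp
  note borel_measurable_exit_point[OF t0 clK, measurable] borel_measurable_stopped_grid[OF t0 clK, measurable]
  have lim1: "(\<lambda>m. expectation (\<lambda>\<omega>. indicator C (Z t0 \<omega>) * u (?S m \<omega>))) \<longlonglongrightarrow> expectation (\<lambda>\<omega>. indicator C (Z t0 \<omega>) * u (exit_point K t0 \<omega>))"
  proof (rule integral_dominated_convergence[where w="\<lambda>_. B"])
    show "AE \<omega> in M. (\<lambda>m. indicator C (Z t0 \<omega>) * u (?S m \<omega>)) \<longlonglongrightarrow> indicator C (Z t0 \<omega>) * u (exit_point K t0 \<omega>)"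
      using AE_exit_point[OF t0 K]
    proof eventually_elim
      case (elim \<omega>)
      show ?case
      proof (cases "Z t0 \<omega> \<in> C")
        case True
        from True C(2) elim have "(\<lambda>m. ?S m \<omega>) \<longlonglongrightarrow> exit_point K t0 \<omega>" "exit_point K t0 \<omega> \<in> frontier K" by auto
        then have "(\<lambda>m. u (?S m \<omega>)) \<longlonglongrightarrow> u (exit_point K t0 \<omega>)"
          using cont isCont_tendsto_compose by blast
        then show ?thesis by (intro tendsto_mult tendsto_const)
      qed simp
    qed
    show "AE \<omega> in M. norm (indicator C (Z t0 \<omega>) * u (?S m \<omega>)) \<le> B" for m
      using B order_trans[OF abs_ge_zero B] by (auto simp: indicator_def)
  qed auto
  have lim2: "(\<lambda>m. expectation (\<lambda>\<omega>. indicator C (Z t0 \<omega>) * u (?S m \<omega>))) \<longlonglongrightarrow> expectation (\<lambda>\<omega>. indicator C (Z t0 \<omega>) * u (Z t0 \<omega>))"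
  proof (rule LIM_zero_cancel, rule Lim_null_comparison)
    let ?L = "expectation (\<lambda>\<omega>. indicator C (Z t0 \<omega>) * u (Z t0 \<omega>))"
    show "eventually (\<lambda>m. norm (expectation (\<lambda>\<omega>. indicator C (Z t0 \<omega>) * u (?S m \<omega>)) - ?L)
      \<le> 4 ^ m * (4 * B * exp (- (\<rho>\<^sup>2 / 4 * 2 ^ m)))) sequentially"
    proof (rule always_eventually, rule allI)
      fix m
      show "norm (expectation (\<lambda>\<omega>. indicator C (Z t0 \<omega>) * u (?S m \<omega>)) - ?L) \<le> 4 ^ m * (4 * B * exp (- (\<rho>\<^sup>2 / 4 * 2 ^ m)))"
        using discrete_stopping_bound[OF t0, of "1 / 2 ^ m" K C u B \<rho> "4 ^ m"] \<rho> B mv by simp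
    qed
    \<comment> \<open>The number of steps grows like \<open>4 ^ m\<close>, but each error is
      exponentially small in \<open>2 ^ m\<close>.\<close>
    have "c > 0 \<Longrightarrow> (\<lambda>m. 4 ^ m * (4 * B * exp (- (c * 2 ^ m)))) \<longlonglongrightarrow> 0" for c :: real by real_asymp
    from this[of "\<rho>\<^sup>2 / 4"] show "(\<lambda>m. 4 ^ m * (4 * B * exp (- (\<rho>\<^sup>2 / 4 * 2 ^ m)))) \<longlonglongrightarrow> 0" using \<rho> by simp
  qed
  show ?thesis using LIMSEQ_unique[OF lim1 lim2] .
qed

end

section \<open>Harmonic functions\<close>

text \<open>On the unit circle these are the real trigonometric polynomials: complex coefficients
  \<open>a\<close> yield cosines and sines alike.\<close>

inductive harmonic_polynomial :: "(complex \<Rightarrow> real) \<Rightarrow> bool" where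
  monom: "harmonic_polynomial (\<lambda>z. Re (a * z ^ n))"
| add: "harmonic_polynomial p \<Longrightarrow> harmonic_polynomial q \<Longrightarrow> harmonic_polynomial (\<lambda>z. p z + q z)"

lemma Re_times_Re: "Re v * Re w = Re (v * w / 2) + Re (v * cnj w / 2)"
  by (simp add: field_simps)

text \<open>The product-to-sum formula: on the circle \<open>cnj z\<close> is the inverse of
  \<open>z\<close>, so the mixed term has exponent \<open>m - n\<close>. The symmetry reduction to
  \<open>n \<le> m\<close> keeps this exponent a natural number.\<close>

lemma harmonic_polynomial_monom_mult:
  "\<exists>r. harmonic_polynomial r \<and> (\<forall>z. cmod z = 1 \<longrightarrow> Re (a * z ^ n) * Re (b * z ^ m) = r z)"
proof (induction n m arbitrary: a b rule: linorder_wlog)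
  case (le n m)
  show ?case
  proof (intro exI conjI allI impI)
    show "harmonic_polynomial (\<lambda>z. Re ((a * b / 2) * z ^ (n + m)) + Re ((cnj a * b / 2) * z ^ (m - n)))"
      by (intro harmonic_polynomial.intros)
    fix z :: complex assume z: "cmod z = 1"
    have "z * cnj z = 1" using z complex_norm_square[of z] by simp
    then have 1: "z ^ n * cnj z ^ n = 1" by (metis power_mult_distrib power_one)
    have "z ^ m = z ^ n * z ^ (m - n)" using le by (simp add: power_add[symmetric])
    then have "b * z ^ m * cnj (a * z ^ n) / 2 = (z ^ n * cnj z ^ n) * ((cnj a * b / 2) * z ^ (m - n))" by simp
    then have 2: "b * z ^ m * cnj (a * z ^ n) / 2 = (cnj a * b / 2) * z ^ (m - n)" unfolding 1 by simp
    have "Re (a * z ^ n) * Re (b * z ^ m) = Re (b * z ^ m * (a * z ^ n) / 2) + Re (b * z ^ m * cnj (a * z ^ n) / 2)"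
      using Re_times_Re[of "b * z ^ m" "a * z ^ n"] by (simp only: mult.commute)
    also have "b * z ^ m * (a * z ^ n) / 2 = (a * b / 2) * z ^ (n + m)" by (simp add: power_add)
    finally show "Re (a * z ^ n) * Re (b * z ^ m) = Re ((a * b / 2) * z ^ (n + m)) + Re ((cnj a * b / 2) * z ^ (m - n))"
      unfolding 2 .
  qed
next
  case (sym n m)
  then show ?case by (metis mult.commute)
qed

lemma harmonic_polynomial_mult:
  assumes "harmonic_polynomial p" "harmonic_polynomial q"
  shows "\<exists>r. harmonic_polynomial r \<and> (\<forall>z. cmod z = 1 \<longrightarrow> p z * q z = r z)"
  using assms
proof (induction rule: harmonic_polynomial.induct)
  case (monom a n)
  from monom show ?case
  proof (induction rule: harmonic_polynomial.induct)
    case (monom b m)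
    then show ?case by (rule harmonic_polynomial_monom_mult)
  next
    case (add q1 q2)
    then obtain r1 r2 where "harmonic_polynomial r1" "\<forall>z. cmod z = 1 \<longrightarrow> Re (a * z ^ n) * q1 z = r1 z"
      "harmonic_polynomial r2" "\<forall>z. cmod z = 1 \<longrightarrow> Re (a * z ^ n) * q2 z = r2 z" by blast
    then show ?case
      by (intro exI[of _ "\<lambda>z. r1 z + r2 z"]) (simp add: harmonic_polynomial.add distrib_left)
  qed
next
  case (add p1 p2)
  then obtain r1 r2 where "harmonic_polynomial r1" "\<forall>z. cmod z = 1 \<longrightarrow> p1 z * q z = r1 z"
    "harmonic_polynomial r2" "\<forall>z. cmod z = 1 \<longrightarrow> p2 z * q z = r2 z" by blast
  then show ?case
    by (intro exI[of _ "\<lambda>z. r1 z + r2 z"]) (simp add: harmonic_polynomial.add distrib_right)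
qed

text \<open>Polynomials in the two coordinates are what Stone-Weierstrass delivers; this brings them
  into the span of the moments.\<close>

lemma real_polynomial_function_on_circle:
  assumes "real_polynomial_function p"
  shows "\<exists>r. harmonic_polynomial r \<and> (\<forall>z. cmod z = 1 \<longrightarrow> p z = r z)"
  using assms
proof (induction rule: real_polynomial_function.induct)
  case (linear f)
  interpret bounded_linear f by fact
  \<comment> \<open>A real linear functional on the plane is the real part of multiplication by a
    complex number, found by evaluating at 1 and \<open>\<i>\<close>.\<close>
  have "f z = Re ((Complex (f 1) (- f \<i>)) * z ^ 1)" for z
  proof -
    have "f z = f (Re z *\<^sub>R 1 + Im z *\<^sub>R \<i>)" by (rule arg_cong[where f=f]) (simp add: complex_eq_iff)
    also have "\<dots> = Re z * f 1 + Im z * f \<i>" by (simp only: add scale) simp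
    finally show ?thesis by (simp add: mult.commute)
  qed
  then show ?case using harmonic_polynomial.monom by blast
next
  case (const c)
  show ?case
    by (intro exI[of _ "\<lambda>z. Re (of_real c * z ^ 0)"] conjI harmonic_polynomial.monom) simp
next
  case (add f g)
  then obtain r1 r2 where "harmonic_polynomial r1" "\<forall>z. cmod z = 1 \<longrightarrow> f z = r1 z"
    "harmonic_polynomial r2" "\<forall>z. cmod z = 1 \<longrightarrow> g z = r2 z" by blast
  then show ?case
    by (intro exI[of _ "\<lambda>z. r1 z + r2 z"]) (simp add: harmonic_polynomial.add)
next
  case (mult f g)
  then obtain r1 r2 where "harmonic_polynomial r1" "\<forall>z. cmod z = 1 \<longrightarrow> f z = r1 z"
    "harmonic_polynomial r2" "\<forall>z. cmod z = 1 \<longrightarrow> g z = r2 z" by blast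
  then show ?case using harmonic_polynomial_mult[of r1 r2] by auto
qed

text \<open>The mean value property at the centre 0. Writing \<open>0 ^ n\<close> joins the case
  \<open>n = 0\<close>, where it is 1, with the vanishing higher moments.\<close>

lemma integral_circle_monom: "(\<integral>z. Re (a * z ^ n) \<partial>circle_measure) = Re (a * 0 ^ n)"
proof -
  have h: "(\<lambda>z. a * z ^ n) holomorphic_on ball 0 2" by (intro holomorphic_intros)
  have m: "(\<lambda>z. Re (a * z ^ n)) \<in> borel_measurable borel" by measurable
  show ?thesis using circle_mean_value[OF h _ m, of 1] by simp
qed

text \<open>Stone-Weierstrass: a continuous function on the circle is uniformly close to a harmonic
  polynomial, on which the two integrals agree.\<close>

lemma integral_circle_of_moments:
  fixes \<phi> :: "complex \<Rightarrow> real"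
  assumes "prob_space \<mu>" and [measurable_cong]: "sets \<mu> = sets borel" and ae: "AE z in \<mu>. cmod z = 1"
    and mom: "\<And>a n. (\<integral>z. Re (a * z ^ n) \<partial>\<mu>) = Re (a * 0 ^ n)"
    and [measurable]: "\<phi> \<in> borel_measurable borel" and cont: "continuous_on (sphere 0 1) \<phi>"
  shows "integral\<^sup>L \<mu> \<phi> = integral\<^sup>L circle_measure \<phi>"
proof -
  interpret \<mu>: prob_space \<mu> by fact
  have meas: "harmonic_polynomial p \<Longrightarrow> p \<in> borel_measurable borel" for p
    by (induction rule: harmonic_polynomial.induct) auto
  have bd: "harmonic_polynomial p \<Longrightarrow> \<exists>B. \<forall>z. cmod z = 1 \<longrightarrow> \<bar>p z\<bar> \<le> B" for p
  proof (induction rule: harmonic_polynomial.induct)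
    case (monom a n)
    have "\<bar>Re (a * z ^ n)\<bar> \<le> cmod a" if "cmod z = 1" for z
      using abs_Re_le_cmod[of "a * z ^ n"] that by (simp add: norm_mult norm_power)
    then show ?case by blast
  next
    case (add p q)
    then obtain B1 B2 where "\<forall>z. cmod z = 1 \<longrightarrow> \<bar>p z\<bar> \<le> B1" "\<forall>z. cmod z = 1 \<longrightarrow> \<bar>q z\<bar> \<le> B2" by blast
    then show ?case by (intro exI[of _ "B1 + B2"]) (auto intro: order_trans[OF abs_triangle_ineq] add_mono)
  qed
  have int: "integrable \<nu> p" if "prob_space \<nu>" "sets \<nu> = sets borel" "AE z in \<nu>. cmod z = 1"
      "p \<in> borel_measurable borel" "\<forall>z. cmod z = 1 \<longrightarrow> \<bar>p z\<bar> \<le> B" for \<nu> and p :: "complex \<Rightarrow> real" and B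
  proof -
    interpret \<nu>: prob_space \<nu> by fact
    show ?thesis
      by (rule \<nu>.integrable_const_bound[of _ B])
         (use that in \<open>auto elim: eventually_mono simp: measurable_cong_sets[OF that(2) refl]\<close>)
  qed
  have eq: "harmonic_polynomial p \<Longrightarrow> integral\<^sup>L \<mu> p = integral\<^sup>L circle_measure p" for p
  proof (induction rule: harmonic_polynomial.induct)
    case (monom a n)
    show ?case by (simp only: mom integral_circle_monom)
  next
    case (add p q)
    obtain B1 B2 where "\<forall>z. cmod z = 1 \<longrightarrow> \<bar>p z\<bar> \<le> B1" "\<forall>z. cmod z = 1 \<longrightarrow> \<bar>q z\<bar> \<le> B2"
      using bd add.hyps by blast
    then have "integrable \<mu> p" "integrable \<mu> q" "integrable circle_measure p" "integrable circle_measure q"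
      using add.hyps meas by (auto intro!: int assms(1,2) ae circle.prob_space_axioms AE_circle_measure_norm)
    then show ?case using add.IH by simp
  qed
  have "compact (\<phi> ` sphere 0 1)" by (rule compact_continuous_image[OF cont]) simp
  then obtain B where "\<forall>x\<in>\<phi> ` sphere 0 1. \<bar>x\<bar> \<le> B" using compact_imp_bounded bounded_iff[of "\<phi> ` sphere 0 1"] by auto
  then have \<phi>B: "\<forall>z. cmod z = 1 \<longrightarrow> \<bar>\<phi> z\<bar> \<le> B" by auto
  have le: "\<bar>integral\<^sup>L \<mu> \<phi> - integral\<^sup>L circle_measure \<phi>\<bar> \<le> 2 * e" if e: "0 < e" for e
  proof -
    obtain p where p: "real_polynomial_function p" "\<And>z. z \<in> sphere 0 1 \<Longrightarrow> \<bar>\<phi> z - p z\<bar> < e"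
      using Stone_Weierstrass_real_polynomial_function[OF compact_sphere cont e] by blast
    obtain r where r: "harmonic_polynomial r" "\<forall>z. cmod z = 1 \<longrightarrow> p z = r z"
      using real_polynomial_function_on_circle[OF p(1)] by blast
    obtain B' where B': "\<forall>z. cmod z = 1 \<longrightarrow> \<bar>r z\<bar> \<le> B'" using bd[OF r(1)] by blast
    have close: "\<bar>integral\<^sup>L \<nu> \<phi> - integral\<^sup>L \<nu> r\<bar> \<le> e"
      if \<nu>: "prob_space \<nu>" "sets \<nu> = sets borel" "AE z in \<nu>. cmod z = 1" for \<nu>
    proof -
      interpret \<nu>: prob_space \<nu> by fact
      have i: "integrable \<nu> \<phi>" "integrable \<nu> r"
        using int[OF \<nu> assms(5) \<phi>B] int[OF \<nu> meas[OF r(1)] B'] by auto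
      have "\<bar>integral\<^sup>L \<nu> \<phi> - integral\<^sup>L \<nu> r\<bar> = \<bar>\<integral>z. \<phi> z - r z \<partial>\<nu>\<bar>" using i by simp
      also have "\<dots> \<le> (\<integral>z. \<bar>\<phi> z - r z\<bar> \<partial>\<nu>)" by (rule integral_abs_bound)
      also have "\<dots> \<le> (\<integral>z. e \<partial>\<nu>)"
        using \<nu>(3) by (intro integral_mono_AE) (use i p r in \<open>auto elim!: eventually_mono intro: less_imp_le\<close>)
      also have "\<dots> = e" by (simp add: \<nu>.prob_space)
      finally show ?thesis .
    qed
    show ?thesis
      using close[OF assms(1,2) ae] close[OF circle.prob_space_axioms sets_circle_measure AE_circle_measure_norm] eq[OF r(1)]
      by linarith
  qed
  have "\<bar>integral\<^sup>L \<mu> \<phi> - integral\<^sup>L circle_measure \<phi>\<bar> \<le> 0"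
    by (rule field_le_epsilon) (use le[of "_ / 2"] in force)
  then show ?thesis by simp
qed

text \<open>Harmonicity in the form consumed by \<open>circle_mean_value\<close>. The holomorphic
  function is chosen disc by disc, because \<open>ln (cmod z)\<close> on an annulus is not globally
  the real part of one.\<close>

definition locally_Re_holomorphic :: "(complex \<Rightarrow> real) \<Rightarrow> complex set \<Rightarrow> bool" where
  "locally_Re_holomorphic u W \<longleftrightarrow> continuous_on W u \<and>
     (\<forall>x \<rho>. 0 < \<rho> \<longrightarrow> ball x \<rho> \<subseteq> W \<longrightarrow> (\<exists>h. h holomorphic_on ball x \<rho> \<and> (\<forall>y\<in>ball x \<rho>. u y = Re (h y))))"

lemma locally_Re_holomorphic_Re:
  assumes "h holomorphic_on W"
  shows "locally_Re_holomorphic (\<lambda>z. Re (h z)) W"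
  unfolding locally_Re_holomorphic_def
  using assms holomorphic_on_imp_continuous_on[OF assms] 
  by (auto intro!: continuous_intros exI[of _ h] intro: holomorphic_on_subset)

text \<open>On a disc a zero-free function has a holomorphic logarithm, whose real part is the
  logarithm of the modulus.\<close>

lemma locally_Re_holomorphic_ln_cmod:
  assumes h: "h holomorphic_on W" and nz: "\<And>z. z \<in> W \<Longrightarrow> h z \<noteq> 0"
  shows "locally_Re_holomorphic (\<lambda>z. ln (cmod (h z))) W"
  unfolding locally_Re_holomorphic_def
proof (intro conjI allI impI)
  show "continuous_on W (\<lambda>z. ln (cmod (h z)))"
    using nz by (intro continuous_intros holomorphic_on_imp_continuous_on[OF h]) auto
  fix x and \<rho> :: real assume "0 < \<rho>" and sub: "ball x \<rho> \<subseteq> W"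
  have 1: "h holomorphic_on ball x \<rho>" using h sub by (rule holomorphic_on_subset)
  have 2: "contractible (ball x \<rho>)" by (simp add: convex_imp_contractible)
  have 3: "h z \<noteq> 0" if "z \<in> ball x \<rho>" for z using nz sub that by blast
  obtain l where l: "l holomorphic_on ball x \<rho>" "\<And>z. z \<in> ball x \<rho> \<Longrightarrow> h z = exp (l z)"
    by (rule contractible_imp_holomorphic_log[OF 1 2 3]) (assumption, rule that)
  then show "\<exists>l. l holomorphic_on ball x \<rho> \<and> (\<forall>y\<in>ball x \<rho>. ln (cmod (h y)) = Re (l y))"
    by (intro exI[of _ l]) auto
qed

context standard_planar_brownian_motion
begin

text \<open>\<open>u\<close> is controlled only near \<open>K\<close>, while the stopping theorem
  wants a bounded Borel function on the plane. Hence \<open>v\<close> cuts \<open>u\<close> off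
  outside a closed \<open>\<rho>\<close>-neighbourhood \<open>V\<close> of \<open>K\<close>, which
  increments shorter than \<open>\<rho>\<close> from \<open>K\<close> do not leave.\<close>

theorem expectation_harmonic_exit:
  assumes t0: "0 \<le> t0" and K: "compact K" "K \<subseteq> W" "open W" and u: "locally_Re_holomorphic u W"
    and C [measurable]: "C \<in> sets borel" "C \<subseteq> K"
  obtains v :: "complex \<Rightarrow> real" where "v \<in> borel_measurable borel" "bounded (range v)" "\<And>z. z \<in> K \<Longrightarrow> v z = u z"
    "expectation (\<lambda>\<omega>. indicator C (Z t0 \<omega>) * v (exit_point K t0 \<omega>)) = expectation (\<lambda>\<omega>. indicator C (Z t0 \<omega>) * v (Z t0 \<omega>))"
proof -
  obtain \<rho> where \<rho>: "\<rho> > 0" "(\<Union>x\<in>K. cball x \<rho>) \<subseteq> W"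
    using compact_subset_open_imp_cball_epsilon_subset[OF K(1,3,2)] by blast
  define V where "V = (\<Union>x\<in>K. \<Union>y\<in>cball 0 \<rho>. {x + y})"
  have V: "compact V" unfolding V_def by (intro compact_sums' K compact_cball)
  have cV: "cball x \<rho> \<subseteq> V" if "x \<in> K" for x
  proof
    fix y assume "y \<in> cball x \<rho>"
    then have "y - x \<in> cball 0 \<rho>" by (simp add: dist_norm norm_minus_commute)
    moreover have "y \<in> {x + (y - x)}" by simp
    ultimately show "y \<in> V" using that unfolding V_def by blast
  qed
  have VW: "V \<subseteq> W"
  proof
    fix y assume "y \<in> V"
    then obtain x d where "x \<in> K" "d \<in> cball 0 \<rho>" "y = x + d" by (auto simp: V_def)
    then show "y \<in> W" using \<rho>(2) by (force simp: dist_norm)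
  qed
  define v where "v = (\<lambda>z. indicator V z * u z)"
  have cont: "continuous_on V u" using u VW continuous_on_subset unfolding locally_Re_holomorphic_def by blast
  have vm [measurable]: "v \<in> borel_measurable borel"
    unfolding v_def using borel_measurable_continuous_on_indicator[OF _ cont] V by (simp add: borel_compact)
  have "compact (u ` V)" by (rule compact_continuous_image[OF cont V])
  then obtain B where B: "\<forall>x\<in>u ` V. \<bar>x\<bar> \<le> B" using compact_imp_bounded bounded_iff[of "u ` V"] by auto
  have vB: "\<bar>v z\<bar> \<le> max 0 B" for z using B by (auto simp: v_def indicator_def)
  have KV: "K \<subseteq> V" using cV \<rho> by force
  have "expectation (\<lambda>\<omega>. indicator C (Z t0 \<omega>) * v (exit_point K t0 \<omega>)) = expectation (\<lambda>\<omega>. indicator C (Z t0 \<omega>) * v (Z t0 \<omega>))"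
  proof (rule expectation_exit_point[OF t0 K(1) C vm vB \<rho>(1)])
    fix x z assume x: "x \<in> K" and z: "cmod z < \<rho>"
    have bV: "ball x \<rho> \<subseteq> V" using cV[OF x] by force
    then obtain h where "h holomorphic_on ball x \<rho>" "\<forall>y\<in>ball x \<rho>. u y = Re (h y)"
      using u VW \<rho>(1) unfolding locally_Re_holomorphic_def by (metis subset_trans)
    moreover have "v y = u y" if "y \<in> ball x \<rho>" for y using bV that by (auto simp: v_def)
    ultimately show "(\<integral>\<zeta>. v (x + \<zeta> * z) \<partial>circle_measure) = v x"
      by (intro circle_mean_value[of h x \<rho>] z vm) auto
  next
    fix x assume "x \<in> frontier K"
    then have x: "x \<in> K" using compact_imp_closed[OF K(1)] frontier_subset_closed by blast
    have bV: "ball x \<rho> \<subseteq> V" using cV[OF x] by force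
    have "continuous_on (ball x \<rho>) u" using cont bV by (rule continuous_on_subset)
    then have "continuous_on (ball x \<rho>) v"
      by (rule continuous_on_cong[THEN iffD1, rotated -1]) (use bV in \<open>auto simp: v_def\<close>)
    then show "isCont v x" using \<rho> by (simp add: continuous_on_eq_continuous_at)
  qed
  moreover have "bounded (range v)" using vB by (auto simp: bounded_iff)
  moreover have "v z = u z" if "z \<in> K" for z using KV that by (auto simp: v_def)
  ultimately show ?thesis using that vm by blast
qed

end

section \<open>Recurrence and exit estimates\<close>

lemma frontier_subset_diff:
  assumes "closed K" "open V" "V \<subseteq> K"
  shows "frontier K \<subseteq> K - V"
  using interior_maximal[OF assms(3,2)] closure_closed[OF assms(1)] by (auto simp: frontier_def)

lemma compact_subset_unit_ball:
  assumes "compact A" "A \<subseteq> ball (0::complex) 1"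
  obtains q where "q < 1" "\<And>z. z \<in> A \<Longrightarrow> cmod z \<le> q"
proof (cases "A = {}")
  case True then show ?thesis using that[of 0] by simp
next
  case False
  then obtain w where w: "w \<in> A" "\<forall>z\<in>A. cmod z \<le> cmod w"
    using continuous_attains_sup[OF assms(1) _ continuous_on_norm_id] by blast
  then show ?thesis using assms(2) that[of "cmod w"] by auto
qed

lemma exit_time_eq:
  assumes cont: "continuous_on {0..} (\<lambda>t. Z t \<omega>)" and U: "open U" and out: "0 \<le> s1" "Z s1 \<omega> \<notin> U"
  obtains T where "0 \<le> T" "exit_time Z U \<omega> = ennreal T" "Z T \<omega> \<notin> U" "\<And>s. 0 \<le> s \<Longrightarrow> s < T \<Longrightarrow> Z s \<omega> \<in> U"
proof -
  define E where "E = {t. 0 \<le> t \<and> Z t \<omega> \<notin> U}"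
  have "closed ({0..} \<inter> (\<lambda>t. Z t \<omega>) -` (- U))"
    using cont U by (intro continuous_closed_preimage) auto
  moreover have "{0..} \<inter> (\<lambda>t. Z t \<omega>) -` (- U) = E" by (auto simp: E_def)
  ultimately have cl: "closed E" by simp
  have E: "E \<noteq> {}" "bdd_below E" using out by (auto simp: E_def intro!: bdd_belowI[of _ 0])
  define T where "T = Inf E"
  have T: "T \<in> E" unfolding T_def by (rule closed_contains_Inf[OF E cl])
  have below: "T \<le> s" if "s \<in> E" for s unfolding T_def by (rule cInf_lower[OF that E(2)])
  have "exit_time Z U \<omega> = ennreal T"
    unfolding exit_time_def
  proof (rule antisym)
    show "Inf {ennreal t |t. 0 \<le> t \<and> Z t \<omega> \<notin> U} \<le> ennreal T"
      using T by (intro Inf_lower) (auto simp: E_def)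
    show "ennreal T \<le> Inf {ennreal t |t. 0 \<le> t \<and> Z t \<omega> \<notin> U}"
      by (rule Inf_greatest) (use below in \<open>auto simp: E_def intro!: ennreal_leI\<close>)
  qed
  moreover have "Z s \<omega> \<in> U" if "0 \<le> s" "s < T" for s using below[of s] that by (force simp: E_def)
  ultimately show ?thesis using that T by (auto simp: E_def)
qed

text \<open>For \<open>b\<close> before the exit time \<open>T\<close> the path up to
  \<open>b\<close> is a compact subset of \<open>U\<close>, so it lies in \<open>K n\<close> for
  large \<open>n\<close> and \<open>b \<le> \<tau> n\<close>. Conversely
  \<open>K n \<subseteq> U\<close> forces \<open>\<tau> n < T\<close>. Continuity of the path does
  the rest.\<close>

lemma exit_points_tendsto_exit_position:
  assumes cont: "continuous_on {0..} (\<lambda>t. Z t \<omega>)" and U: "open U" and out: "0 \<le> s1" "Z s1 \<omega> \<notin> U"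
    and in0: "Z 0 \<omega> \<in> U" and KU: "\<And>n. K n \<subseteq> U"
    and exh: "\<And>A. compact A \<Longrightarrow> A \<subseteq> U \<Longrightarrow> eventually (\<lambda>n. A \<subseteq> K n) sequentially"
    and \<tau>: "\<And>n::nat. 0 \<le> \<tau> n" "\<And>n s. 0 \<le> s \<Longrightarrow> s \<le> \<tau> n \<Longrightarrow> Z s \<omega> \<in> K n"
      "\<And>n e. 0 < e \<Longrightarrow> \<exists>s>\<tau> n. s < \<tau> n + e \<and> Z s \<omega> \<notin> K n"
  shows "(\<lambda>n. Z (\<tau> n) \<omega>) \<longlonglongrightarrow> exit_position Z U \<omega>"
proof -
  obtain T where T: "0 \<le> T" "exit_time Z U \<omega> = ennreal T" "Z T \<omega> \<notin> U" "\<And>s. 0 \<le> s \<Longrightarrow> s < T \<Longrightarrow> Z s \<omega> \<in> U"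
    
    by (rule exit_time_eq[where Z=Z and \<omega>=\<omega>, OF cont U out]) (rule that)
  have pos: "exit_position Z U \<omega> = Z T \<omega>" using T by (simp add: exit_position_def)
  have T0: "0 < T" using T(1,3) in0 by (cases "T = 0") auto
  have lt: "\<tau> n < T" for n
  proof (rule ccontr)
    assume "\<not> \<tau> n < T"
    then show False using \<tau>(2)[of T n] T(1,3) KU by auto
  qed
  have "\<tau> \<longlonglongrightarrow> T"
  proof (rule order_tendstoI)
    fix a assume "T < a" then show "eventually (\<lambda>n. \<tau> n < a) sequentially"
      using lt by (intro always_eventually allI) (meson less_trans)
  next
    fix a assume a: "a < T"
    define b where "b = (max a 0 + T) / 2"
    have b: "0 \<le> b" "a < b" "b < T" using a T0 by (auto simp: b_def max_def)
    have "compact ((\<lambda>t. Z t \<omega>) ` {0..b})"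
      by (intro compact_continuous_image continuous_on_subset[OF cont]) auto
    moreover have "(\<lambda>t. Z t \<omega>) ` {0..b} \<subseteq> U" using T(4) b by auto
    ultimately have "eventually (\<lambda>n. (\<lambda>t. Z t \<omega>) ` {0..b} \<subseteq> K n) sequentially" by (rule exh)
    then show "eventually (\<lambda>n. a < \<tau> n) sequentially"
    proof eventually_elim
      case (elim n)
      have "b \<le> \<tau> n"
      proof (rule ccontr)
        assume "\<not> b \<le> \<tau> n"
        then have "0 < b - \<tau> n" by simp
        then obtain s where "s > \<tau> n" "s < \<tau> n + (b - \<tau> n)" "Z s \<omega> \<notin> K n" using \<tau>(3) by blast
        moreover have "s \<in> {0..b}" using calculation \<tau>(1)[of n] by auto
        ultimately show False using elim by blast
      qed
      then show ?case using b by simp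
    qed
  qed
  then have "(\<lambda>n. Z (\<tau> n) \<omega>) \<longlonglongrightarrow> Z T \<omega>"
    using continuous_on_tendsto_compose[OF cont, of \<tau> T sequentially] T(1) \<tau>(1) by auto
  then show ?thesis by (simp add: pos)
qed

text \<open>\<open>P\<close> will quantify over uncountably many times, so it is bounded from
  outside by events of arbitrarily small probability.\<close>

lemma (in prob_space) AE_not_if_small:
  assumes "\<And>e. 0 < e \<Longrightarrow> \<exists>A\<in>events. prob A \<le> e \<and> (AE \<omega> in M. P \<omega> \<longrightarrow> \<omega> \<in> A)"
  shows "AE \<omega> in M. \<not> P \<omega>"
proof -
  have "\<forall>n::nat. \<exists>A. A \<in> events \<and> prob A \<le> 1 / (n + 1) \<and> (AE \<omega> in M. P \<omega> \<longrightarrow> \<omega> \<in> A)"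
    using assms by (auto simp: Bex_def)
  then obtain A where A: "\<And>n. A n \<in> events" "\<And>n. prob (A n) \<le> 1 / (real n + 1)" "\<And>n. AE \<omega> in M. P \<omega> \<longrightarrow> \<omega> \<in> A n"
    by metis
  have m: "(\<Inter>n. A n) \<in> events" using A(1) by auto
  have "prob (\<Inter>n. A n) \<le> 0"
  proof (rule tendsto_lowerbound)
    show "(\<lambda>n. 1 / (real n + 1)) \<longlonglongrightarrow> 0" by real_asymp
    have "prob (\<Inter>n. A n) \<le> prob (A n)" for n by (rule finite_measure_mono) (use A in auto)
    then show "eventually (\<lambda>n. prob (\<Inter>n. A n) \<le> 1 / (real n + 1)) sequentially"
      using A(2) by (intro always_eventually allI) (rule order_trans)
  qed auto
  then have "(\<Inter>n. A n) \<in> null_sets M" using m by (intro null_setsI) (auto simp: emeasure_eq_measure measure_le_0_iff)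
  then have "AE \<omega> in M. \<omega> \<notin> (\<Inter>n. A n)" by (rule AE_not_in)
  moreover have "AE \<omega> in M. \<forall>n. P \<omega> \<longrightarrow> \<omega> \<in> A n" 
    by (subst AE_all_countable) (use A(3) in blast)
  ultimately show ?thesis by eventually_elim auto
qed

text \<open>The intersections increase with \<open>N\<close> and each lies in \<open>F N\<close>, so
  a uniform bound survives the limit.\<close>

lemma (in prob_space) prob_liminf_le:
  assumes F: "\<And>n::nat. F n \<in> events" "\<And>n. prob (F n) \<le> L"
  shows "(\<Union>N. \<Inter>n\<in>{N..}. F n) \<in> events" "prob (\<Union>N. \<Inter>n\<in>{N..}. F n) \<le> L"
proof -
  have m: "(\<Inter>n\<in>{N..}. F n) \<in> events" for N using F(1) by (intro sets.countable_INT') auto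
  then show "(\<Union>N. \<Inter>n\<in>{N..}. F n) \<in> events" by auto
  have "(\<lambda>N. prob (\<Inter>n\<in>{N..}. F n)) \<longlonglongrightarrow> prob (\<Union>N. \<Inter>n\<in>{N..}. F n)"
    by (rule finite_Lim_measure_incseq) (use m in \<open>auto simp: incseq_def\<close>)
  moreover have "prob (\<Inter>n\<in>{N..}. F n) \<le> L" for N
    using finite_measure_mono[of "\<Inter>n\<in>{N..}. F n" "F N"] F by (meson INT_lower atLeast_iff le_refl order_trans)
  ultimately show "prob (\<Union>N. \<Inter>n\<in>{N..}. F n) \<le> L" by (intro LIMSEQ_le_const2) auto
qed

context standard_planar_brownian_motion
begin

text \<open>Markov's inequality after optional stopping: at the exit \<open>u - \<alpha>\<close> is
  nonnegative, and at least \<open>\<gamma>\<close> on \<open>S\<close>, while at time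
  \<open>t0\<close> it is at most \<open>\<beta> - \<alpha>\<close> on \<open>C\<close>.\<close>

lemma prob_exit_le:
  assumes t0: "0 \<le> t0" and K: "compact K" "K \<subseteq> W" "open W" and u: "locally_Re_holomorphic u W"
    and C [measurable]: "C \<in> sets borel" "C \<subseteq> K" and S [measurable]: "S \<in> sets borel"
    and \<alpha>: "\<And>z. z \<in> frontier K \<Longrightarrow> \<alpha> \<le> u z" and \<beta>: "\<And>z. z \<in> C \<Longrightarrow> u z \<le> \<beta>" and "\<alpha> \<le> \<beta>"
    and \<gamma>: "\<And>z. z \<in> frontier K \<Longrightarrow> z \<in> S \<Longrightarrow> \<alpha> + \<gamma> \<le> u z" "0 < \<gamma>"
  shows "{\<omega> \<in> space M. Z t0 \<omega> \<in> C \<and> exit_point K t0 \<omega> \<in> S} \<in> events"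
    and "prob {\<omega> \<in> space M. Z t0 \<omega> \<in> C \<and> exit_point K t0 \<omega> \<in> S} \<le> (\<beta> - \<alpha>) / \<gamma>"
proof -
  let ?F = "{\<omega> \<in> space M. Z t0 \<omega> \<in> C \<and> exit_point K t0 \<omega> \<in> S}"
  have clK: "closed K" using K(1) by (rule compact_imp_closed)
  have [measurable]: "Z t0 \<in> borel_measurable M" using t0 by simp
  note borel_measurable_exit_point[OF t0 clK, measurable]
  show Fm: "?F \<in> events" by measurable
  obtain v :: "complex \<Rightarrow> real" where v [measurable]: "v \<in> borel_measurable borel" and vb: "bounded (range v)" and vu: "\<And>z. z \<in> K \<Longrightarrow> v z = u z"
    and ev: "expectation (\<lambda>\<omega>. indicator C (Z t0 \<omega>) * v (exit_point K t0 \<omega>)) = expectation (\<lambda>\<omega>. indicator C (Z t0 \<omega>) * v (Z t0 \<omega>))"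
    by (rule expectation_harmonic_exit[OF t0 K u C]) (rule that)
  obtain B where B: "\<And>z. \<bar>v z\<bar> \<le> B" using vb by (auto simp: bounded_iff)
  have int: "integrable M (\<lambda>\<omega>. indicator C (Z t0 \<omega>) * v (Y \<omega>))" if "Y \<in> borel_measurable M" for Y
    by (rule integrable_const_bound[of _ B]) (use that B order_trans[OF abs_ge_zero B] in \<open>auto simp: indicator_def\<close>)
  let ?c = "\<lambda>\<omega>. indicator C (Z t0 \<omega>) :: real"
  have cm: "?c \<in> borel_measurable M" by measurable
  have ci: "integrable M ?c" by (rule integrable_const_bound[of _ 1]) (auto simp: indicator_def)
  have fi: "integrable M (indicator ?F :: 'a \<Rightarrow> real)" 
    by (rule integrable_const_bound[of _ 1]) (use borel_measurable_indicator[OF Fm] in \<open>auto simp: indicator_def\<close>)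
  have Ec: "expectation ?c \<le> 1" "0 \<le> expectation ?c"
    using integral_mono[OF ci, of "\<lambda>_. 1"] by (auto simp: prob_space indicator_def)
  have "\<alpha> * expectation ?c + \<gamma> * prob ?F = expectation (\<lambda>\<omega>. \<alpha> * ?c \<omega> + \<gamma> * indicator ?F \<omega>)"
    using ci fi Fm by (simp add: Bochner_Integration.integral_add)
  also have "\<dots> \<le> expectation (\<lambda>\<omega>. ?c \<omega> * v (exit_point K t0 \<omega>))"
  proof (rule integral_mono_AE)
    show "AE \<omega> in M. \<alpha> * ?c \<omega> + \<gamma> * indicator ?F \<omega> \<le> ?c \<omega> * v (exit_point K t0 \<omega>)"
      using AE_exit_point[OF t0 K(1)]
    proof eventually_elim
      case (elim \<omega>)
      show ?case
      proof (cases "Z t0 \<omega> \<in> C")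
        case True
        then have fr: "exit_point K t0 \<omega> \<in> frontier K" using elim C(2) by auto
        then have "v (exit_point K t0 \<omega>) = u (exit_point K t0 \<omega>)" using vu frontier_subset_closed[OF clK] by blast
        then show ?thesis using True \<alpha>[OF fr] \<gamma>(1)[OF fr] \<gamma>(2) by (auto simp: indicator_def)
      qed (auto simp: indicator_def)
    qed
  qed (use ci fi int in auto)
  also have "\<dots> = expectation (\<lambda>\<omega>. ?c \<omega> * v (Z t0 \<omega>))" by (rule ev)
  also have "\<dots> \<le> expectation (\<lambda>\<omega>. \<beta> * ?c \<omega>)"
    by (rule integral_mono) (use ci int vu \<beta> C(2) in \<open>auto simp: indicator_def\<close>)
  also have "\<dots> = \<beta> * expectation ?c" by simp
  finally have "\<gamma> * prob ?F \<le> (\<beta> - \<alpha>) * expectation ?c" by (simp add: algebra_simps)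
  also have "\<dots> \<le> (\<beta> - \<alpha>) * 1" using Ec \<open>\<alpha> \<le> \<beta>\<close> by (intro mult_left_mono) auto
  finally show "prob ?F \<le> (\<beta> - \<alpha>) / \<gamma>" using \<gamma>(2) by (simp add: field_simps)
qed

text \<open>A path that avoids the disc of radius \<open>a\<close> leaves every annulus through the
  outer circle. For \<open>ln (cmod z)\<close> this has probability at most
  \<open>(ln R' - ln a) / (ln b - ln a)\<close>, which tends to 0 as the outer radius
  \<open>b\<close> grows.\<close>

theorem AE_recurrent:
  assumes t0: "0 \<le> t0" and a: "0 < a"
  shows "AE \<omega> in M. \<exists>s\<ge>t0. cmod (Z s \<omega>) \<le> a"
proof -
  have comp: "compact {z. a \<le> cmod z \<and> cmod z \<le> b}" for b
  proof -
    have "{z. a \<le> cmod z \<and> cmod z \<le> b} = cball 0 b - ball 0 a" by auto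
    then show ?thesis by (simp add: compact_diff)
  qed
  have small: "AE \<omega> in M. \<not> (a \<le> cmod (Z t0 \<omega>) \<and> cmod (Z t0 \<omega>) \<le> real R \<and> (\<forall>s\<ge>t0. a < cmod (Z s \<omega>)))" for R :: nat
  proof (rule AE_not_if_small)
    fix e :: real assume e: "0 < e"
    \<comment> \<open>Ensures \<open>ln a \<le> ln R'\<close> when the natural number
      \<open>R\<close> is smaller than \<open>a\<close>.\<close>
    define R' where "R' = max (real R) a"
    have R': "real R \<le> R'" "a \<le> R'" by (auto simp: R'_def)
    have "filterlim (\<lambda>b. (ln R' - ln a) / (ln b - ln a)) (nhds 0) at_top" by real_asymp
    then have "eventually (\<lambda>b. (ln R' - ln a) / (ln b - ln a) < e) at_top" using e by (rule order_tendstoD)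
    then have "eventually (\<lambda>b. (ln R' - ln a) / (ln b - ln a) < e \<and> R' < b) at_top"
      using eventually_gt_at_top by (rule eventually_conj)
    then obtain b where b: "(ln R' - ln a) / (ln b - ln a) < e" "R' < b"
      using eventually_happens'[OF trivial_limit_at_top_linorder] by blast
    define K where "K = {z. a \<le> cmod z \<and> cmod z \<le> b}"
    define C where "C = {z. a \<le> cmod z \<and> cmod z \<le> R'}"
    have fr: "frontier K \<subseteq> K - {z. a < cmod z \<and> cmod z < b}"
      unfolding K_def by (rule frontier_subset_diff[OF compact_imp_closed[OF comp]])
        (auto intro!: open_Collect_conj open_Collect_less continuous_intros)
    have u: "locally_Re_holomorphic (\<lambda>z. ln (cmod z)) (- {0})"
      using locally_Re_holomorphic_ln_cmod[of "\<lambda>z. z" "- {0}"] by (simp add: holomorphic_on_ident)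
    let ?F = "{\<omega> \<in> space M. Z t0 \<omega> \<in> C \<and> exit_point K t0 \<omega> \<in> sphere 0 b}"
    have p: "compact K" "K \<subseteq> - {0}" "open (- {0::complex})" "C \<in> sets borel" "C \<subseteq> K" "sphere (0::complex) b \<in> sets borel"
      using a b by (auto simp: K_def C_def intro!: comp borel_compact compact_sphere)
    have q: "ln a \<le> ln (cmod z)" if "z \<in> frontier K" for z
    proof -
      have "z \<in> K" using fr that by blast
      then have "a \<le> cmod z" by (simp add: K_def)
      then show ?thesis using a by (subst ln_le_cancel_iff; linarith)
    qed
    have q': "ln (cmod z) \<le> ln R'" if "z \<in> C" for z
    proof -
      have "a \<le> cmod z" "cmod z \<le> R'" using that by (simp_all add: C_def)
      then show ?thesis using a by (subst ln_le_cancel_iff; linarith)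
    qed
    have q'': "ln a + (ln b - ln a) \<le> ln (cmod z)" if "z \<in> frontier K" "z \<in> sphere 0 b" for z using that by auto
    have l: "ln a \<le> ln R'" "0 < ln b - ln a" using a b R' by auto
    have *: "?F \<in> events" "prob ?F \<le> (ln R' - ln a) / (ln b - ln a)"
      by (rule prob_exit_le[OF t0 p(1-3) u p(4-6) q q' l(1) q'' l(2)], assumption+)+
    have "AE \<omega> in M. (a \<le> cmod (Z t0 \<omega>) \<and> cmod (Z t0 \<omega>) \<le> real R \<and> (\<forall>s\<ge>t0. a < cmod (Z s \<omega>))) \<longrightarrow> \<omega> \<in> ?F"
      using AE_exit_point[OF t0 comp[of b], folded K_def] AE_space
    proof eventually_elim
      case (elim \<omega>)
      show ?case
      proof
        assume as: "a \<le> cmod (Z t0 \<omega>) \<and> cmod (Z t0 \<omega>) \<le> real R \<and> (\<forall>s\<ge>t0. a < cmod (Z s \<omega>))"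
        then have C: "Z t0 \<omega> \<in> C" using R' by (auto simp: C_def)
        then have "Z t0 \<omega> \<in> K" using b by (auto simp: C_def K_def)
        then obtain \<tau> where "\<tau> \<ge> t0" "exit_point K t0 \<omega> = Z \<tau> \<omega>" "Z \<tau> \<omega> \<in> frontier K" using elim(1) by blast
        then have "Z \<tau> \<omega> \<in> K - {z. a < cmod z \<and> cmod z < b}" using fr by blast
        moreover have "a < cmod (Z \<tau> \<omega>)" using as \<open>\<tau> \<ge> t0\<close> by blast
        ultimately have "cmod (exit_point K t0 \<omega>) = b"
          using \<open>exit_point K t0 \<omega> = Z \<tau> \<omega>\<close> by (auto simp: K_def)
        then show "\<omega> \<in> ?F" using C elim(2) by simp
      qed
    qed
    then show "\<exists>A\<in>events. prob A \<le> e \<and> (AE \<omega> in M. (a \<le> cmod (Z t0 \<omega>) \<and> cmod (Z t0 \<omega>) \<le> real R \<and> (\<forall>s\<ge>t0. a < cmod (Z s \<omega>))) \<longrightarrow> \<omega> \<in> A)"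
      using * b(1) by (intro bexI[of _ ?F]) auto
  qed
  have "AE \<omega> in M. \<forall>R::nat. \<not> (a \<le> cmod (Z t0 \<omega>) \<and> cmod (Z t0 \<omega>) \<le> real R \<and> (\<forall>s\<ge>t0. a < cmod (Z s \<omega>)))"
    by (subst AE_all_countable, intro allI, rule small)
  then show ?thesis
  proof eventually_elim
    case (elim \<omega>)
    show ?case
    proof (rule ccontr)
      assume no: "\<not> (\<exists>s\<ge>t0. cmod (Z s \<omega>) \<le> a)"
      obtain R where "cmod (Z t0 \<omega>) \<le> real R" using real_arch_simple by blast
      moreover have "a < cmod (Z s \<omega>)" if "s \<ge> t0" for s using no that by force
      ultimately show False using elim less_imp_le by blast
    qed
  qed
qed

end

section \<open>The inverse map and compact subsets of the image\<close>

locale univalent_on_disc =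
  fixes f :: "complex \<Rightarrow> complex"
  assumes holomorphic: "f holomorphic_on ball 0 1" and inj: "inj_on f (ball 0 1)" and f_0: "f 0 = 0"
begin

definition "U = f ` ball 0 1"
definition "g = inv_into (ball 0 1) f"

lemma g_f [simp]: "cmod z < 1 \<Longrightarrow> g (f z) = z"
  unfolding g_def by (rule inv_into_f_f[OF inj]) simp

lemma f_g: "w \<in> U \<Longrightarrow> f (g w) = w" and cmod_g: "w \<in> U \<Longrightarrow> cmod (g w) < 1"
  unfolding U_def by auto

lemma open_U: "open U" unfolding U_def by (rule open_mapping_thm3[OF holomorphic open_ball inj])

lemma open_image: "open V \<Longrightarrow> V \<subseteq> ball 0 1 \<Longrightarrow> open (f ` V)"
  by (rule open_mapping_thm3) (use holomorphic inj in \<open>auto intro: holomorphic_on_subset inj_on_subset\<close>)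

lemma compact_image: "compact A \<Longrightarrow> A \<subseteq> ball 0 1 \<Longrightarrow> compact (f ` A)"
  by (rule compact_continuous_image[OF continuous_on_subset[OF holomorphic_on_imp_continuous_on[OF holomorphic]]])

lemma holomorphic_g: "g holomorphic_on U"
proof -
  obtain h where h: "h holomorphic_on f ` ball 0 1" "\<And>z. z \<in> ball 0 1 \<Longrightarrow> h (f z) = z"
    by (rule holomorphic_has_inverse[OF holomorphic open_ball inj]) (rule that)
  have "g w = h w" if "w \<in> U" for w using h(2)[of "g w"] f_g[OF that] cmod_g[OF that] by simp
  then show ?thesis using h(1) unfolding U_def by (metis holomorphic_transform)
qed

lemma continuous_g: "A \<subseteq> U \<Longrightarrow> continuous_on A g"
  using holomorphic_on_imp_continuous_on[OF holomorphic_g] continuous_on_subset by blast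

lemma frontier_image:
  assumes "compact A" "A \<subseteq> ball 0 1" "open V" "V \<subseteq> A"
  shows "frontier (f ` A) \<subseteq> f ` (A - V)"
proof -
  have "frontier (f ` A) \<subseteq> f ` A - f ` V"
    using assms by (intro frontier_subset_diff compact_imp_closed compact_image open_image) auto
  then show ?thesis by blast
qed

lemma image_in_iff: "A \<subseteq> ball 0 1 \<Longrightarrow> w \<in> f ` A \<longleftrightarrow> w \<in> U \<and> g w \<in> A"
proof (intro iffI conjI)
  assume A: "A \<subseteq> ball 0 1"
  show "w \<in> U" if "w \<in> f ` A" using that A by (auto simp: U_def)
  show "g w \<in> A" if "w \<in> f ` A" using that A by auto
  show "w \<in> f ` A" if "w \<in> U \<and> g w \<in> A" using that f_g[of w] by (metis imageI)
qed

lemma frontier_annulus: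
  assumes "s < r" "r < 1" and z: "z \<in> frontier (f ` {z. s \<le> cmod z \<and> cmod z \<le> r})"
  shows "z \<in> U" "cmod (g z) = s \<or> cmod (g z) = r"
proof -
  have "{z. s \<le> cmod z \<and> cmod z \<le> r} = cball 0 r - ball (0::complex) s" by auto
  then have c: "compact {z::complex. s \<le> cmod z \<and> cmod z \<le> r}" by (simp add: compact_diff)
  have sub: "{z. s \<le> cmod z \<and> cmod z \<le> r} \<subseteq> ball 0 1" using assms by auto
  have "frontier (f ` {z. s \<le> cmod z \<and> cmod z \<le> r}) \<subseteq> f ` ({z. s \<le> cmod z \<and> cmod z \<le> r} - {z. s < cmod z \<and> cmod z < r})"
    by (rule frontier_image[OF c sub]) (auto intro!: open_Collect_conj open_Collect_less continuous_intros)
  then have "z \<in> f ` ({z. s \<le> cmod z \<and> cmod z \<le> r} - {z. s < cmod z \<and> cmod z < r})" using z by blast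
  then have "z \<in> U \<and> g z \<in> {z. s \<le> cmod z \<and> cmod z \<le> r} - {z. s < cmod z \<and> cmod z < r}"
    by (subst (asm) image_in_iff) (use sub in auto)
  then show "z \<in> U" "cmod (g z) = s \<or> cmod (g z) = r" by auto
qed

lemma compact_annulus: "r < 1 \<Longrightarrow> compact (f ` {z. s \<le> cmod z \<and> cmod z \<le> r})"
proof (rule compact_image)
  have "{z. s \<le> cmod z \<and> cmod z \<le> r} = cball 0 r - ball (0::complex) s" by auto
  then show "compact {z::complex. s \<le> cmod z \<and> cmod z \<le> r}" by (simp add: compact_diff)
qed auto

lemma compact_exhaustion:
  assumes A: "compact A" "A \<subseteq> U" and r: "r \<longlonglongrightarrow> 1"
  shows "eventually (\<lambda>n::nat. A \<subseteq> f ` cball 0 (r n)) sequentially"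
proof -
  have "compact (g ` A)" using A continuous_g by (intro compact_continuous_image) auto
  moreover have "g ` A \<subseteq> ball 0 1" using A cmod_g by auto
  ultimately obtain q where q: "q < 1" "\<And>z. z \<in> g ` A \<Longrightarrow> cmod z \<le> q" by (rule compact_subset_unit_ball) (rule that)
  have "eventually (\<lambda>n. q < r n) sequentially" using r q(1) by (rule order_tendstoD)
  then show ?thesis
  proof eventually_elim
    case (elim n)
    show ?case
    proof
      fix w assume w: "w \<in> A"
      then have "w = f (g w)" "g w \<in> cball 0 (r n)" using A(2) f_g q(2)[of "g w"] elim by auto
      then show "w \<in> f ` cball 0 (r n)" by blast
    qed
  qed
qed

end

section \<open>The law of the exit point from the image of a smaller disc\<close>

locale univalent_brownian_motion = standard_planar_brownian_motion M Z + univalent_on_disc f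
  for M :: "'a measure" and Z :: "real \<Rightarrow> 'a \<Rightarrow> complex" and f :: "complex \<Rightarrow> complex"
begin

text \<open>\<open>f\<close> is arbitrary off the disc; restricting to the unit circle, with default
  value 0 elsewhere, gives a Borel function on the plane when \<open>0 < r\<close> and
  \<open>r < 1\<close>.\<close>

definition boundary_circle :: "real \<Rightarrow> complex \<Rightarrow> complex" where
  "boundary_circle r \<zeta> = indicator (sphere 0 1) \<zeta> *\<^sub>R f (of_real r * \<zeta>)"

lemma continuous_on_boundary_circle:
  assumes "0 < r" "r < 1"
  shows "continuous_on (sphere 0 1) (\<lambda>\<zeta>. f (of_real r * \<zeta>))"
  by (rule continuous_on_compose2[OF holomorphic_on_imp_continuous_on[OF holomorphic]])
     (use assms in \<open>auto simp: norm_mult intro!: continuous_intros\<close>)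

lemma borel_measurable_boundary_circle [measurable]:
  assumes "0 < r" "r < 1" shows "boundary_circle r \<in> borel_measurable borel"
  unfolding boundary_circle_def[abs_def]
  by (rule borel_measurable_continuous_on_indicator[OF _ continuous_on_boundary_circle[OF assms]]) auto

text \<open>The pulled back exit point \<open>g X / r\<close> lies on the unit circle. Optional
  stopping for powers of \<open>g\<close>, started at \<open>g 0 = 0\<close>, shows that its moments
  are those of the uniform law.\<close>

theorem expectation_exit_disc:
  fixes \<phi> :: "complex \<Rightarrow> real"
  assumes r: "0 < r" "r < 1" and \<phi>: "continuous_on UNIV \<phi>"
  shows "expectation (\<lambda>\<omega>. \<phi> (exit_point (f ` cball 0 r) 0 \<omega>)) = (\<integral>\<zeta>. \<phi> (boundary_circle r \<zeta>) \<partial>circle_measure)"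
proof -
  let ?K = "f ` cball 0 r"
  let ?X = "exit_point ?K 0"
  have sub: "cball 0 r \<subseteq> ball 0 (1::real)" "cball (0::complex) r \<subseteq> ball 0 1" "sphere (0::complex) r \<subseteq> ball 0 1" using r by auto
  have K: "compact ?K" "?K \<subseteq> U" using sub by (auto simp: U_def intro!: compact_image)
  have [measurable]: "\<phi> \<in> borel_measurable borel" using \<phi> by (rule borel_measurable_continuous_onI)
  have Xm [measurable]: "?X \<in> borel_measurable M" by (rule borel_measurable_exit_point) (use K compact_imp_closed in auto)
  have AX: "AE \<omega> in M. ?X \<omega> \<in> U \<and> cmod (g (?X \<omega>)) = r"
    using AE_exit_point[OF order_refl K(1)] start
  proof eventually_elim
    case (elim \<omega>)
    have "0 \<in> ?K" using f_0 r by (auto intro!: image_eqI[of _ _ 0])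
    then have "?X \<omega> \<in> frontier ?K" using elim by auto
    moreover have "frontier ?K \<subseteq> f ` (cball 0 r - ball 0 r)" by (rule frontier_image) (use sub in auto)
    ultimately have "?X \<omega> \<in> f ` sphere 0 r" by auto
    then have "?X \<omega> \<in> U \<and> g (?X \<omega>) \<in> sphere 0 r" by (subst (asm) image_in_iff) (use sub in auto)
    then show ?case by simp
  qed
  define G where "G = (\<lambda>w. indicator ?K w *\<^sub>R (g w / of_real r))"
  have Gm [measurable]: "G \<in> borel_measurable borel" unfolding G_def
    by (rule borel_measurable_continuous_on_indicator) (use K r continuous_g in \<open>auto intro!: continuous_intros borel_compact\<close>)
  have KX: "AE \<omega> in M. ?X \<omega> \<in> ?K"
    using AX by eventually_elim (subst image_in_iff, use sub in auto)
  have GX: "AE \<omega> in M. cmod (G (?X \<omega>)) = 1 \<and> G (?X \<omega>) = g (?X \<omega>) / of_real r \<and> boundary_circle r (G (?X \<omega>)) = ?X \<omega>"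
    using AX KX
  proof eventually_elim
    case (elim \<omega>)
    then have 1: "G (?X \<omega>) = g (?X \<omega>) / of_real r" by (simp add: G_def)
    then have "cmod (G (?X \<omega>)) = 1" using elim r by (simp add: norm_divide)
    moreover have "f (of_real r * G (?X \<omega>)) = ?X \<omega>" using 1 r elim f_g by simp
    ultimately show ?case using 1 by (simp add: boundary_circle_def)
  qed
  let ?\<mu> = "distr M borel (\<lambda>\<omega>. G (?X \<omega>))"
  have "integral\<^sup>L ?\<mu> (\<lambda>\<zeta>. \<phi> (boundary_circle r \<zeta>)) = (\<integral>\<zeta>. \<phi> (boundary_circle r \<zeta>) \<partial>circle_measure)"
  proof (rule integral_circle_of_moments)
    show "prob_space ?\<mu>" by (rule prob_space_distr) simp
    show "AE z in ?\<mu>. cmod z = 1" using GX by (subst AE_distr_iff) (auto elim: eventually_mono)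
    show "(\<lambda>\<zeta>. \<phi> (boundary_circle r \<zeta>)) \<in> borel_measurable borel" using r by measurable
    have "continuous_on (sphere 0 1) (\<lambda>\<zeta>. \<phi> (f (of_real r * \<zeta>)))"
      by (rule continuous_on_compose2[OF \<phi> continuous_on_boundary_circle[OF r]]) auto
    then show "continuous_on (sphere 0 1) (\<lambda>\<zeta>. \<phi> (boundary_circle r \<zeta>))"
      by (rule continuous_on_cong[THEN iffD1, rotated -1]) (auto simp: boundary_circle_def)
    fix a :: complex and n :: nat
    \<comment> \<open>Rescaled so that \<open>b * g w ^ n\<close> is
      \<open>a * (g w / of_real r) ^ n\<close>.\<close>
    define b where "b = a / of_real r ^ n"
    have h: "(\<lambda>w. b * g w ^ n) holomorphic_on U" by (intro holomorphic_intros holomorphic_g)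
    obtain v :: "complex \<Rightarrow> real" where v [measurable]: "v \<in> borel_measurable borel" and vu: "\<And>z. z \<in> ?K \<Longrightarrow> v z = Re (b * g z ^ n)"
      and ev: "expectation (\<lambda>\<omega>. indicator ?K (Z 0 \<omega>) * v (?X \<omega>)) = expectation (\<lambda>\<omega>. indicator ?K (Z 0 \<omega>) * v (Z 0 \<omega>))"
      by (rule expectation_harmonic_exit[OF order_refl K open_U locally_Re_holomorphic_Re[OF h], of ?K]) 
         (use K in \<open>auto intro: borel_compact\<close>)
    have [measurable]: "?K \<in> sets borel" using K by (intro borel_compact)
    have [measurable]: "Z 0 \<in> borel_measurable M" by simp
    have K0: "AE \<omega> in M. Z 0 \<omega> = 0 \<and> Z 0 \<omega> \<in> ?K"
      using start by eventually_elim (use f_0 r in \<open>auto intro!: image_eqI[of _ _ 0]\<close>)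
    have g0: "g 0 = 0" using g_f[of 0] f_0 by simp
    have "(\<integral>z. Re (a * z ^ n) \<partial>?\<mu>) = expectation (\<lambda>\<omega>. Re (a * G (?X \<omega>) ^ n))"
      by (subst integral_distr) auto
    also have "\<dots> = expectation (\<lambda>\<omega>. indicator ?K (Z 0 \<omega>) * v (?X \<omega>))"
    proof (rule integral_cong_AE)
      show "AE \<omega> in M. Re (a * G (?X \<omega>) ^ n) = indicator ?K (Z 0 \<omega>) * v (?X \<omega>)"
        using GX KX K0
      proof eventually_elim
        case (elim \<omega>)
        then have 1: "indicator ?K (Z 0 \<omega>) = (1::real)" by (intro indicator_simps(1)) blast
        have 2: "v (?X \<omega>) = Re (b * g (?X \<omega>) ^ n)" using vu elim(2) by blast
        have 3: "G (?X \<omega>) = g (?X \<omega>) / of_real r" using elim(1) by blast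
        show ?case unfolding 1 2 3 by (simp add: b_def power_divide)
      qed
    qed measurable
    also have "\<dots> = expectation (\<lambda>\<omega>. Re (a * 0 ^ n))" unfolding ev
    proof (rule integral_cong_AE)
      show "AE \<omega> in M. indicator ?K (Z 0 \<omega>) * v (Z 0 \<omega>) = Re (a * 0 ^ n)"
        using K0
      proof eventually_elim
        case (elim \<omega>)
        then have 1: "indicator ?K (Z 0 \<omega>) = (1::real)" by (intro indicator_simps(1)) blast
        have 2: "v (Z 0 \<omega>) = Re (b * g (Z 0 \<omega>) ^ n)" using vu elim by blast
        have 3: "Z 0 \<omega> = 0" using elim by blast
        show ?case unfolding 1 2 unfolding 3 g0 by (cases n) (simp_all add: b_def)
      qed
    qed measurable
    also have "\<dots> = Re (a * 0 ^ n)" by (simp add: prob_space)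
    finally show "(\<integral>z. Re (a * z ^ n) \<partial>?\<mu>) = Re (a * 0 ^ n)" .
  qed simp
  moreover have "integral\<^sup>L ?\<mu> (\<lambda>\<zeta>. \<phi> (boundary_circle r \<zeta>)) = expectation (\<lambda>\<omega>. \<phi> (?X \<omega>))"
  proof -
    have "integral\<^sup>L ?\<mu> (\<lambda>\<zeta>. \<phi> (boundary_circle r \<zeta>)) = expectation (\<lambda>\<omega>. \<phi> (boundary_circle r (G (?X \<omega>))))"
      by (subst integral_distr) (use r in auto)
    also have "\<dots> = expectation (\<lambda>\<omega>. \<phi> (?X \<omega>))"
      by (rule integral_cong_AE) (use GX r in \<open>auto elim: eventually_mono\<close>)
    finally show ?thesis .
  qed
  ultimately show ?thesis by simp
qed

end

section \<open>The exit position\<close>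

text \<open>The indicator of a closed set is a bounded pointwise limit of clipped multiples of the
  distance, and closed sets form an intersection-stable generator of the Borel sets.\<close>

lemma measure_eqI_bounded_continuous:
  fixes \<mu> \<nu> :: "complex measure"
  assumes "prob_space \<mu>" "prob_space \<nu>" and s: "sets \<mu> = sets borel" "sets \<nu> = sets borel"
    and eq: "\<And>\<phi>. continuous_on UNIV \<phi> \<Longrightarrow> (\<And>z. 0 \<le> \<phi> z \<and> \<phi> z \<le> (1::real)) \<Longrightarrow> integral\<^sup>L \<mu> \<phi> = integral\<^sup>L \<nu> \<phi>"
  shows "\<mu> = \<nu>"
proof -
  interpret \<mu>: prob_space \<mu> by fact
  interpret \<nu>: prob_space \<nu> by fact
  have closed: "measure \<mu> A = measure \<nu> A" if A: "closed A" for A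
  proof (cases "A = {}")
    case False
    define \<phi> where "\<phi> = (\<lambda>(n::nat) z. max 0 (1 - real n * infdist z A))"
    have cont: "continuous_on UNIV (\<phi> n)" for n unfolding \<phi>_def by (intro continuous_intros)
    have bd: "0 \<le> \<phi> n z \<and> \<phi> n z \<le> 1" for n z by (auto simp: \<phi>_def infdist_nonneg)
    have lim: "(\<lambda>n. \<phi> n z) \<longlonglongrightarrow> indicator A z" for z
    proof (cases "z \<in> A")
      case True then show ?thesis by (simp add: \<phi>_def)
    next
      case outside: False
      then have d: "0 < infdist z A" using A False infdist_nonneg[of z A] in_closed_iff_infdist_zero[OF A False] by fastforce
      obtain N where N: "1 / infdist z A < real N" using reals_Archimedean2 by blast
      have "\<phi> n z = 0" if "N \<le> n" for n
      proof -
        have "1 \<le> real n * infdist z A" using N d that by (simp add: divide_less_eq) (meson less_eq_real_def less_le_trans mult_right_mono of_nat_mono order_trans)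
        then show ?thesis by (simp add: \<phi>_def)
      qed
      then have "eventually (\<lambda>n. \<phi> n z = 0) sequentially" using eventually_sequentially by blast
      then show ?thesis using outside by (simp add: tendsto_eventually)
    qed
    have conv: "(\<lambda>n. integral\<^sup>L \<rho> (\<phi> n)) \<longlonglongrightarrow> measure \<rho> A" if "prob_space \<rho>" and s: "sets \<rho> = sets borel" for \<rho>
    proof -
      interpret \<rho>: prob_space \<rho> by fact
      have "(\<lambda>n. integral\<^sup>L \<rho> (\<phi> n)) \<longlonglongrightarrow> integral\<^sup>L \<rho> (indicator A)"
        using cont bd lim s A
        by (intro integral_dominated_convergence[where w="\<lambda>_. 1"])
           (auto simp: measurable_cong_sets[OF s refl] intro!: borel_measurable_continuous_onI)
      then show ?thesis using s A by (simp add: sets_eq_imp_space_eq[OF s])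
    qed
    show ?thesis
      using LIMSEQ_unique[OF conv[OF assms(1) s(1)]] conv[OF assms(2) s(2)] eq[OF cont bd] by simp
  qed simp
  show ?thesis
  proof (rule measure_eqI_generator_eq[where E="Collect closed" and \<Omega>=UNIV and A="\<lambda>_. UNIV"])
    show "Int_stable (Collect (closed :: complex set \<Rightarrow> bool))" by (auto simp: Int_stable_def)
    show "emeasure \<mu> X = emeasure \<nu> X" if "X \<in> Collect closed" for X
      using closed[of X] that by (simp add: \<mu>.emeasure_eq_measure \<nu>.emeasure_eq_measure)
    show "sets \<mu> = sigma_sets UNIV (Collect closed)" "sets \<nu> = sigma_sets UNIV (Collect closed)"
      unfolding s borel_eq_closed by (auto simp: sets_measure_of)
  qed auto
qed

text \<open>Off a null set \<open>X\<close> equals its Borel version \<open>Y\<close>, and in the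
  completion every subset of that null set is measurable.\<close>

lemma AE_eq_imp_measurable_completion:
  assumes Y: "Y \<in> borel_measurable M" and ae: "AE x in M. X x = Y x"
  shows "X \<in> borel_measurable (completion M)" and "distr (completion M) borel X = distr M borel Y"
proof -
  obtain N where N: "{x \<in> space M. X x \<noteq> Y x} \<subseteq> N" "N \<in> null_sets M"
    using ae by (auto elim!: AE_E simp: null_sets_def)
  show X: "X \<in> borel_measurable (completion M)"
  proof (rule measurableI)
    fix A :: "'b set" assume A: "A \<in> sets borel"
    have eq: "X -` A \<inter> space (completion M) = (Y -` A \<inter> space M - N) \<union> (X -` A \<inter> space M \<inter> N)"
      using N(1) by auto
    have "Y -` A \<inter> space M - N \<in> sets (completion M)"
      using measurable_sets[OF Y A] N(2) by (intro sets_completionI_sets sets.Diff) auto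
    moreover have "X -` A \<inter> space M \<inter> N \<in> sets (completion M)"
      by (rule null_sets_completion[OF N(2)]) auto
    ultimately show "X -` A \<inter> space (completion M) \<in> sets (completion M)"
      unfolding eq by (rule sets.Un)
  qed auto
  have "distr (completion M) borel X = distr (completion M) borel Y"
    by (rule distr_cong_AE[OF refl refl AE_completion[OF ae] X measurable_completion[OF Y]])
  then show "distr (completion M) borel X = distr M borel Y" using distr_completion[OF Y] by simp
qed

section \<open>The image domain is left almost surely\<close>

context univalent_brownian_motion
begin

theorem AE_exits: "AE \<omega> in M. \<exists>s\<ge>0. Z s \<omega> \<notin> U"
proof -
  have "AE \<omega> in M. \<not> (\<forall>s\<ge>0. Z s \<omega> \<in> U)"
  proof (rule AE_not_if_small)
    fix e :: real assume e: "0 < e"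
    \<comment> \<open>\<open>e / 2\<close> is one half of the error budget, the other half going to
      the event that \<open>Z t0\<close> is not yet near the boundary; \<open>1 / 2\<close>
      guarantees \<open>1 / 2 < r0\<close> below.\<close>
    define c where "c = min (e / 2) (1 / 2)"
    have c: "0 < c" "c \<le> 1 / 2" "c \<le> e / 2" using e by (auto simp: c_def)
    define r0 where "r0 = exp (- (c * ln 2))"
    have ln2: "0 < ln (2::real)" by simp
    have "- (c * ln 2) < 0" using c ln2 by simp
    then have r01: "r0 < 1" by (simp add: r0_def)
    have "c * ln 2 < 1 * ln 2" by (rule mult_strict_right_mono) (use c in auto)
    then have "exp (- ln 2) < r0" by (simp add: r0_def)
    then have r02: "1 / 2 < r0" by (simp add: exp_minus)
    have lnr0: "- ln r0 = c * ln 2" by (simp add: r0_def)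
    have K0: "compact (f ` cball 0 r0)" by (rule compact_image) (use r01 in auto)
    have "(\<lambda>n. prob {\<omega> \<in> space M. Z (real n) \<omega> \<in> f ` cball 0 r0}) \<longlonglongrightarrow> 0"
      by (rule prob_position_tendsto_0) (use K0 emeasure_compact_finite in \<open>auto intro: borel_compact\<close>)
    then have "eventually (\<lambda>n. prob {\<omega> \<in> space M. Z (real n) \<omega> \<in> f ` cball 0 r0} < e / 2) sequentially"
      using e by (intro order_tendstoD) auto
    then obtain n where n: "prob {\<omega> \<in> space M. Z (real n) \<omega> \<in> f ` cball 0 r0} < e / 2"
      using eventually_happens'[OF sequentially_bot] by blast
    define t0 where "t0 = real n"
    have t0: "0 \<le> t0" by (simp add: t0_def)
    define r where "r = (\<lambda>k::nat. 1 - (1 - r0) / (real k + 2))"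
    have r: "r0 < r k" "r k < 1" for k
    proof -
      have "(1 - r0) / (real k + 2) < (1 - r0) / 1" using r01 by (intro divide_strict_left_mono) auto
      then show "r0 < r k" by (simp add: r_def)
      show "r k < 1" using r01 by (simp add: r_def)
    qed
    have rlim: "r \<longlonglongrightarrow> 1" unfolding r_def by real_asymp
    define C where "C = (\<lambda>k. f ` {z. r0 \<le> cmod z \<and> cmod z \<le> r k})"
    define K where "K = (\<lambda>k. f ` {z. 1 / 2 \<le> cmod z \<and> cmod z \<le> r k})"
    define S where "S = f ` sphere 0 (1 / 2)"
    have cK: "compact (K k)" for k unfolding K_def by (rule compact_annulus[OF r(2)])
    have frK: "z \<in> U \<and> (cmod (g z) = 1 / 2 \<or> cmod (g z) = r k)" if "z \<in> frontier (K k)" for z k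
      using frontier_annulus[of "1 / 2" "r k" z] that r[of k] r02 unfolding K_def by auto
    have KK: "w \<in> K k \<longleftrightarrow> w \<in> U \<and> 1 / 2 \<le> cmod (g w) \<and> cmod (g w) \<le> r k" for w k
      unfolding K_def by (subst image_in_iff) (use r(2)[of k] in auto)
    have CC: "w \<in> C k \<longleftrightarrow> w \<in> U \<and> r0 \<le> cmod (g w) \<and> cmod (g w) \<le> r k" for w k
      unfolding C_def by (subst image_in_iff) (use r(2)[of k] in auto)
    have SS: "w \<in> S \<longleftrightarrow> w \<in> U \<and> cmod (g w) = 1 / 2" for w
      unfolding S_def by (subst image_in_iff) auto
    define F where "F = (\<lambda>k. {\<omega> \<in> space M. Z t0 \<omega> \<in> C k \<and> exit_point (K k) t0 \<omega> \<in> S})"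
    have gnz: "g z \<noteq> 0" if "z \<in> U - {0}" for z using f_g[of z] f_0 that by auto
    have U0: "open (U - {0})" using open_U by (simp add: open_delete)
    have h: "(\<lambda>z. inverse (g z)) holomorphic_on U - {0}"
      using gnz by (intro holomorphic_intros holomorphic_on_subset[OF holomorphic_g]) auto
    have u: "locally_Re_holomorphic (\<lambda>z. ln (cmod (inverse (g z)))) (U - {0})"
      by (rule locally_Re_holomorphic_ln_cmod[OF h]) (use gnz in simp)
    have g0: "g 0 = 0" using g_f[of 0] f_0 by simp
    have F: "F k \<in> events" "prob (F k) \<le> c" for k
    proof -
      have p: "K k \<subseteq> U - {0}" "C k \<in> sets borel" "C k \<subseteq> K k" "S \<in> sets borel"
      proof -
        show "K k \<subseteq> U - {0}" using g0 by (auto simp: KK)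
        show "C k \<subseteq> K k" using r02 by (auto simp: KK CC)
        show "C k \<in> sets borel" unfolding C_def by (intro borel_compact compact_annulus r)
        show "S \<in> sets borel" unfolding S_def by (intro borel_compact compact_image) auto
      qed
      have cm: "ln (cmod (inverse w)) = - ln (cmod w)" for w :: complex
        by (cases "w = 0") (simp_all add: norm_inverse ln_inverse)
      have q: "0 \<le> ln (cmod (inverse (g z)))" if "z \<in> frontier (K k)" for z
      proof -
        have "0 < cmod (g z)" "cmod (g z) \<le> 1" using frK[OF that] r[of k] r02 by linarith+
        then have "ln (cmod (g z)) \<le> 0" by (subst ln_le_zero_iff)
        then show ?thesis unfolding cm by linarith
      qed
      have q': "ln (cmod (inverse (g z))) \<le> c * ln 2" if "z \<in> C k" for z
      proof -
        have "r0 \<le> cmod (g z)" using that CC by blast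
        then have "ln r0 \<le> ln (cmod (g z))" using r02 by (subst ln_le_cancel_iff; linarith)
        then show ?thesis using lnr0 by (simp add: cm)
      qed
      have q'': "0 + ln 2 \<le> ln (cmod (inverse (g z)))" if "z \<in> frontier (K k)" "z \<in> S" for z
      proof -
        have "cmod (g z) = 1 / 2" using that(2) SS by blast
        then have "ln (cmod (g z)) = ln (1 / 2)" by (rule arg_cong)
        then show ?thesis unfolding cm by (simp add: ln_div)
      qed
      have l: "0 \<le> c * ln 2" "0 < ln (2::real)" using c by auto
      show "F k \<in> events" unfolding F_def
        by (rule prob_exit_le(1)[OF t0 cK p(1) U0 u p(2-4) q q' l(1) q'' l(2)])
      have "prob (F k) \<le> (c * ln 2 - 0) / ln 2" unfolding F_def
        by (rule prob_exit_le(2)[OF t0 cK p(1) U0 u p(2-4) q q' l(1) q'' l(2)])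
      then show "prob (F k) \<le> c" by simp
    qed
    \<comment> \<open>The outer radius beyond which the exit must be through \<open>S\<close>
      depends on the path, so the second part asks for \<open>F k\<close> from some index
      on.\<close>
    define A where "A = {\<omega> \<in> space M. Z t0 \<omega> \<in> f ` cball 0 r0} \<union> (\<Union>N. \<Inter>k\<in>{N..}. F k)"
    have [measurable]: "Z t0 \<in> borel_measurable M" "f ` cball 0 r0 \<in> sets borel" using t0 K0 by (auto intro: borel_compact)
    have A1: "{\<omega> \<in> space M. Z t0 \<omega> \<in> f ` cball 0 r0} \<in> events" by measurable
    have Am: "A \<in> events" unfolding A_def using A1 prob_liminf_le(1)[of F c, OF F] by auto
    have "prob A \<le> prob {\<omega> \<in> space M. Z t0 \<omega> \<in> f ` cball 0 r0} + prob (\<Union>N. \<Inter>k\<in>{N..}. F k)"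
      unfolding A_def using A1 prob_liminf_le(1)[of F c, OF F] by (rule measure_Un_le)
    also have "\<dots> \<le> e / 2 + e / 2"
      using n prob_liminf_le(2)[of F c, OF F] c by (intro add_mono) (auto simp: t0_def)
    finally have pA: "prob A \<le> e" by simp
    have "open (f ` ball 0 (1 / 2))" by (rule open_image) auto
    moreover have "0 \<in> f ` ball 0 (1 / 2)" using f_0 by (auto intro!: image_eqI[of _ _ 0])
    ultimately obtain a where a: "0 < a" "cball 0 a \<subseteq> f ` ball 0 (1 / 2)" by (meson open_contains_cball)
    have "AE \<omega> in M. \<forall>k. Z t0 \<omega> \<in> K k \<longrightarrow> (\<exists>\<tau>\<ge>t0. (\<forall>s. t0 \<le> s \<and> s \<le> \<tau> \<longrightarrow> Z s \<omega> \<in> K k) \<and>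
       exit_point (K k) t0 \<omega> = Z \<tau> \<omega> \<and> Z \<tau> \<omega> \<in> frontier (K k))"
    proof (subst AE_all_countable, intro allI)
      fix k
      show "AE \<omega> in M. Z t0 \<omega> \<in> K k \<longrightarrow> (\<exists>\<tau>\<ge>t0. (\<forall>s. t0 \<le> s \<and> s \<le> \<tau> \<longrightarrow> Z s \<omega> \<in> K k) \<and>
       exit_point (K k) t0 \<omega> = Z \<tau> \<omega> \<and> Z \<tau> \<omega> \<in> frontier (K k))"
        using AE_exit_point[OF t0 cK[of k]] by (rule eventually_mono) blast
    qed
    then have "AE \<omega> in M. (\<forall>s\<ge>0. Z s \<omega> \<in> U) \<longrightarrow> \<omega> \<in> A"
      using AE_recurrent[OF t0 a(1)] continuous_paths AE_space
    proof eventually_elim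
      case (elim \<omega>)
      show ?case
      proof
        assume inU: "\<forall>s\<ge>0. Z s \<omega> \<in> U"
        show "\<omega> \<in> A"
        proof (cases "cmod (g (Z t0 \<omega>)) \<le> r0")
          case True
          then have "Z t0 \<omega> \<in> f ` cball 0 r0"
            using inU t0 r01 by (subst image_in_iff) auto
          then show ?thesis using elim(4) by (simp add: A_def)
        next
          case False
          obtain s where s: "t0 \<le> s" "cmod (Z s \<omega>) \<le> a" using elim(2) by blast
          then have "Z s \<omega> \<in> f ` ball 0 (1 / 2)" using a(2) by auto
          then have gs: "cmod (g (Z s \<omega>)) < 1 / 2" by (subst (asm) image_in_iff) auto
          \<comment> \<open>Until the return time \<open>s\<close> the path keeps
            \<open>cmod (g w) \<le> q\<close> for some \<open>q < 1\<close>. Once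
            \<open>q < r k\<close>, its exit from \<open>K k\<close>, which occurs before
            \<open>s\<close>, cannot be through the outer circle.\<close>
          have "compact ((\<lambda>t. g (Z t \<omega>)) ` {t0..s})"
          proof (rule compact_continuous_image)
            show "continuous_on {t0..s} (\<lambda>t. g (Z t \<omega>))"
              by (rule continuous_on_compose2[OF continuous_g[OF order_refl] continuous_on_subset[OF elim(3)]])
                 (use t0 inU in auto)
          qed simp
          moreover have "(\<lambda>t. g (Z t \<omega>)) ` {t0..s} \<subseteq> ball 0 1" using inU t0 cmod_g by auto
          ultimately obtain q where q: "q < 1" "\<And>z. z \<in> (\<lambda>t. g (Z t \<omega>)) ` {t0..s} \<Longrightarrow> cmod z \<le> q"
            by (rule compact_subset_unit_ball) (rule that)
          have "eventually (\<lambda>k. q < r k) sequentially" using rlim q(1) by (rule order_tendstoD)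
          then obtain N where N: "\<And>k. N \<le> k \<Longrightarrow> q < r k" by (auto simp: eventually_sequentially)
          have "\<omega> \<in> F k" if k: "N \<le> k" for k
          proof -
            have gt0: "cmod (g (Z t0 \<omega>)) \<le> q" using q(2) s by auto
            have C: "Z t0 \<omega> \<in> C k" using False gt0 N[OF k] inU t0 by (simp add: CC)
            then have "Z t0 \<omega> \<in> K k" using r02 by (simp add: CC KK)
            then obtain \<tau> where \<tau>: "\<tau> \<ge> t0" "\<And>s. t0 \<le> s \<Longrightarrow> s \<le> \<tau> \<Longrightarrow> Z s \<omega> \<in> K k"
              "exit_point (K k) t0 \<omega> = Z \<tau> \<omega>" "Z \<tau> \<omega> \<in> frontier (K k)" using elim(1) by blast
            have "\<tau> < s"
            proof (rule ccontr)
              assume "\<not> \<tau> < s"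
              then have "Z s \<omega> \<in> K k" using \<tau>(2)[of s] s by simp
              then show False using gs KK by auto
            qed
            then have "cmod (g (Z \<tau> \<omega>)) \<le> q" using q(2)[of "g (Z \<tau> \<omega>)"] \<tau>(1) by auto
            then have "cmod (g (Z \<tau> \<omega>)) = 1 / 2" using frK[OF \<tau>(4)] N[OF k] by auto
            then have "exit_point (K k) t0 \<omega> \<in> S" using frK[OF \<tau>(4)] \<tau>(3) by (simp add: SS)
            then show ?thesis using C elim(4) by (simp add: F_def)
          qed
          then have "\<omega> \<in> (\<Union>N. \<Inter>k\<in>{N..}. F k)" by (intro UN_I[of N]) auto
          then show ?thesis unfolding A_def by blast
        qed
      qed
    qed
    then show "\<exists>A\<in>events. prob A \<le> e \<and> (AE \<omega> in M. (\<forall>s\<ge>0. Z s \<omega> \<in> U) \<longrightarrow> \<omega> \<in> A)"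
      using Am pA by blast
  qed
  then show ?thesis by simp
qed

corollary AE_exit_time_finite: "AE \<omega> in M. exit_time Z U \<omega> < \<infinity>"
  using AE_exits
proof eventually_elim
  case (elim \<omega>)
  then obtain s where "0 \<le> s" "Z s \<omega> \<notin> U" by blast
  then have "exit_time Z U \<omega> \<le> ennreal s" unfolding exit_time_def by (intro Inf_lower) auto
  also have "\<dots> < \<infinity>" by simp
  finally show ?case .
qed

section \<open>Convergence of the exit points along an exhaustion\<close>

definition radius :: "nat \<Rightarrow> real" where "radius n = 1 - 1 / (real n + 2)"

lemma radius: "0 < radius n" "radius n < 1"
  by (auto simp: radius_def field_simps)

lemma radius_tendsto: "radius \<longlonglongrightarrow> 1"
  unfolding radius_def by real_asymp

abbreviation exit_disc :: "nat \<Rightarrow> 'a \<Rightarrow> complex" where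
  "exit_disc n \<equiv> exit_point (f ` cball 0 (radius n)) 0"

lemma compact_disc: "compact (f ` cball 0 (radius n))"
  by (rule compact_image) (use radius[of n] in auto)

lemma AE_exit_disc_tendsto: "AE \<omega> in M. (\<lambda>n. exit_disc n \<omega>) \<longlonglongrightarrow> exit_position Z U \<omega>"
proof -
  let ?K = "\<lambda>n. f ` cball 0 (radius n)"
  have "AE \<omega> in M. \<forall>n. Z 0 \<omega> \<in> ?K n \<longrightarrow> (\<exists>\<tau>\<ge>0. (\<forall>s. 0 \<le> s \<and> s \<le> \<tau> \<longrightarrow> Z s \<omega> \<in> ?K n) \<and>
      exit_disc n \<omega> = Z \<tau> \<omega> \<and> (\<forall>e>0. \<exists>s>\<tau>. s < \<tau> + e \<and> Z s \<omega> \<notin> ?K n))"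
  proof (subst AE_all_countable, intro allI)
    fix n
    show "AE \<omega> in M. Z 0 \<omega> \<in> ?K n \<longrightarrow> (\<exists>\<tau>\<ge>0. (\<forall>s. 0 \<le> s \<and> s \<le> \<tau> \<longrightarrow> Z s \<omega> \<in> ?K n) \<and>
      exit_disc n \<omega> = Z \<tau> \<omega> \<and> (\<forall>e>0. \<exists>s>\<tau>. s < \<tau> + e \<and> Z s \<omega> \<notin> ?K n))"
      using AE_exit_point[OF order_refl compact_disc[of n]] by (rule eventually_mono) blast
  qed
  then show ?thesis using AE_exits continuous_paths start
  proof eventually_elim
    case (elim \<omega>)
    have in0: "0 \<in> ?K n" for n using f_0 radius[of n] by (auto intro!: image_eqI[of _ _ 0])
    have sub: "?K n \<subseteq> U" for n using radius[of n] by (auto simp: U_def)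
    have "\<forall>n. \<exists>\<tau>\<ge>0. (\<forall>s. 0 \<le> s \<and> s \<le> \<tau> \<longrightarrow> Z s \<omega> \<in> ?K n) \<and>
      exit_disc n \<omega> = Z \<tau> \<omega> \<and> (\<forall>e>0. \<exists>s>\<tau>. s < \<tau> + e \<and> Z s \<omega> \<notin> ?K n)"
      using elim(1) in0 elim(4) by simp
    then obtain \<tau> where \<tau>: "\<And>n. 0 \<le> \<tau> n" "\<And>n s. 0 \<le> s \<Longrightarrow> s \<le> \<tau> n \<Longrightarrow> Z s \<omega> \<in> ?K n"
      "\<And>n. exit_disc n \<omega> = Z (\<tau> n) \<omega>" "\<And>n e. 0 < e \<Longrightarrow> \<exists>s>\<tau> n. s < \<tau> n + e \<and> Z s \<omega> \<notin> ?K n"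
      by metis
    obtain s1 where s1: "0 \<le> s1" "Z s1 \<omega> \<notin> U" using elim(2) by blast
    have "(\<lambda>n. Z (\<tau> n) \<omega>) \<longlonglongrightarrow> exit_position Z U \<omega>"
    proof (rule exit_points_tendsto_exit_position[where K="?K"])
      show "Z 0 \<omega> \<in> U" using elim(4) in0[of 0] sub[of 0] by auto
      show "eventually (\<lambda>n. A \<subseteq> ?K n) sequentially" if "compact A" "A \<subseteq> U" for A
        by (rule compact_exhaustion[OF that radius_tendsto])
    qed (use elim(3) open_U s1 sub \<tau> in auto)
    then show ?case by (simp add: \<tau>(3))
  qed
qed

text \<open>A Borel version of the exit position.\<close>

definition exit_limit :: "'a \<Rightarrow> complex" where "exit_limit \<omega> = lim (\<lambda>n. exit_disc n \<omega>)"

lemma borel_measurable_exit_disc [measurable]: "exit_disc n \<in> borel_measurable M"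
  by (rule borel_measurable_exit_point) (use compact_disc compact_imp_closed in auto)

lemma borel_measurable_exit_limit [measurable]: "exit_limit \<in> borel_measurable M"
  unfolding exit_limit_def[abs_def] by (intro borel_measurable_lim_metric borel_measurable_exit_disc)

lemma AE_exit_limit: "AE \<omega> in M. exit_position Z U \<omega> = exit_limit \<omega> \<and> (\<lambda>n. exit_disc n \<omega>) \<longlonglongrightarrow> exit_limit \<omega>"
  using AE_exit_disc_tendsto by eventually_elim (auto simp: exit_limit_def limI)

lemma borel_measurable_boundary_circle_radius [measurable]: "boundary_circle (radius n) \<in> borel_measurable borel"
  by (rule borel_measurable_boundary_circle[OF radius])

text \<open>Almost sure convergence of the exit points, read through their laws, becomes weak
  convergence of the images of the circles of radius \<open>radius n\<close>.\<close>

lemma integral_boundary_circle_tendsto: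
  fixes \<phi> :: "complex \<Rightarrow> real"
  assumes \<phi>: "continuous_on UNIV \<phi>" and bd: "\<And>z. 0 \<le> \<phi> z \<and> \<phi> z \<le> 1"
  shows "(\<lambda>n. \<integral>\<zeta>. \<phi> (boundary_circle (radius n) \<zeta>) \<partial>circle_measure) \<longlonglongrightarrow> expectation (\<lambda>\<omega>. \<phi> (exit_limit \<omega>))"
proof -
  have [measurable]: "\<phi> \<in> borel_measurable borel" using \<phi> by (rule borel_measurable_continuous_onI)
  have "(\<lambda>n. expectation (\<lambda>\<omega>. \<phi> (exit_disc n \<omega>))) \<longlonglongrightarrow> expectation (\<lambda>\<omega>. \<phi> (exit_limit \<omega>))"
  proof (rule integral_dominated_convergence[where w="\<lambda>_. 1"])
    show "AE \<omega> in M. (\<lambda>n. \<phi> (exit_disc n \<omega>)) \<longlonglongrightarrow> \<phi> (exit_limit \<omega>)"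
      using AE_exit_limit by eventually_elim (use continuous_on_tendsto_compose[OF \<phi>] in auto)
  qed (use bd in auto)
  then show ?thesis by (simp add: expectation_exit_disc[OF radius \<phi>])
qed

text \<open>Radial limits cannot be infinite on a set of positive measure: the laws of \<open>f (r \<zeta>)\<close> are
  tight as \<open>r \<rightarrow> 1\<close>, being the laws of exit points that converge almost surely.\<close>

lemma AE_not_tendsto_infinity:
  "AE \<zeta> in circle_measure. \<not> filterlim (\<lambda>n. boundary_circle (radius n) \<zeta>) at_infinity sequentially"
proof -
  let ?b = "\<lambda>n. boundary_circle (radius n)"
  \<comment> \<open>Divergence to infinity written with countable quantifiers, so that the set is
    Borel.\<close>
  define B where "B = {\<zeta>. \<forall>k::nat. \<exists>N. \<forall>n\<ge>N. real k \<le> cmod (?b n \<zeta>)}"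
  have Bm [measurable]: "B \<in> sets borel"
  proof -
    have "{\<zeta> \<in> space borel. \<forall>k::nat. \<exists>N. \<forall>n\<in>{N..}. real k \<le> cmod (?b n \<zeta>)} \<in> sets borel" by measurable
    then show ?thesis by (simp add: B_def Ball_def)
  qed
  \<comment> \<open>A continuous ramp from 0 at modulus \<open>R\<close> to 1 at modulus
    \<open>R + 1\<close>. Along points of \<open>B\<close> it tends to 1 for each \<open>R\<close>,
    whereas its mean under the law of \<open>exit_limit\<close> vanishes as \<open>R\<close>
    grows.\<close>
  define \<phi> where "\<phi> = (\<lambda>(R::nat) (w::complex). min 1 (max 0 (cmod w - real R)))"
  have \<phi>c: "continuous_on UNIV (\<phi> R)" for R unfolding \<phi>_def by (intro continuous_intros)
  have [measurable]: "\<phi> R \<in> borel_measurable borel" for R using \<phi>c by (rule borel_measurable_continuous_onI)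
  have bd: "0 \<le> \<phi> R z \<and> \<phi> R z \<le> 1" for R z by (auto simp: \<phi>_def)
  have le: "measure circle_measure B \<le> expectation (\<lambda>\<omega>. \<phi> R (exit_limit \<omega>))" for R
  proof (rule LIMSEQ_le)
    show "(\<lambda>n. \<integral>\<zeta>. \<phi> R (?b n \<zeta>) \<partial>circle_measure) \<longlonglongrightarrow> expectation (\<lambda>\<omega>. \<phi> R (exit_limit \<omega>))"
      by (rule integral_boundary_circle_tendsto[OF \<phi>c bd])
    have "(\<lambda>n. \<integral>\<zeta>. indicator B \<zeta> * \<phi> R (?b n \<zeta>) \<partial>circle_measure) \<longlonglongrightarrow> (\<integral>\<zeta>. indicator B \<zeta> \<partial>circle_measure)"
    proof (rule integral_dominated_convergence[where w="\<lambda>_. 1"])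
      show "AE \<zeta> in circle_measure. (\<lambda>n. indicator B \<zeta> * \<phi> R (?b n \<zeta>)) \<longlonglongrightarrow> indicator B \<zeta>"
      proof (intro AE_I2)
        fix \<zeta>
        show "(\<lambda>n. indicator B \<zeta> * \<phi> R (?b n \<zeta>)) \<longlonglongrightarrow> indicator B \<zeta>"
        proof (cases "\<zeta> \<in> B")
          case True
          then obtain N where N: "\<forall>n\<ge>N. real (R + 1) \<le> cmod (?b n \<zeta>)" unfolding B_def by blast
          have "eventually (\<lambda>n. indicator B \<zeta> * \<phi> R (?b n \<zeta>) = indicator B \<zeta>) sequentially"
            using eventually_ge_at_top[of N]
          proof eventually_elim
            case (elim n)
            then have "real R + 1 \<le> cmod (?b n \<zeta>)" using N by auto
            then show ?case by (simp add: \<phi>_def)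
          qed
          then show ?thesis by (rule tendsto_eventually)
        qed simp
      qed
      show "AE \<zeta> in circle_measure. norm (indicator B \<zeta> * \<phi> R (?b n \<zeta>)) \<le> 1" for n
        using bd by (auto simp: indicator_def)
    qed auto
    then show "(\<lambda>n. \<integral>\<zeta>. indicator B \<zeta> * \<phi> R (?b n \<zeta>) \<partial>circle_measure) \<longlonglongrightarrow> measure circle_measure B" by simp
    have "(\<integral>\<zeta>. indicator B \<zeta> * \<phi> R (?b n \<zeta>) \<partial>circle_measure) \<le> (\<integral>\<zeta>. \<phi> R (?b n \<zeta>) \<partial>circle_measure)" for n
      by (rule integral_mono; (rule circle.integrable_const_bound[of _ 1])?)
         (use bd in \<open>auto simp: indicator_def\<close>)
    then show "\<exists>N. \<forall>n\<ge>N. (\<integral>\<zeta>. indicator B \<zeta> * \<phi> R (?b n \<zeta>) \<partial>circle_measure) \<le> (\<integral>\<zeta>. \<phi> R (?b n \<zeta>) \<partial>circle_measure)" by blast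
  qed
  have "(\<lambda>R. expectation (\<lambda>\<omega>. \<phi> R (exit_limit \<omega>))) \<longlonglongrightarrow> expectation (\<lambda>\<omega>. 0)"
  proof (rule integral_dominated_convergence[where w="\<lambda>_. 1"])
    show "AE \<omega> in M. (\<lambda>R. \<phi> R (exit_limit \<omega>)) \<longlonglongrightarrow> 0"
    proof (intro AE_I2)
      fix \<omega>
      obtain N where N: "cmod (exit_limit \<omega>) \<le> real N" using real_arch_simple by blast
      have "eventually (\<lambda>R. \<phi> R (exit_limit \<omega>) = 0) sequentially"
        using eventually_ge_at_top[of N] by eventually_elim (use N in \<open>auto simp: \<phi>_def\<close>)
      then show "(\<lambda>R. \<phi> R (exit_limit \<omega>)) \<longlonglongrightarrow> 0" by (rule tendsto_eventually)
    qed
  qed (use bd in auto)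
  then have "(\<lambda>R. expectation (\<lambda>\<omega>. \<phi> R (exit_limit \<omega>))) \<longlonglongrightarrow> 0" by simp
  then have "measure circle_measure B \<le> 0" using le by (intro LIMSEQ_le_const) auto
  then have "B \<in> null_sets circle_measure"
    using Bm by (intro null_setsI) (auto simp: circle.emeasure_eq_measure measure_le_0_iff)
  then have "AE \<zeta> in circle_measure. \<zeta> \<notin> B" by (rule AE_not_in)
  then show ?thesis
  proof eventually_elim
    case (elim \<zeta>)
    show ?case
    proof
      assume "filterlim (\<lambda>n. ?b n \<zeta>) at_infinity sequentially"
      then have "filterlim (\<lambda>n. cmod (?b n \<zeta>)) at_top sequentially" by (rule filterlim_at_infinity_imp_norm_at_top)
      then have "\<zeta> \<in> B" unfolding B_def filterlim_at_top eventually_sequentially by blast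
      then show False using elim by simp
    qed
  qed
qed

section \<open>Finite radial limits and their law\<close>

lemma radius_filterlim: "filterlim radius (at_left 1) sequentially"
  unfolding filterlim_at using radius_tendsto radius by (auto intro!: always_eventually less_imp_neq)

lemma AE_has_radial_limit: "AE \<zeta> in circle_measure. has_radial_limit f \<zeta>"
  using AE_circle_measureI_null[OF AE_univalent_radial_limit_or_infinity[OF holomorphic inj]]
    AE_not_tendsto_infinity AE_circle_measure_norm
proof eventually_elim
  case (elim \<zeta>)
  have "\<not> filterlim (\<lambda>r. f (of_real r * \<zeta>)) at_infinity (at_left 1)"
  proof
    assume "filterlim (\<lambda>r. f (of_real r * \<zeta>)) at_infinity (at_left 1)"
    then have "filterlim (\<lambda>n. f (of_real (radius n) * \<zeta>)) at_infinity sequentially"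
      by (rule filterlim_compose[OF _ radius_filterlim])
    then show False using elim(2,3) by (simp add: boundary_circle_def)
  qed
  then show ?case using elim(1) by blast
qed

text \<open>A Borel version of the radial limit, taken along the radii \<open>radius n\<close>
  only.\<close>

definition boundary_limit :: "complex \<Rightarrow> complex" where
  "boundary_limit \<zeta> = lim (\<lambda>n. boundary_circle (radius n) \<zeta>)"

lemma borel_measurable_boundary_limit [measurable]: "boundary_limit \<in> borel_measurable borel"
  unfolding boundary_limit_def[abs_def] by (intro borel_measurable_lim_metric borel_measurable_boundary_circle_radius)

lemma AE_boundary_limit:
  "AE \<zeta> in circle_measure. radial_limit f \<zeta> = boundary_limit \<zeta> \<and> (\<lambda>n. boundary_circle (radius n) \<zeta>) \<longlonglongrightarrow> boundary_limit \<zeta>"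
  using AE_has_radial_limit AE_circle_measure_norm
proof eventually_elim
  case (elim \<zeta>)
  then obtain L where L: "((\<lambda>r. f (of_real r * \<zeta>)) \<longlongrightarrow> L) (at_left 1)" unfolding has_radial_limit_def by blast
  have "radial_limit f \<zeta> = L" unfolding radial_limit_def by (rule tendsto_Lim[OF _ L]) simp
  moreover have "(\<lambda>n. f (of_real (radius n) * \<zeta>)) \<longlonglongrightarrow> L" by (rule filterlim_compose[OF L radius_filterlim])
  then have "(\<lambda>n. boundary_circle (radius n) \<zeta>) \<longlonglongrightarrow> L" using elim(2) by (simp add: boundary_circle_def)
  ultimately show ?case by (auto simp: boundary_limit_def limI)
qed

text \<open>The integrals of a test function over the circles of radius \<open>radius n\<close>
  converge to both expectations: through the exit points to one, through the radial limits to the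
  other.\<close>

theorem distr_exit_limit: "distr M borel exit_limit = distr circle_measure borel boundary_limit"
proof (rule measure_eqI_bounded_continuous)
  fix \<phi> :: "complex \<Rightarrow> real" assume \<phi>: "continuous_on UNIV \<phi>" and bd: "\<And>z. 0 \<le> \<phi> z \<and> \<phi> z \<le> 1"
  have [measurable]: "\<phi> \<in> borel_measurable borel" using \<phi> by (rule borel_measurable_continuous_onI)
  have "(\<lambda>n. \<integral>\<zeta>. \<phi> (boundary_circle (radius n) \<zeta>) \<partial>circle_measure) \<longlonglongrightarrow> (\<integral>\<zeta>. \<phi> (boundary_limit \<zeta>) \<partial>circle_measure)"
  proof (rule integral_dominated_convergence[where w="\<lambda>_. 1"])
    show "AE \<zeta> in circle_measure. (\<lambda>n. \<phi> (boundary_circle (radius n) \<zeta>)) \<longlonglongrightarrow> \<phi> (boundary_limit \<zeta>)"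
      using AE_boundary_limit by eventually_elim (use continuous_on_tendsto_compose[OF \<phi>] in auto)
  qed (use bd in auto)
  from LIMSEQ_unique[OF this integral_boundary_circle_tendsto[OF \<phi> bd]]
  show "integral\<^sup>L (distr M borel exit_limit) \<phi> = integral\<^sup>L (distr circle_measure borel boundary_limit) \<phi>"
    by (simp add: integral_distr)
qed (auto intro!: prob_space_distr circle.prob_space_distr)

end

theorem theorem3:
  fixes f :: "complex \<Rightarrow> complex"
    and M :: "'a measure" and Z :: "real \<Rightarrow> 'a \<Rightarrow> complex"
    and N :: "'b measure" and \<xi> :: "'b \<Rightarrow> complex"
  assumes "f holomorphic_on ball 0 1" and "inj_on f (ball 0 1)" and "f 0 = 0"
    and "standard_planar_brownian_motion M Z"
    and "uniform_on_circle N \<xi>"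
  defines "U \<equiv> f ` ball 0 1"
  shows "(AE \<omega> in M. exit_time Z U \<omega> < \<infinity>) \<and>
         (AE \<zeta> in circle_measure. has_radial_limit f \<zeta>) \<and>
         same_distribution M (exit_position Z U) N (\<lambda>\<omega>. radial_limit f (\<xi> \<omega>))"
proof -
  interpret standard_planar_brownian_motion M Z by fact
  interpret univalent_brownian_motion M Z f
    by unfold_locales (use assms(1-3) in auto)
  have U: "U = univalent_on_disc.U f" by (simp add: assms(6) U_def)
  have [measurable]: "\<xi> \<in> borel_measurable N" and \<xi>: "distr N borel \<xi> = circle_measure"
    using assms(5) by (auto simp: uniform_on_circle_def)
  have m: "(\<lambda>\<omega>. boundary_limit (\<xi> \<omega>)) \<in> borel_measurable N" by measurable
  \<comment> \<open>\<xi> enters only through its law, so the almost everywhere identity on the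
    circle is pulled back along it.\<close>
  have "AE \<zeta> in distr N borel \<xi>. radial_limit f \<zeta> = boundary_limit \<zeta>"
    unfolding \<xi> using AE_boundary_limit by eventually_elim simp
  then have ae: "AE \<omega> in N. radial_limit f (\<xi> \<omega>) = boundary_limit (\<xi> \<omega>)"
    by (rule AE_distrD[rotated]) simp
  have ae': "AE \<omega> in M. exit_position Z U \<omega> = exit_limit \<omega>"
    unfolding U using AE_exit_limit by eventually_elim simp
  have "distr N borel (\<lambda>\<omega>. boundary_limit (\<xi> \<omega>)) = distr (distr N borel \<xi>) borel boundary_limit"
    by (subst distr_distr) (auto simp: o_def)
  then have "same_distribution M (exit_position Z U) N (\<lambda>\<omega>. radial_limit f (\<xi> \<omega>))"
    unfolding same_distribution_def
    using AE_eq_imp_measurable_completion[OF borel_measurable_exit_limit ae']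
      AE_eq_imp_measurable_completion[OF m ae] distr_exit_limit by (simp add: \<xi>)
  then show ?thesis using AE_exit_time_finite AE_has_radial_limit by (simp add: U)
qed

end
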